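(* Let $d\geq2$, $p\geq2$, $0<s<1$, with $sp<d$ and $sp\neq1$. Let $A:\mathbb{R}^d\times\mathbb{R}^d\to(0,\infty)$ be measurable, symmetric ($A(\mathbf{x},\mathbf{y})=A(\mathbf{y},\mathbf{x})$), with $0<\frac1\Lambda\leq A(\mathbf{x},\mathbf{y})\leq\Lambda$ for all $\mathbf{x},\mathbf{y}\in\mathbb{R}^d$. Assume $\mathbf{f}\in[L^{p'_\ast}_{loc}(\mathbb{R}^d)]^d$ and that $\mathbf{u}\in[W^{s,p}(\mathbb{R}^d)]^d$ satisfies $$\mathcal{E}_{p,A}(\mathbf{u},\boldsymbol{\varphi})=\int_{\mathbb{R}^d}\mathbf{f}(\mathbf{x})\cdot\boldsymbol{\varphi}(\mathbf{x})\,d\mathbf{x}\qquad\text{for all }\boldsymbol{\varphi}\in[C_c^\infty(\mathbb{R}^d)]^d.$$ Let $B=B_r(\mathbf{x}_0)\subset\mathbb{R}^d$ be a ball, and let $\psi\in C_c^\infty(B)$ be such that $0\leq\psi\leq1$, $\operatorname{supp}\psi\subset\frac12B$ and $|\nabla\psi|\leq\frac{C(d)}{r}$, where $C(d)$ is a constant depending only on $d$. Then $$\begin{aligned}\int_B\int_B\frac{|\psi(\mathbf{x})\mathbf{u}(\mathbf{x})-\psi(\mathbf{y})\mathbf{u}(\mathbf{y})|^p}{|\mathbf{x}-\mathbf{y}|^{d+sp}}\,d\mathbf{y}\,d\mathbf{x}&\leq\frac{C}{r^{sp}}\int_B|\mathbf{u}(\mathbf{x})|^p\,d\mathbf{x}+C\int_{\mathbb{R}^d\setminus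 B}\frac{|\mathbf{u}(\mathbf{y})|^{p-1}}{|\mathbf{x}_0-\mathbf{y}|^{d+sp}}\,d\mathbf{y}\int_B|\mathbf{u}(\mathbf{x})|\,d\mathbf{x}\\&\quad+C\,r^{d+sp'}\left(\frac{1}{|B|}\int_B|\mathbf{f}(\mathbf{x})|^{p'_\ast}\,d\mathbf{x}\right)^{p'/p'_\ast}\end{aligned}$$ for some $C=C(d,s,p,\Lambda)>0$.
   Context: The projected difference is $\mathcal{D}(\mathbf{u})(\mathbf{x},\mathbf{y}):=(\mathbf{u}(\mathbf{x})-\mathbf{u}(\mathbf{y}))\cdot\frac{\mathbf{x}-\mathbf{y}}{|\mathbf{x}-\mathbf{y}|}$, and $$\mathcal{E}_{p,A}(\mathbf{u},\boldsymbol{\varphi}) := \int_{\mathbb{R}^d}\int_{\mathbb{R}^d}\frac{A(\mathbf{x},\mathbf{y})}{|\mathbf{x}-\mathbf{y}|^{d+sp}}|\mathcal{D}(\mathbf{u})(\mathbf{x},\mathbf{y})|^{p-2}\,\mathcal{D}(\mathbf{u})(\mathbf{x},\mathbf{y})\,\mathcal{D}(\boldsymbol{\varphi})(\mathbf{x},\mathbf{y})\,d\mathbf{y}\,d\mathbf{x}.$$ $p'$ is the Hölder conjugate of $p$, $\frac1p+\frac1{p'}=1$, and $p'_\ast:=\frac{p'd}{d+p's}$. $[W^{s,p}(\mathbb{R}^d)]^d$ is the space of $\mathbf{u}\in[L^p(\mathbb{R}^d)]^d$ with $\int_{\mathbb{R}^d}\int_{\mathbb{R}^d}\frac{|\mathbf{u}(\mathbf{x})-\mathbf{u}(\mathbf{y})|^p}{|\mathbf{x}-\mathbf{y}|^{d+sp}}\,d\mathbf{y}\,d\mathbf{x}<\infty$.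 $B_r(\mathbf{x}_0)$ is the ball of radius $r>0$ centered at $\mathbf{x}_0$ and $\frac12B:=B_{r/2}(\mathbf{x}_0)$. *)

theory Defs
  imports "HOL-Analysis.Analysis"
begin

text \<open>Euclidean space of dimension d is \<^typ>\<open>real ^ 'n\<close> with d = \<^term>\<open>CARD('n)\<close>. Measurability and
  integrals refer to \<^const>\<open>lebesgue\<close>, the completed measure. Singular kernels such as
  1 / norm (x - y) powr a take the value 0 on the diagonal, which is a null set.\<close>

definition projected_difference :: "(real ^ 'n \<Rightarrow> real ^ 'n) \<Rightarrow> real ^ 'n \<Rightarrow> real ^ 'n \<Rightarrow> real"
  where "projected_difference u x y = (u x - u y) \<bullet> ((x - y) /\<^sub>R norm (x - y))"

text \<open>For p = 2 the factor \<open>\<bar>D\<bar> powr (p - 2)\<close> is 0 rather than 1 where D = 0; this is harmless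
  because it is multiplied by D.\<close>

definition nonlocal_form ::
    "real \<Rightarrow> real \<Rightarrow> (real ^ 'n \<Rightarrow> real ^ 'n \<Rightarrow> real)
      \<Rightarrow> (real ^ 'n \<Rightarrow> real ^ 'n) \<Rightarrow> (real ^ 'n \<Rightarrow> real ^ 'n) \<Rightarrow> real"
  where "nonlocal_form p s A u \<phi> =
    (LINT x|lebesgue. LINT y|lebesgue.
       A x y / norm (x - y) powr (real CARD('n) + s * p)
         * \<bar>projected_difference u x y\<bar> powr (p - 2)
         * projected_difference u x y * projected_difference \<phi> x y)"

definition in_Lp :: "real \<Rightarrow> (real ^ 'n) set \<Rightarrow> (real ^ 'n \<Rightarrow> real ^ 'n) \<Rightarrow> bool"
  where "in_Lp p K u \<longleftrightarrow>
    set_borel_measurable lebesgue K u \<and>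
    (\<integral>\<^sup>+x\<in>K. ennreal (norm (u x) powr p) \<partial>lebesgue) < \<infinity>"

definition in_Lp_loc :: "real \<Rightarrow> (real ^ 'n \<Rightarrow> real ^ 'n) \<Rightarrow> bool"
  where "in_Lp_loc p u \<longleftrightarrow> (\<forall>K. compact K \<longrightarrow> in_Lp p K u)"

definition gagliardo ::
    "real \<Rightarrow> real \<Rightarrow> (real ^ 'n) set \<Rightarrow> (real ^ 'n \<Rightarrow> real ^ 'n) \<Rightarrow> ennreal"
  where "gagliardo s p S u =
    (\<integral>\<^sup>+x\<in>S. (\<integral>\<^sup>+y\<in>S.
        ennreal (norm (u x - u y) powr p / norm (x - y) powr (real CARD('n) + s * p))
      \<partial>lebesgue) \<partial>lebesgue)"

definition fractional_sobolev :: "real \<Rightarrow> real \<Rightarrow> (real ^ 'n \<Rightarrow> real ^ 'n) set"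
  where "fractional_sobolev s p = {u. in_Lp p UNIV u \<and> gagliardo s p UNIV u < \<infinity>}"

primrec Ck :: "nat \<Rightarrow> ('a::real_normed_vector \<Rightarrow> 'b::real_normed_vector) \<Rightarrow> bool"
  where
    "Ck 0 f \<longleftrightarrow> continuous_on UNIV f"
  | "Ck (Suc k) f \<longleftrightarrow> f differentiable_on UNIV \<and>
       (\<forall>v. Ck k (\<lambda>x. frechet_derivative f (at x) v))"

definition supp :: "('a::topological_space \<Rightarrow> 'b::zero) \<Rightarrow> 'a set"
  where "supp f = closure {x. f x \<noteq> 0}"

text \<open>The functions in \<open>C\<^sub>c\<^sup>\<infinity>(\<Omega>)\<close>, extended by 0 to the whole space.\<close>

definition test_functions ::
    "'a::real_normed_vector set \<Rightarrow> ('a \<Rightarrow> 'b::real_normed_vector) set"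
  where "test_functions \<Omega> = {\<phi>. (\<forall>k. Ck k \<phi>) \<and> compact (supp \<phi>) \<and> supp \<phi> \<subseteq> \<Omega>}"

definition gradient :: "(real ^ 'n \<Rightarrow> real) \<Rightarrow> real ^ 'n \<Rightarrow> real ^ 'n"
  where "gradient f x = (\<chi> i. frechet_derivative f (at x) (axis i 1))"

text \<open>With p' the Hoelder conjugate of p, this is the Hoelder conjugate of the fractional Sobolev
  exponent d p / (d - s p).\<close>

definition lower_star_exponent :: "real \<Rightarrow> real \<Rightarrow> real \<Rightarrow> real"
  where "lower_star_exponent d s p' = p' * d / (d + p' * s)"

end

theory Submission
  imports Defs
begin

text \<open>
  One tests the equation with \<open>\<psi>\<^sup>p u\<close>. A pointwise inequality turns the energy into the projected
  Gagliardo seminorm of \<open>w = \<psi> u\<close> up to the first two terms of the right-hand side. The force term is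
  absorbed by Hoelder's inequality and the fractional Sobolev inequality.

  The passage from the projected to the full seminorm of \<open>w\<close> (fractional Korn inequality on the whole
  space) is elementary: every second difference \<open>w(x + 2h) - 2 w(x + h) + w(x)\<close>, paired with any vector
  \<open>c\<close>, is a signed sum of six projected increments of \<open>w\<close> along \<open>h\<close>, \<open>c\<close> and \<open>h + c\<close>. With \<open>c\<close> ranging
  over finitely many linear images of \<open>h\<close>, this bounds the second differences, and a scaling argument
  recovers the first differences since \<open>s < 1\<close> and the seminorm of \<open>w\<close> is finite.

  Sobolev's inequality follows from Chebyshev's inequality on balls whose radius depends on the point.
  The test function \<open>\<psi>\<^sup>p u\<close> is not smooth; it is mollified with rescaled copies of \<open>\<psi>\<close> itself, and the
  equation passes to the limit by continuity of translations in \<open>L\<^sup>p\<close>. The data are first replaced by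
  Borel functions that agree with them almost everywhere.
\<close>

section \<open>Integrals over Euclidean space\<close>

text \<open>A term can be absorbed only if it is finite. This is secured in advance and only
  qualitatively: a Lipschitz multiple of \<open>u\<close> inherits a finite seminorm from
  \<open>u\<close>, and Sobolev's inequality is proved for bounded truncations first.

  The Korn and Sobolev inequalities hold on the whole space. The estimate is therefore made for the
  seminorm of \<open>\<psi> u\<close> over all pairs and restricted to the ball at the very end.
  Pairs with one point outside the ball need a lower bound as well, and they produce the tail term.

  The power \<open>\<psi>\<^sup>p\<close> is chosen because, for
  \<open>\<psi> y \<le> \<psi> x\<close>, the error \<open>\<psi> x powr p - \<psi> y powr p\<close>
  is at most \<open>p * \<psi> x powr (p - 1) * (\<psi> x - \<psi> y)\<close>; the factor
  \<open>\<psi> x powr (p - 1)\<close> is what a Young inequality needs to hide this error in the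
  main part.

  The limit under mollification rests on writing the integrand as a product of a flux in L^p' and a
  weighted difference in L^p on pairs. Mollifying the test function averages the second factor over
  diagonal translations.\<close>

lemma powr_sum_le:
  fixes a :: "'i \<Rightarrow> real"
  assumes "finite I" and "\<And>i. i \<in> I \<Longrightarrow> a i \<ge> 0" and "p > 0"
  shows "(\<Sum>i\<in>I. a i) powr p \<le> real (card I) powr p * (\<Sum>i\<in>I. a i powr p)"
proof (cases "I = {}")
  case False
  define m where "m = Max (a ` I)"
  have m: "m \<in> a ` I" using assms(1) False unfolding m_def by (intro Max_in) auto
  then obtain j where j: "j \<in> I" "m = a j" by auto
  have le: "a i \<le> m" if "i \<in> I" for i
    using assms(1) that unfolding m_def by auto
  have "(\<Sum>i\<in>I. a i) \<le> real (card I) * m"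
    using sum_bounded_above[of I a m] le by simp
  then have "(\<Sum>i\<in>I. a i) powr p \<le> (real (card I) * m) powr p"
    using assms by (intro powr_mono2 sum_nonneg) auto
  also have "\<dots> = real (card I) powr p * a j powr p"
    using assms(2)[OF j(1)] j by (simp add: powr_mult)
  also have "\<dots> \<le> real (card I) powr p * (\<Sum>i\<in>I. a i powr p)"
    using j(1) assms(1) by (intro mult_left_mono member_le_sum) auto
  finally show ?thesis .
qed auto

lemma powr_add_le:
  fixes a b p :: real
  assumes "a \<ge> 0" "b \<ge> 0" "p > 0"
  shows "(a + b) powr p \<le> 2 powr p * (a powr p + b powr p)"
  using powr_sum_le[of "{True, False}" "\<lambda>i. if i then a else b" p] assms by simp

text \<open>Convexity of t powr p at the points a / l and b / (1 - l). The weight l is left free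
  because \<open>fractional_korn\<close> needs a sharp coefficient in front of one term and can
  afford a large one in front of the other.\<close>

lemma powr_add_convex_le:
  fixes a b l p :: real
  assumes "a \<ge> 0" "b \<ge> 0" "p \<ge> 1" "0 < l" "l < 1"
  shows "(a + b) powr p \<le> l powr (1 - p) * a powr p + (1 - l) powr (1 - p) * b powr p"
proof -
  have "(l * (a / l) + (1 - l) * (b / (1 - l))) powr p
      \<le> l * (a / l) powr p + (1 - l) * (b / (1 - l)) powr p"
  \<comment> \<open>Convexity is applied between positive points only. If a summand vanishes, the
    claim reduces to l powr p \<le> l, or the same with 1 - l.\<close>
  proof (cases "a = 0 \<or> b = 0")
    case True
    have "t powr p \<le> t" if "0 < t" "t < 1" for t :: real
      using powr_mono'[of 1 p t] that assms by simp
    then have "l powr p \<le> l" "(1 - l) powr p \<le> 1 - l" using assms by auto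
    then have "l powr p * (a / l) powr p \<le> l * (a / l) powr p"
      "(1 - l) powr p * (b / (1 - l)) powr p \<le> (1 - l) * (b / (1 - l)) powr p"
      by (intro mult_right_mono; simp)+
    then show ?thesis using True assms by (auto simp: powr_mult[symmetric])
  next
    case False
    then show ?thesis
      using convex_onD[OF powr_convex[of p], of "1 - l" "a / l" "b / (1 - l)"] assms by simp
  qed
  also have "l * (a / l) powr p = l powr (1 - p) * a powr p"
    using assms by (simp add: powr_divide powr_diff)
  also have "(1 - l) * (b / (1 - l)) powr p = (1 - l) powr (1 - p) * b powr p"
    using assms by (simp add: powr_divide powr_diff)
  finally show ?thesis using assms by simp
qed

section \<open>Translations, dilations and linear changes of variables\<close>

lemma sets_borel_ball [measurable]: "ball (c::'a::metric_space) r \<in> sets borel"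
  by simp

lemma nn_integral_lborel_shift:
  fixes F :: "'a::euclidean_space \<Rightarrow> ennreal"
  assumes [measurable]: "F \<in> borel_measurable borel"
  shows "(\<integral>\<^sup>+x. F (x + c) \<partial>lborel) = (\<integral>\<^sup>+x. F x \<partial>lborel)"
proof -
  have "(\<integral>\<^sup>+x. F x \<partial>lborel) = (\<integral>\<^sup>+x. F x \<partial>distr lborel borel ((+) c))"
    by (simp add: lborel_distr_plus)
  also have "\<dots> = (\<integral>\<^sup>+x. F (c + x) \<partial>lborel)"
    by (subst nn_integral_distr) auto
  finally show ?thesis by (simp add: add.commute)
qed

lemma nn_integral_lborel_affine:
  fixes F :: "'a::euclidean_space \<Rightarrow> ennreal"
  assumes [measurable]: "F \<in> borel_measurable borel" and "c \<noteq> 0"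
  shows "(\<integral>\<^sup>+x. F x \<partial>lborel) = ennreal (\<bar>c\<bar> ^ DIM('a)) * (\<integral>\<^sup>+x. F (t + c *\<^sub>R x) \<partial>lborel)"
proof -
  have "(\<integral>\<^sup>+x. F x \<partial>lborel)
      = (\<integral>\<^sup>+x. F x \<partial>density (distr lborel borel (\<lambda>x. t + c *\<^sub>R x)) (\<lambda>_. \<bar>c\<bar>^DIM('a)))"
    using lborel_affine[OF assms(2), of t] by metis
  also have "\<dots> = (\<integral>\<^sup>+x. ennreal (\<bar>c\<bar>^DIM('a)) * F (t + c *\<^sub>R x) \<partial>lborel)"
    by (subst nn_integral_density) (auto simp: nn_integral_distr)
  also have "\<dots> = ennreal (\<bar>c\<bar>^DIM('a)) * (\<integral>\<^sup>+x. F (t + c *\<^sub>R x) \<partial>lborel)"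
    by (subst nn_integral_cmult) auto
  finally show ?thesis .
qed

lemma nn_integral_lborel_reflect:
  fixes F :: "'a::euclidean_space \<Rightarrow> ennreal"
  assumes [measurable]: "F \<in> borel_measurable borel"
  shows "(\<integral>\<^sup>+x. F (t - x) \<partial>lborel) = (\<integral>\<^sup>+x. F x \<partial>lborel)"
  using nn_integral_lborel_affine[OF assms, of "-1" t] by simp

text \<open>Both sides are translation invariant functionals of \<open>F\<close>, so they are compared by averaging
  over translations by the unit ball and exchanging the order of integration.\<close>

lemma nn_integral_lborel_linear_le:
  fixes N :: "'a::euclidean_space \<Rightarrow> 'a"
  assumes N: "linear N" "inj N"
  obtains C where "C > 0" and
    "\<And>F. F \<in> borel_measurable borel \<Longrightarrow>
      (\<integral>\<^sup>+h. F (N h) \<partial>lborel) \<le> ennreal C * (\<integral>\<^sup>+h. F h \<partial>lborel)"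
proof -
  obtain N' where N': "linear N'" "\<And>x. N' (N x) = x" "\<And>x. N (N' x) = x"
    using linear_injective_isomorphism[OF N] by blast
  obtain R where R: "R > 0" "\<And>x. norm (N' x) \<le> R * norm x"
    using linear_bounded_pos[OF N'(1)] by blast
  define v w where "v = measure lborel (ball (0::'a) 1)" and "w = measure lborel (ball (0::'a) R)"
  have v: "v > 0" "emeasure lborel (ball (0::'a) 1) = ennreal v"
    by (simp_all add: v_def content_ball_pos emeasure_ball measure_def)
  have w: "w > 0" "emeasure lborel (ball x R) = ennreal w" for x :: 'a
    using R(1) by (simp_all add: w_def content_ball_pos emeasure_ball measure_def)
  have m[measurable]: "N \<in> borel_measurable borel"
    using N(1) by (intro borel_measurable_continuous_onI linear_continuous_on) (simp add: linear_conv_bounded_linear)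
  show thesis
  proof (rule that[of "w / v"])
    show "w / v > 0" using v w(1) by simp
    fix F :: "'a \<Rightarrow> ennreal"
    assume [measurable]: "F \<in> borel_measurable borel"
    have "(\<integral>\<^sup>+x. F (N x) \<partial>lborel) * ennreal v
      = (\<integral>\<^sup>+y. indicator (ball 0 1) y * (\<integral>\<^sup>+x. F (N x) \<partial>lborel) \<partial>(lborel::'a measure))"
      by (subst nn_integral_multc) (auto simp: v mult.commute)
    \<comment> \<open>The inner integral does not change when x is shifted by N' y. As N (N' y) = y,
      this moves y into the argument of F.\<close>
    also have "\<dots> = (\<integral>\<^sup>+y. indicator (ball 0 1) y * (\<integral>\<^sup>+x. F (N (x + N' y)) \<partial>lborel) \<partial>(lborel::'a measure))"
      using nn_integral_lborel_shift[of "\<lambda>x. F (N x)"] by simp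
    also have "\<dots> = (\<integral>\<^sup>+y. (\<integral>\<^sup>+x. indicator (ball 0 1) y * F (y + N x) \<partial>lborel) \<partial>(lborel::'a measure))"
      using N' by (subst nn_integral_cmult[symmetric]) (auto simp: linear_add[OF N(1)] add.commute)
    also have "\<dots> = (\<integral>\<^sup>+x. (\<integral>\<^sup>+y. indicator (ball 0 1) y * F (y + N x) \<partial>lborel) \<partial>(lborel::'a measure))"
      by (rule lborel_pair.Fubini') measurable
    also have "\<dots> = (\<integral>\<^sup>+x. (\<integral>\<^sup>+y. indicator (ball 0 1) (y - N x) * F y \<partial>lborel) \<partial>(lborel::'a measure))"
      using nn_integral_lborel_shift[of "\<lambda>y. indicator (ball 0 1) (y - N x) * F y" "N x" for x] by simp
    also have "\<dots> = (\<integral>\<^sup>+y. (\<integral>\<^sup>+x. indicator (ball 0 1) (y - N x) * F y \<partial>lborel) \<partial>(lborel::'a measure))"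
      by (rule lborel_pair.Fubini') measurable
    \<comment> \<open>Now F depends on y alone, and norm (y - N x) < 1 forces x into the ball of
      radius R about N' y. The volume w of that ball is independent of y, so w / v takes the place
      of the inverse determinant.\<close>
    also have "\<dots> \<le> (\<integral>\<^sup>+y. (\<integral>\<^sup>+x. indicator (ball (N' y) R) x * F y \<partial>lborel) \<partial>(lborel::'a measure))"
    proof (intro nn_integral_mono mult_right_mono)
      fix x y :: 'a
      have "norm (N' y - x) < R" if "norm (y - N x) < 1"
      proof -
        have "norm (N' y - x) = norm (N' (y - N x))"
          by (simp add: linear_diff[OF N'(1)] N')
        also have "\<dots> \<le> R * norm (y - N x)" by (rule R)
        also have "\<dots> < R * 1" using that R(1) by (intro mult_strict_left_mono) auto
        finally show ?thesis by simp
      qed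
      then show "indicator (ball 0 1) (y - N x) \<le> (indicator (ball (N' y) R) x :: ennreal)"
        by (auto simp: indicator_def dist_norm norm_minus_commute)
    qed auto
    also have "\<dots> = (\<integral>\<^sup>+y. ennreal w * F y \<partial>(lborel::'a measure))"
      by (subst nn_integral_multc) (auto simp: w)
    also have "\<dots> = ennreal w * (\<integral>\<^sup>+y. F y \<partial>lborel)"
      by (subst nn_integral_cmult) auto
    finally have "(\<integral>\<^sup>+x. F (N x) \<partial>lborel) * ennreal v * ennreal (1 / v)
        \<le> ennreal w * (\<integral>\<^sup>+y. F y \<partial>lborel) * ennreal (1 / v)"
      by (rule mult_right_mono) simp
    moreover have "t * ennreal v * ennreal (1 / v) = t" for t
      using v(1) by (simp add: mult.assoc ennreal_mult'[symmetric])
    moreover have "ennreal (w / v) = ennreal w * ennreal (1 / v)"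
      using v(1) w(1) by (simp_all add: ennreal_mult'[symmetric])
    ultimately show "(\<integral>\<^sup>+h. F (N h) \<partial>lborel) \<le> ennreal (w / v) * (\<integral>\<^sup>+h. F h \<partial>lborel)"
      by (metis mult.assoc mult.commute)
  qed
qed

section \<open>Power kernels on dyadic annuli\<close>

lemma nn_integral_annulus_le:
  fixes \<beta> :: real
  obtains C where "C > 0" and
    "\<And>\<rho>. \<rho> > 0 \<Longrightarrow> (\<integral>\<^sup>+h. ennreal (norm h powr (-\<beta>))
        * indicator {h :: 'a::euclidean_space. \<rho> \<le> norm h \<and> norm h < 2 * \<rho>} h \<partial>lborel)
      \<le> ennreal (C * \<rho> powr (DIM('a) - \<beta>))"
proof -
  define v where "v = unit_ball_vol (real DIM('a))"
  have v: "v > 0" by (simp add: v_def)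
  define C where "C = 2 powr \<bar>\<beta>\<bar> * (v * 2 ^ DIM('a))"
  show thesis
  proof (rule that[of C])
    show "C > 0" using v by (simp add: C_def)
    fix \<rho> :: real assume \<rho>: "\<rho> > 0"
    \<comment> \<open>On the annulus norm h and \<rho> agree up to a factor 2. The absolute value in
      2 powr \<bar>\<beta>\<bar> treats decreasing and increasing powers alike.\<close>
    have pt: "norm h powr (-\<beta>) \<le> 2 powr \<bar>\<beta>\<bar> * \<rho> powr (-\<beta>)"
      if "\<rho> \<le> norm h" "norm h < 2 * \<rho>" for h :: 'a
    proof (cases "\<beta> \<ge> 0")
      case True
      have "norm h powr (-\<beta>) \<le> 1 * \<rho> powr (-\<beta>)"
        using powr_mono2'[of "-\<beta>" \<rho> "norm h"] that \<rho> True by simp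
      also have "\<dots> \<le> 2 powr \<bar>\<beta>\<bar> * \<rho> powr (-\<beta>)"
        by (intro mult_right_mono) (auto simp: ge_one_powr_ge_zero)
      finally show ?thesis .
    next
      case False
      have "norm h powr (-\<beta>) \<le> (2 * \<rho>) powr (-\<beta>)"
        using that \<rho> False by (intro powr_mono2) auto
      also have "\<dots> = 2 powr \<bar>\<beta>\<bar> * \<rho> powr (-\<beta>)"
        using \<rho> False by (simp add: powr_mult)
      finally show ?thesis .
    qed
    have "(\<integral>\<^sup>+h. ennreal (norm h powr (-\<beta>)) * indicator {h :: 'a. \<rho> \<le> norm h \<and> norm h < 2 * \<rho>} h \<partial>lborel)
      \<le> (\<integral>\<^sup>+h. ennreal (2 powr \<bar>\<beta>\<bar> * \<rho> powr (-\<beta>)) * indicator (ball (0::'a) (2 * \<rho>)) h \<partial>lborel)"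
      by (intro nn_integral_mono) (auto simp: indicator_def intro!: ennreal_leI pt)
    also have "\<dots> = ennreal (2 powr \<bar>\<beta>\<bar> * \<rho> powr (-\<beta>)) * emeasure lborel (ball (0::'a) (2 * \<rho>))"
      by (subst nn_integral_cmult_indicator) auto
    also have "emeasure lborel (ball (0::'a) (2 * \<rho>)) = ennreal (v * (2 * \<rho>) ^ DIM('a))"
      using \<rho> by (simp add: emeasure_ball v_def)
    also have "ennreal (2 powr \<bar>\<beta>\<bar> * \<rho> powr (-\<beta>)) * \<dots> = ennreal (C * \<rho> powr (DIM('a) - \<beta>))"
    proof -
      have "\<rho> powr (DIM('a) - \<beta>) = \<rho> powr (-\<beta>) * \<rho> ^ DIM('a)"
        using \<rho> by (simp add: powr_diff powr_minus powr_realpow divide_simps)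
      then show ?thesis using \<rho> v
        by (simp add: C_def ennreal_mult'[symmetric] power_mult_distrib mult_ac)
    qed
    finally show "(\<integral>\<^sup>+h. ennreal (norm h powr (-\<beta>)) * indicator {h :: 'a. \<rho> \<le> norm h \<and> norm h < 2 * \<rho>} h \<partial>lborel)
        \<le> ennreal (C * \<rho> powr (DIM('a) - \<beta>))" .
  qed
qed

text \<open>The summation step shared by the integrals near and away from the origin. The annuli
  need to cover only the points where F does not vanish, and they may overlap.\<close>

lemma nn_integral_annuli_le:
  fixes a b R :: real and F :: "'a::euclidean_space \<Rightarrow> ennreal"
  assumes pt: "\<And>h. F h \<noteq> 0 \<Longrightarrow> \<exists>k. F h \<le> ennreal (norm h powr (-\<beta>)) \<and> \<rho> k \<le> norm h \<and> norm h < 2 * \<rho> k"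
    and \<rho>: "\<And>k::nat. \<rho> k > 0"
    and ann: "\<And>\<rho>. \<rho> > 0 \<Longrightarrow> (\<integral>\<^sup>+h. ennreal (norm h powr (-\<beta>))
        * indicator {h :: 'a. \<rho> \<le> norm h \<and> norm h < 2 * \<rho>} h \<partial>lborel) \<le> ennreal (C * \<rho> powr e)"
    and s: "(\<lambda>k. C * \<rho> k powr e) sums T" and C: "C \<ge> 0"
  shows "(\<integral>\<^sup>+h. F h \<partial>lborel) \<le> ennreal T"
proof -
  let ?G = "\<lambda>k h. ennreal (norm h powr (-\<beta>)) * indicator {h :: 'a. \<rho> k \<le> norm h \<and> norm h < 2 * \<rho> k} h"
  have "(\<integral>\<^sup>+h. F h \<partial>lborel) \<le> (\<integral>\<^sup>+h. (\<Sum>k. ?G k h) \<partial>lborel)"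
  proof (intro nn_integral_mono)
    fix h :: 'a
    show "F h \<le> (\<Sum>k. ?G k h)"
    proof (cases "F h = 0")
      case False
      then obtain k where k: "F h \<le> ennreal (norm h powr (-\<beta>))" "\<rho> k \<le> norm h" "norm h < 2 * \<rho> k"
        using pt by blast
      then have "F h \<le> ?G k h" by simp
      also have "\<dots> \<le> (\<Sum>k. ?G k h)"
        using sum_le_suminf[of "\<lambda>k. ?G k h" "{k}"]
        by (simp only: sum.insert finite.intros empty_iff not_False_eq_True sum.empty add_0_right summableI) simp
      finally show ?thesis .
    qed simp
  qed
  also have "\<dots> = (\<Sum>k. \<integral>\<^sup>+h. ?G k h \<partial>lborel)"
    by (intro nn_integral_suminf) auto
  also have "\<dots> \<le> (\<Sum>k. ennreal (C * \<rho> k powr e))"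
    by (intro suminf_le ann \<rho>) auto
  also have "\<dots> = ennreal T"
    using s C by (intro suminf_ennreal_eq) auto
  finally show ?thesis .
qed

text \<open>The annuli of radii R * 2 ^ k cover the complement of the ball. Their contributions form
  a geometric series of ratio 2 powr (-a), which converges because a > 0.\<close>

lemma nn_integral_norm_powr_far:
  fixes a :: real
  assumes a: "a > 0"
  obtains C where "C > 0" and
    "\<And>R. R > 0 \<Longrightarrow> (\<integral>\<^sup>+h. ennreal (norm h powr (-(DIM('a) + a))) * indicator (- ball (0::'a::euclidean_space) R) h \<partial>lborel)
      \<le> ennreal (C * R powr (-a))"
proof -
  obtain C where C: "C > 0" and ann:
    "\<And>\<rho>. \<rho> > 0 \<Longrightarrow> (\<integral>\<^sup>+h. ennreal (norm h powr (-(DIM('a) + a)))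
        * indicator {h :: 'a. \<rho> \<le> norm h \<and> norm h < 2 * \<rho>} h \<partial>lborel)
      \<le> ennreal (C * \<rho> powr (DIM('a) - (DIM('a) + a)))"
    using nn_integral_annulus_le[where 'a='a, of "DIM('a) + a"] by blast
  define q where "q = (2::real) powr (-a)"
  have q: "0 < q" "q < 1" using a by (auto simp: q_def powr_less_one)
  show thesis
  proof (rule that[of "C / (1 - q)"])
    show "C / (1 - q) > 0" using C q by simp
    fix R :: real assume R: "R > 0"
    have sums: "(\<lambda>k. C * (R * 2 ^ k) powr (DIM('a) - (DIM('a) + a))) sums (C / (1 - q) * R powr (-a))"
    proof -
      have *: "C * (R * 2 ^ k) powr (DIM('a) - (DIM('a) + a)) = (C * R powr (-a)) * q ^ k" for k
        using R by (simp add: q_def powr_mult powr_realpow[symmetric] powr_powr mult.commute)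
      have "(\<lambda>k. (C * R powr (-a)) * q ^ k) sums ((C * R powr (-a)) * (1 / (1 - q)))"
        using q by (intro sums_mult geometric_sums) auto
      then show ?thesis unfolding * by (simp add: mult_ac)
    qed
    show "(\<integral>\<^sup>+h. ennreal (norm h powr (-(DIM('a) + a))) * indicator (- ball (0::'a) R) h \<partial>lborel)
      \<le> ennreal (C / (1 - q) * R powr (-a))"
    proof (rule nn_integral_annuli_le[OF _ _ ann sums])
      fix h :: 'a
      assume "ennreal (norm h powr (-(DIM('a) + a))) * indicator (- ball (0::'a) R) h \<noteq> 0"
      then have h: "norm h \<ge> R" by (auto simp: indicator_def split: if_splits)
      have pos: "norm h / R > 0" using h R by (auto intro!: divide_pos_pos)
      \<comment> \<open>The floor of the binary logarithm is the index of the annulus that contains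
        h.\<close>
      define m where "m = \<lfloor>log 2 (norm h / R)\<rfloor>"
      have "log 2 (norm h / R) \<ge> 0" using h R by (subst zero_le_log_cancel_iff) (auto intro!: divide_pos_pos)
      then have m0: "m \<ge> 0" by (simp add: m_def)
      have "2 powr real_of_int m \<le> norm h / R \<and> norm h / R < 2 powr (real_of_int m + 1)"
        using floor_log_eq_powr_iff[OF pos, of 2 m] by (simp add: m_def)
      moreover have "2 powr real_of_int m = 2 ^ nat m" using m0 by (simp add: powr_real_of_int)
      ultimately have "R * 2 ^ nat m \<le> norm h \<and> norm h < 2 * (R * 2 ^ nat m)"
        using R by (simp add: powr_add field_simps)
      then show "\<exists>k. ennreal (norm h powr (-(DIM('a) + a))) * indicator (- ball (0::'a) R) h
          \<le> ennreal (norm h powr (-(DIM('a) + a))) \<and> R * 2 ^ k \<le> norm h \<and> norm h < 2 * (R * 2 ^ k)"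
        by (intro exI[of _ "nat m"]) (auto simp: indicator_def)
    qed (use R C in auto)
  qed
qed

text \<open>The annuli now shrink towards the origin. The contribution of radius \<rho> is of order
  \<rho> powr a, so halving the radius again gives the ratio 2 powr (-a).\<close>

lemma nn_integral_norm_powr_near:
  fixes a :: real
  assumes a: "a > 0"
  obtains C where "C > 0" and
    "\<And>R. R > 0 \<Longrightarrow> (\<integral>\<^sup>+h. ennreal (norm h powr (a - DIM('a))) * indicator (ball (0::'a::euclidean_space) R) h \<partial>lborel)
      \<le> ennreal (C * R powr a)"
proof -
  have e: "-(DIM('a) - a) = a - DIM('a)" by simp
  obtain C where C: "C > 0" and ann:
    "\<And>\<rho>. \<rho> > 0 \<Longrightarrow> (\<integral>\<^sup>+h. ennreal (norm h powr (-(DIM('a) - a)))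
        * indicator {h :: 'a. \<rho> \<le> norm h \<and> norm h < 2 * \<rho>} h \<partial>lborel)
      \<le> ennreal (C * \<rho> powr (DIM('a) - (DIM('a) - a)))"
    using nn_integral_annulus_le[where 'a='a, of "DIM('a) - a"] by blast
  define q where "q = (2::real) powr (-a)"
  have q: "0 < q" "q < 1" using a by (auto simp: q_def powr_less_one)
  show thesis
  proof (rule that[of "C * q / (1 - q)"])
    show "C * q / (1 - q) > 0" using C q by simp
    fix R :: real assume R: "R > 0"
    have sums: "(\<lambda>k. C * (R / 2 ^ Suc k) powr (DIM('a) - (DIM('a) - a))) sums (C * q / (1 - q) * R powr a)"
    proof -
      have *: "C * (R / 2 ^ Suc k) powr (DIM('a) - (DIM('a) - a)) = (C * q * R powr a) * q ^ k" for k
      proof -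
        have "(R / 2 ^ Suc k) powr a = R powr a * q ^ Suc k"
          using R by (simp only: q_def powr_divide powr_realpow[symmetric] powr_powr powr_gt_zero
              zero_less_numeral power_Suc[symmetric]) (simp add: powr_minus divide_simps powr_add[symmetric] algebra_simps)
        then show ?thesis by simp
      qed
      have "(\<lambda>k. (C * q * R powr a) * q ^ k) sums ((C * q * R powr a) * (1 / (1 - q)))"
        using q by (intro sums_mult geometric_sums) auto
      then show ?thesis unfolding * by (simp add: mult_ac)
    qed
    have "(\<integral>\<^sup>+h. ennreal (norm h powr (-(DIM('a) - a))) * indicator (ball (0::'a) R) h \<partial>lborel)
      \<le> ennreal (C * q / (1 - q) * R powr a)"
    proof (rule nn_integral_annuli_le[OF _ _ ann sums])
      fix h :: 'a
      assume "ennreal (norm h powr (-(DIM('a) - a))) * indicator (ball (0::'a) R) h \<noteq> 0"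
      \<comment> \<open>As \<open>0 powr x = 0\<close>, the integrand vanishes at the origin, the
        one point that no annulus contains.\<close>
      then have h: "norm h < R" "h \<noteq> 0" by (auto simp: indicator_def split: if_splits)
      have pos: "norm h / R > 0" using h R by (auto intro!: divide_pos_pos)
      define m where "m = \<lfloor>log 2 (norm h / R)\<rfloor>"
      have "log 2 (norm h / R) < 0" using h R by simp
      then have m0: "m < 0" by (simp add: m_def floor_less_zero)
      \<comment> \<open>The logarithm is negative, so its floor is at most -1: the outermost annulus
        has inner radius R / 2, whence \<open>Suc k\<close>.\<close>
      define k where "k = nat (- m - 1)"
      have mk: "real_of_int m = - real (Suc k)" using m0 by (simp add: k_def)
      have "2 powr real_of_int m \<le> norm h / R \<and> norm h / R < 2 powr (real_of_int m + 1)"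
        using floor_log_eq_powr_iff[OF pos, of 2 m] by (simp add: m_def)
      moreover have "2 powr real_of_int m = 1 / 2 ^ Suc k"
        by (simp only: mk powr_minus powr_realpow zero_less_numeral inverse_eq_divide)
      ultimately have "R / 2 ^ Suc k \<le> norm h \<and> norm h < 2 * (R / 2 ^ Suc k)"
        using R by (simp add: powr_add field_simps)
      then show "\<exists>k. ennreal (norm h powr (-(DIM('a) - a))) * indicator (ball (0::'a) R) h
          \<le> ennreal (norm h powr (-(DIM('a) - a))) \<and> R / 2 ^ Suc k \<le> norm h \<and> norm h < 2 * (R / 2 ^ Suc k)"
        by (intro exI[of _ k]) (auto simp: indicator_def)
    qed (use R C in auto)
    then show "(\<integral>\<^sup>+h. ennreal (norm h powr (a - DIM('a))) * indicator (ball (0::'a) R) h \<partial>lborel)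
      \<le> ennreal (C * q / (1 - q) * R powr a)"
      by (simp only: e)
  qed
qed

section \<open>The fractional Korn inequality\<close>

text \<open>The p-th power of the Gagliardo seminorm on the whole space, with the increment h as
  outer variable: the Korn argument translates x for fixed h and then changes variables linearly in
  h.\<close>

definition slobodeckij :: "real \<Rightarrow> real \<Rightarrow> ('a::euclidean_space \<Rightarrow> 'b::real_normed_vector) \<Rightarrow> ennreal"
  where "slobodeckij p s u = (\<integral>\<^sup>+h. (\<integral>\<^sup>+x.
    ennreal (norm (u (x + h) - u x) powr p * norm h powr (-(real DIM('a) + s * p))) \<partial>lborel) \<partial>lborel)"

definition weighted_pair_integral :: "real \<Rightarrow> real \<Rightarrow> ('a::euclidean_space \<Rightarrow> 'a \<Rightarrow> real) \<Rightarrow> ennreal"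
  where "weighted_pair_integral p \<beta> Q =
    (\<integral>\<^sup>+h. (\<integral>\<^sup>+x. ennreal (\<bar>Q h x\<bar> powr p * norm h powr (-\<beta>)) \<partial>lborel) \<partial>lborel)"

text \<open>The increment is paired with \<open>h\<close> rather than with \<open>h /\<^sub>R norm h\<close>; the additional \<open>p\<close> in the
  exponent of the kernel compensates for this.\<close>

definition projected_slobodeckij :: "real \<Rightarrow> real \<Rightarrow> ('a::euclidean_space \<Rightarrow> 'a) \<Rightarrow> ennreal"
  where "projected_slobodeckij p s u =
    weighted_pair_integral p (real DIM('a) + s * p + p) (\<lambda>h x. (u (x + h) - u x) \<bullet> h)"

text \<open>Collects the expressions in u whose weighted integral is bounded by the projected
  seminorm with a constant independent of u. The weight suits expressions of the size of an
  increment times h. Joint measurability is included so that integrals of sums can be split.\<close>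

definition korn_controlled ::
    "real \<Rightarrow> real \<Rightarrow> (('a::euclidean_space \<Rightarrow> 'a) \<Rightarrow> 'a \<Rightarrow> 'a \<Rightarrow> real) \<Rightarrow> bool"
  where "korn_controlled p s Q \<longleftrightarrow>
    (\<forall>u\<in>borel_measurable borel. (\<lambda>(h, x). Q u h x) \<in> borel_measurable (borel \<Otimes>\<^sub>M borel)) \<and>
    (\<exists>C>0. \<forall>u\<in>borel_measurable borel.
      weighted_pair_integral p (real DIM('a) + s * p + p) (Q u) \<le> ennreal C * projected_slobodeckij p s u)"

section \<open>Closure properties of controlled expressions\<close>

lemma weighted_pair_integral_add_le:
  assumes [measurable]: "(\<lambda>(h, x). Q1 h x) \<in> borel_measurable (borel \<Otimes>\<^sub>M borel)"
      "(\<lambda>(h, x). Q2 h x) \<in> borel_measurable (borel \<Otimes>\<^sub>M borel)"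
    and le: "\<And>h x. \<bar>Q h x\<bar> \<le> \<bar>Q1 h x\<bar> + \<bar>Q2 h x\<bar>" and p: "p > 0"
  shows "weighted_pair_integral p \<beta> Q
    \<le> ennreal (2 powr p) * (weighted_pair_integral p \<beta> Q1 + weighted_pair_integral p \<beta> Q2)"
proof -
  let ?k = "\<lambda>h. norm h powr (-\<beta>)"
  have "\<bar>Q h x\<bar> powr p * ?k h \<le> 2 powr p * (\<bar>Q1 h x\<bar> powr p * ?k h + \<bar>Q2 h x\<bar> powr p * ?k h)" for h x
  proof -
    have "\<bar>Q h x\<bar> powr p \<le> (\<bar>Q1 h x\<bar> + \<bar>Q2 h x\<bar>) powr p"
      using le p by (intro powr_mono2) auto
    also have "\<dots> \<le> 2 powr p * (\<bar>Q1 h x\<bar> powr p + \<bar>Q2 h x\<bar> powr p)"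
      using p by (intro powr_add_le) auto
    finally have "\<bar>Q h x\<bar> powr p * ?k h \<le> 2 powr p * (\<bar>Q1 h x\<bar> powr p + \<bar>Q2 h x\<bar> powr p) * ?k h"
      by (intro mult_right_mono) auto
    then show ?thesis by (simp add: algebra_simps)
  qed
  then have "weighted_pair_integral p \<beta> Q \<le> (\<integral>\<^sup>+h. (\<integral>\<^sup>+x. ennreal (2 powr p) * (ennreal (\<bar>Q1 h x\<bar> powr p * ?k h)
      + ennreal (\<bar>Q2 h x\<bar> powr p * ?k h)) \<partial>lborel) \<partial>lborel)"
    unfolding weighted_pair_integral_def
    by (intro nn_integral_mono) (simp add: ennreal_plus[symmetric] ennreal_mult'[symmetric] ennreal_leI del: ennreal_plus)
  also have "\<dots> = ennreal (2 powr p) * (weighted_pair_integral p \<beta> Q1 + weighted_pair_integral p \<beta> Q2)"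
    unfolding weighted_pair_integral_def by (simp add: nn_integral_cmult nn_integral_add)
  finally show ?thesis .
qed

lemma korn_controlled_add:
  fixes Q Q1 Q2 :: "('a::euclidean_space \<Rightarrow> 'a) \<Rightarrow> 'a \<Rightarrow> 'a \<Rightarrow> real"
  assumes c: "korn_controlled p s Q1" "korn_controlled p s Q2"
    and m: "\<And>u. u \<in> borel_measurable borel \<Longrightarrow> (\<lambda>(h, x). Q u h x) \<in> borel_measurable (borel \<Otimes>\<^sub>M borel)"
    and le: "\<And>u h x. \<bar>Q u h x\<bar> \<le> \<bar>Q1 u h x\<bar> + \<bar>Q2 u h x\<bar>" and p: "p > 0"
  shows "korn_controlled p s Q"
proof -
  obtain C1 C2 where C: "C1 > 0" "C2 > 0"
    and 1: "\<And>u. u \<in> borel_measurable borel \<Longrightarrow>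
      weighted_pair_integral p (real DIM('a) + s * p + p) (Q1 u) \<le> ennreal C1 * projected_slobodeckij p s u"
    and 2: "\<And>u. u \<in> borel_measurable borel \<Longrightarrow>
      weighted_pair_integral p (real DIM('a) + s * p + p) (Q2 u) \<le> ennreal C2 * projected_slobodeckij p s u"
    using c unfolding korn_controlled_def by metis
  show ?thesis
    unfolding korn_controlled_def
  proof (intro conjI ballI m exI[of _ "2 powr p * (C1 + C2)"])
    show "2 powr p * (C1 + C2) > 0" using C by simp
    fix u :: "'a \<Rightarrow> 'a" assume u: "u \<in> borel_measurable borel"
    have "weighted_pair_integral p (real DIM('a) + s * p + p) (Q u)
        \<le> ennreal (2 powr p) * (weighted_pair_integral p (real DIM('a) + s * p + p) (Q1 u)
          + weighted_pair_integral p (real DIM('a) + s * p + p) (Q2 u))"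
      using c u le p by (intro weighted_pair_integral_add_le) (auto simp: korn_controlled_def)
    also have "\<dots> \<le> ennreal (2 powr p) * (ennreal C1 * projected_slobodeckij p s u
        + ennreal C2 * projected_slobodeckij p s u)"
      by (intro mult_left_mono add_mono 1 2 u) auto
    also have "\<dots> = ennreal (2 powr p * (C1 + C2)) * projected_slobodeckij p s u"
      using C by (simp add: ennreal_mult' distrib_right mult.assoc)
    finally show "weighted_pair_integral p (real DIM('a) + s * p + p) (Q u)
        \<le> ennreal (2 powr p * (C1 + C2)) * projected_slobodeckij p s u" .
  qed
qed

lemma korn_controlled_zero: "p > 0 \<Longrightarrow> korn_controlled p s (\<lambda>u h x. 0)"
  by (auto simp: korn_controlled_def weighted_pair_integral_def intro!: exI[of _ 1])

lemma korn_controlled_mono: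
  assumes "korn_controlled p s Q1"
    and "\<And>u. u \<in> borel_measurable borel \<Longrightarrow> (\<lambda>(h, x). Q u h x) \<in> borel_measurable (borel \<Otimes>\<^sub>M borel)"
    and "\<And>u h x. \<bar>Q u h x\<bar> \<le> \<bar>Q1 u h x\<bar>" and "p > 0"
  shows "korn_controlled p s Q"
  using assms by (intro korn_controlled_add[OF assms(1) korn_controlled_zero]) auto

lemma korn_controlled_sum:
  fixes Q :: "'i \<Rightarrow> ('a::euclidean_space \<Rightarrow> 'a) \<Rightarrow> 'a \<Rightarrow> 'a \<Rightarrow> real"
  assumes "finite I" and "\<And>i. i \<in> I \<Longrightarrow> korn_controlled p s (Q i)" and p: "p > 0"
  shows "korn_controlled p s (\<lambda>u h x. \<Sum>i\<in>I. \<bar>Q i u h x\<bar>)"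
  using assms(1,2)
proof (induction I rule: finite_induct)
  case empty
  then show ?case using p by (simp add: korn_controlled_zero)
next
  case (insert i I)
  have 1: "korn_controlled p s (Q i)" and 2: "korn_controlled p s (\<lambda>u h x. \<Sum>i\<in>I. \<bar>Q i u h x\<bar>)"
    using insert by auto
  show ?case
  proof (rule korn_controlled_add[OF 1 2 _ _ p])
    fix u :: "'a \<Rightarrow> 'a" assume u: "u \<in> borel_measurable borel"
    have [measurable]: "(\<lambda>(h, x). Q j u h x) \<in> borel_measurable (borel \<Otimes>\<^sub>M borel)" if "j \<in> insert i I" for j
      using insert.prems[OF that] u by (auto simp: korn_controlled_def)
    show "(\<lambda>(h, x). \<Sum>i\<in>insert i I. \<bar>Q i u h x\<bar>) \<in> borel_measurable (borel \<Otimes>\<^sub>M borel)"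
      unfolding split_beta' by (intro borel_measurable_sum) measurable
  qed (use insert in \<open>auto simp: sum_nonneg\<close>)
qed

text \<open>For fixed h a translation in x removes the base shift P h. What remains is a function of
  N h, so the linear substitution h \<mapsto> N h leads back to the projected seminorm; norm (N h)
  \<le> c * norm h compares the weights.\<close>

lemma korn_controlled_increment:
  fixes N P :: "'a::euclidean_space \<Rightarrow> 'a"
  assumes N: "linear N" "inj N" and P: "P \<in> borel_measurable borel" and p: "p > 0" and s: "s \<ge> 0"
  shows "korn_controlled p s (\<lambda>u h x. (u (x + P h + N h) - u (x + P h)) \<bullet> N h)"
proof -
  define \<beta> where "\<beta> = real DIM('a) + s * p + p"
  have \<beta>: "\<beta> > 0" using p s by (simp add: \<beta>_def add_nonneg_pos)
  obtain c where c: "c > 0" "\<And>x. norm (N x) \<le> c * norm x"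
    using linear_bounded_pos[OF N(1)] by blast
  obtain C where C: "C > 0" "\<And>F. F \<in> borel_measurable borel \<Longrightarrow>
      (\<integral>\<^sup>+h. F (N h) \<partial>lborel) \<le> ennreal C * (\<integral>\<^sup>+h. F h \<partial>(lborel :: 'a measure))"
    using nn_integral_lborel_linear_le[OF N] by blast
  have [measurable]: "N \<in> borel_measurable borel"
    using N(1) by (intro borel_measurable_continuous_onI linear_continuous_on) (simp add: linear_conv_bounded_linear)
  note P[measurable]
  have N0: "N h = 0 \<longleftrightarrow> h = 0" for h using N linear_injective_0 linear_0 by blast
  show ?thesis
    unfolding korn_controlled_def \<beta>_def[symmetric]
  proof (intro conjI ballI exI[of _ "c powr \<beta> * C"])
    fix u :: "'a \<Rightarrow> 'a" assume u[measurable]: "u \<in> borel_measurable borel"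
    show "(\<lambda>(h, x). (u (x + P h + N h) - u (x + P h)) \<bullet> N h) \<in> borel_measurable (borel \<Otimes>\<^sub>M borel)"
      by measurable
    define G where "G v = (\<integral>\<^sup>+x. ennreal (\<bar>(u (x + v) - u x) \<bullet> v\<bar> powr p * norm v powr (-\<beta>)) \<partial>lborel)" for v
    have [measurable]: "G \<in> borel_measurable borel" unfolding G_def by measurable
    have pt: "\<bar>(u (x + N h) - u x) \<bullet> N h\<bar> powr p * norm h powr (-\<beta>)
      \<le> c powr \<beta> * (\<bar>(u (x + N h) - u x) \<bullet> N h\<bar> powr p * norm (N h) powr (-\<beta>))" for h x
    proof (cases "h = 0")
      case True
      then show ?thesis by (simp add: linear_0[OF N(1)])
    next
      case False
      have "norm h powr (-\<beta>) \<le> (norm (N h) / c) powr (-\<beta>)"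
        using c False \<beta> N0 by (intro powr_mono2') (auto simp: divide_simps mult.commute)
      also have "\<dots> = c powr \<beta> * norm (N h) powr (-\<beta>)"
        using c by (simp add: powr_divide powr_minus field_simps)
      finally have "\<bar>(u (x + N h) - u x) \<bullet> N h\<bar> powr p * norm h powr (-\<beta>)
        \<le> \<bar>(u (x + N h) - u x) \<bullet> N h\<bar> powr p * (c powr \<beta> * norm (N h) powr (-\<beta>))"
        by (intro mult_left_mono) auto
      then show ?thesis by (simp add: mult_ac)
    qed
    have "weighted_pair_integral p \<beta> (\<lambda>h x. (u (x + P h + N h) - u (x + P h)) \<bullet> N h)
      = (\<integral>\<^sup>+h. (\<integral>\<^sup>+x. ennreal (\<bar>(u (x + N h) - u x) \<bullet> N h\<bar> powr p * norm h powr (-\<beta>)) \<partial>lborel) \<partial>lborel)"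
      unfolding weighted_pair_integral_def
      by (intro nn_integral_cong
        nn_integral_lborel_shift[of "\<lambda>x. ennreal (\<bar>(u (x + N h) - u x) \<bullet> N h\<bar> powr p * norm h powr (-\<beta>))" "P h" for h])
        measurable
    also have "\<dots> \<le> (\<integral>\<^sup>+h. (\<integral>\<^sup>+x. ennreal (c powr \<beta>) *
        ennreal (\<bar>(u (x + N h) - u x) \<bullet> N h\<bar> powr p * norm (N h) powr (-\<beta>)) \<partial>lborel) \<partial>lborel)"
      by (intro nn_integral_mono) (simp add: ennreal_mult'[symmetric] ennreal_leI pt)
    also have "\<dots> = ennreal (c powr \<beta>) * (\<integral>\<^sup>+h. G (N h) \<partial>lborel)"
      by (simp add: nn_integral_cmult G_def)
    also have "\<dots> \<le> ennreal (c powr \<beta>) * (ennreal C * (\<integral>\<^sup>+h. G h \<partial>lborel))"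
      by (intro mult_left_mono C) auto
    also have "(\<integral>\<^sup>+h. G h \<partial>lborel) = projected_slobodeckij p s u"
      by (simp add: G_def projected_slobodeckij_def weighted_pair_integral_def \<beta>_def)
    finally show "weighted_pair_integral p \<beta> (\<lambda>h x. (u (x + P h + N h) - u (x + P h)) \<bullet> N h)
        \<le> ennreal (c powr \<beta> * C) * projected_slobodeckij p s u"
      using C by (simp add: ennreal_mult' mult.assoc)
  qed (use c C in auto)
qed

text \<open>The discrete analogue of recovering all second derivatives of a vector field from the first
  derivatives of its symmetric gradient: for \<open>e v y = (u (y + v) - u y) \<bullet> v\<close>, the second difference
  paired with an arbitrary vector \<open>c\<close> is
  \<open>e (h + c) (x + h) - e (h + c) x - e c (x + 2 h) + e c (x + h) - e h (x + h + c) + e h x\<close>.\<close>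

lemma korn_controlled_second_difference_aux:
  fixes M :: "'a::euclidean_space \<Rightarrow> 'a"
  assumes M: "linear M" "inj M" "inj (\<lambda>h. h + M h)" and p: "p > 0" and s: "s \<ge> 0"
  shows "korn_controlled p s (\<lambda>u h x. (u (x + 2 *\<^sub>R h) - 2 *\<^sub>R u (x + h) + u x) \<bullet> M h)"
proof -
  have lin: "linear (\<lambda>h. h + M h)" "linear (\<lambda>h::'a. h)"
    using M(1) by (auto intro!: linear_compose_add linear_ident)
  have [measurable]: "M \<in> borel_measurable borel"
    using M(1) by (intro borel_measurable_continuous_onI linear_continuous_on) (simp add: linear_conv_bounded_linear)
  define e where "e N P u h x = (u (x + P h + N h) - u (x + P h)) \<bullet> N h"
    for N P :: "'a \<Rightarrow> 'a" and u :: "'a \<Rightarrow> 'a" and h x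
  \<comment> \<open>The six terms of the identity, each given by a direction \<open>N\<close> and a
    base shift \<open>P\<close>. Signs are dropped because only absolute values are summed.\<close>
  define Q where "Q i = (if i = 0 then e (\<lambda>h. h + M h) (\<lambda>h. h)
    else if i = 1 then e (\<lambda>h. h + M h) (\<lambda>h. 0)
    else if i = 2 then e M (\<lambda>h. 2 *\<^sub>R h) else if i = 3 then e M (\<lambda>h. h)
    else if i = 4 then e (\<lambda>h. h) (\<lambda>h. h + M h) else e (\<lambda>h. h) (\<lambda>h. 0))" for i :: nat
  have e: "korn_controlled p s (e N P)"
    if "linear N" "inj N" "P \<in> borel_measurable borel" for N P
    using korn_controlled_increment[OF that p s] by (simp add: e_def[abs_def])
  have inj: "inj (\<lambda>h::'a. h)" by simp
  have Q: "korn_controlled p s (Q i)" for i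
    unfolding Q_def by (simp add: e M lin inj)
  have "korn_controlled p s (\<lambda>u h x. \<Sum>i<6. \<bar>Q i u h x\<bar>)"
    by (intro korn_controlled_sum Q p) auto
  then show ?thesis
  proof (rule korn_controlled_mono[OF _ _ _ p])
    fix u :: "'a \<Rightarrow> 'a" and h x :: 'a
    have "(u (x + 2 *\<^sub>R h) - 2 *\<^sub>R u (x + h) + u x) \<bullet> M h
      = Q 0 u h x - Q 1 u h x - Q 2 u h x + Q 3 u h x - Q 4 u h x + Q 5 u h x"
      by (simp add: Q_def e_def inner_simps algebra_simps scaleR_2)
    also have "\<bar>\<dots>\<bar> \<le> (\<Sum>i<6. \<bar>Q i u h x\<bar>)"
      by (simp add: eval_nat_numeral)
    finally show "\<bar>(u (x + 2 *\<^sub>R h) - 2 *\<^sub>R u (x + h) + u x) \<bullet> M h\<bar> \<le> \<bar>\<Sum>i<6. \<bar>Q i u h x\<bar>\<bar>"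
      by (simp add: sum_nonneg)
  next
    fix u :: "'a \<Rightarrow> 'a" assume [measurable]: "u \<in> borel_measurable borel"
    show "(\<lambda>(h, x). (u (x + 2 *\<^sub>R h) - 2 *\<^sub>R u (x + h) + u x) \<bullet> M h) \<in> borel_measurable (borel \<Otimes>\<^sub>M borel)"
      by measurable
  qed
qed

text \<open>The products (\<Delta> \<bullet> i) * (h \<bullet> j) over basis vectors i, j dominate
  norm \<Delta> * norm h. They are pairings with the rank-one maps h \<mapsto> (h \<bullet> j) i,
  which are not injective in dimension above 1; adding the identity repairs this, and the difference
  of \<open>M 1 b\<close> and \<open>M 0 b\<close> gives the rank-one map back.\<close>

lemma korn_controlled_second_difference:
  assumes p: "p > 0" and s: "s \<ge> 0"
  shows "korn_controlled p s
    (\<lambda>u h x. norm (u (x + 2 *\<^sub>R h) - 2 *\<^sub>R u (x + h) + u (x::'a::euclidean_space)) * norm h)"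
proof -
  define \<Delta> where "\<Delta> u h x = u (x + 2 *\<^sub>R h) - 2 *\<^sub>R u (x + h) + u x" for u :: "'a \<Rightarrow> 'a" and h x
  define M where "M t b h = h + (t * (h \<bullet> snd b)) *\<^sub>R fst b" for t :: real and b :: "'a \<times> 'a" and h :: 'a
  have M: "korn_controlled p s (\<lambda>u h x. \<Delta> u h x \<bullet> M t b h)"
    if t: "t \<ge> 0" and b: "b \<in> Basis \<times> Basis" for t b
  proof -
    have lin: "linear (M t b)"
      unfolding M_def by (intro linearI) (auto simp: algebra_simps inner_simps)
    \<comment> \<open>The values c = 0 and c = 1 give the two injectivity conditions. Pairing with
      the second basis vector multiplies h \<bullet> snd b by c + 1 + t * (fst b \<bullet> snd b),
      which is positive because inner products of basis vectors are 0 or 1.\<close>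
    have inj: "inj (\<lambda>h. c *\<^sub>R h + M t b h)" if c: "c \<ge> 0" for c
    proof -
      have "linear (\<lambda>h. c *\<^sub>R h + M t b h)"
        unfolding M_def by (intro linearI) (auto simp: algebra_simps inner_simps)
      moreover have "h = 0" if "c *\<^sub>R h + M t b h = 0" for h
      proof -
        have "(c *\<^sub>R h + M t b h) \<bullet> snd b = (c + 1 + t * (fst b \<bullet> snd b)) * (h \<bullet> snd b)"
          by (simp add: M_def inner_simps algebra_simps)
        moreover have "t * (fst b \<bullet> snd b) \<ge> 0"
          using b t by (auto simp: inner_Basis)
        ultimately have "h \<bullet> snd b = 0"
          using that c by simp
        then have "(c + 1) *\<^sub>R h = 0" using that by (simp add: M_def algebra_simps)
        then show "h = 0" using c by simp
      qed
      ultimately show ?thesis using linear_injective_0 by blast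
    qed
    show ?thesis
      unfolding \<Delta>_def
      by (rule korn_controlled_second_difference_aux[OF lin _ _ p s]) (use inj[of 0] inj[of 1] in simp_all)
  qed
  define Q where "Q = (\<lambda>u h x. \<Sum>i\<in>{0,1::real} \<times> Basis \<times> Basis. \<bar>\<Delta> u h x \<bullet> M (fst i) (snd i) h\<bar>)"
  have "korn_controlled p s Q"
    unfolding Q_def by (intro korn_controlled_sum p M) auto
  then show ?thesis
    unfolding \<Delta>_def[symmetric]
  proof (rule korn_controlled_mono[OF _ _ _ p])
    fix u :: "'a \<Rightarrow> 'a" and h x :: 'a
    have "norm (\<Delta> u h x) * norm h \<le> (\<Sum>i\<in>Basis. \<bar>\<Delta> u h x \<bullet> i\<bar>) * (\<Sum>j\<in>Basis. \<bar>h \<bullet> j\<bar>)"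
      by (intro mult_mono norm_le_l1) (auto simp: sum_nonneg)
    also have "\<dots> = (\<Sum>b\<in>Basis \<times> Basis. \<bar>\<Delta> u h x \<bullet> ((h \<bullet> snd b) *\<^sub>R fst b)\<bar>)"
      unfolding sum_product sum.cartesian_product' by (simp add: abs_mult mult.commute)
    also have "\<dots> \<le> (\<Sum>b\<in>Basis \<times> Basis. \<bar>\<Delta> u h x \<bullet> M 0 b h\<bar> + \<bar>\<Delta> u h x \<bullet> M 1 b h\<bar>)"
    proof (rule sum_mono)
      fix b :: "'a \<times> 'a"
      have "\<Delta> u h x \<bullet> ((h \<bullet> snd b) *\<^sub>R fst b) = \<Delta> u h x \<bullet> M 1 b h - \<Delta> u h x \<bullet> M 0 b h"
        unfolding M_def by (simp add: inner_add_right)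
      then show "\<bar>\<Delta> u h x \<bullet> ((h \<bullet> snd b) *\<^sub>R fst b)\<bar> \<le> \<bar>\<Delta> u h x \<bullet> M 0 b h\<bar> + \<bar>\<Delta> u h x \<bullet> M 1 b h\<bar>"
        by linarith
    qed
    also have "\<dots> = Q u h x"
      unfolding Q_def sum.cartesian_product'[of _ "{0, 1}"] by (simp add: sum.distrib)
    finally show "\<bar>norm (\<Delta> u h x) * norm h\<bar> \<le> \<bar>Q u h x\<bar>"
      by (simp add: abs_mult)
  next
    fix u :: "'a \<Rightarrow> 'a" assume [measurable]: "u \<in> borel_measurable borel"
    show "(\<lambda>(h, x). norm (\<Delta> u h x) * norm h) \<in> borel_measurable (borel \<Otimes>\<^sub>M borel)"
      unfolding \<Delta>_def by measurable
  qed
qed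

text \<open>From second to first differences: \<open>2 (u (x + h) - u x)\<close> is the increment over \<open>2 h\<close> minus the
  second difference, and rescaling \<open>h\<close> costs only the factor \<open>2 powr s < 2\<close>, so that the former
  can be absorbed.\<close>

theorem fractional_korn:
  fixes p s :: real
  assumes p: "p \<ge> 1" and s: "0 < s" "s < 1"
  obtains C where "C > 0" and
    "\<And>u :: 'a::euclidean_space \<Rightarrow> 'a. u \<in> borel_measurable borel \<Longrightarrow> slobodeckij p s u < \<infinity> \<Longrightarrow>
      slobodeckij p s u \<le> ennreal C * projected_slobodeckij p s u"
proof -
  define \<beta> where "\<beta> = real DIM('a) + s * p"
  \<comment> \<open>\<theta> is both the convexity weight and the final absorption factor: \<theta>
    powr (1 - p) * 2 powr (-p) equals \<theta> * 2 powr (- s p), and the power of 2 is used up by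
    rescaling the kernel and the volume.\<close>
  define \<theta> where "\<theta> = (2::real) powr (s - 1)"
  have \<theta>: "0 < \<theta>" "\<theta> < 1" using s by (auto simp: \<theta>_def powr_less_one)
  obtain C where C: "C > 0" and S: "\<And>u :: 'a \<Rightarrow> 'a. u \<in> borel_measurable borel \<Longrightarrow>
      weighted_pair_integral p (real DIM('a) + s * p + p)
        (\<lambda>h x. norm (u (x + 2 *\<^sub>R h) - 2 *\<^sub>R u (x + h) + u x) * norm h)
      \<le> ennreal C * projected_slobodeckij p s u"
    using korn_controlled_second_difference[of p s] p s unfolding korn_controlled_def by auto
  define D where "D = (1 - \<theta>) powr (1 - p) * 2 powr (-p)"
  have D: "D > 0" using \<theta> by (simp add: D_def)
  show thesis
  proof (rule that[of "D * C / (1 - \<theta>)"])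
    show "D * C / (1 - \<theta>) > 0" using D C \<theta> by simp
    fix u :: "'a \<Rightarrow> 'a"
    assume u[measurable]: "u \<in> borel_measurable borel" and fin: "slobodeckij p s u < \<infinity>"
    let ?\<Delta> = "\<lambda>h x. u (x + 2 *\<^sub>R h) - 2 *\<^sub>R u (x + h) + u x"
    define G where "G h = (\<integral>\<^sup>+x. ennreal (norm (u (x + h) - u x) powr p * norm h powr (-\<beta>)) \<partial>lborel)" for h
    have [measurable]: "G \<in> borel_measurable borel" unfolding G_def by measurable
    have G: "(\<integral>\<^sup>+h. G h \<partial>lborel) = slobodeckij p s u" by (simp add: G_def slobodeckij_def \<beta>_def)
    have G2: "(\<integral>\<^sup>+h. G h \<partial>lborel) = ennreal (2 ^ DIM('a)) * (\<integral>\<^sup>+h. G (2 *\<^sub>R h) \<partial>lborel)"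
      using nn_integral_lborel_affine[of G 2 0] by simp
    have pt: "norm (u (x + h) - u x) powr p * norm h powr (-\<beta>)
        \<le> (\<theta> * 2 powr real DIM('a)) * (norm (u (x + 2 *\<^sub>R h) - u x) powr p * norm (2 *\<^sub>R h) powr (-\<beta>))
          + D * (\<bar>norm (?\<Delta> h x) * norm h\<bar> powr p * norm h powr (-(\<beta> + p)))" for x h
    proof (cases "h = 0")
      case False
      have "2 *\<^sub>R (u (x + h) - u x) = (u (x + 2 *\<^sub>R h) - u x) - ?\<Delta> h x"
        by (simp add: algebra_simps scaleR_2)
      then have "norm (2 *\<^sub>R (u (x + h) - u x)) \<le> norm (u (x + 2 *\<^sub>R h) - u x) + norm (?\<Delta> h x)"
        by (simp only: norm_triangle_ineq4)
      then have "norm (u (x + h) - u x) \<le> norm (u (x + 2 *\<^sub>R h) - u x) / 2 + norm (?\<Delta> h x) / 2"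
        by simp
      then have "norm (u (x + h) - u x) powr p \<le> (norm (u (x + 2 *\<^sub>R h) - u x) / 2 + norm (?\<Delta> h x) / 2) powr p"
        using p by (intro powr_mono2) auto
      also have "\<dots> \<le> \<theta> powr (1 - p) * (norm (u (x + 2 *\<^sub>R h) - u x) / 2) powr p
          + (1 - \<theta>) powr (1 - p) * (norm (?\<Delta> h x) / 2) powr p"
        using \<theta> p by (intro powr_add_convex_le) auto
      also have "\<dots> = \<theta> powr (1 - p) * 2 powr (-p) * norm (u (x + 2 *\<^sub>R h) - u x) powr p
          + D * norm (?\<Delta> h x) powr p"
        by (simp add: D_def powr_divide powr_minus divide_simps)
      also have "\<theta> powr (1 - p) * 2 powr (-p) = \<theta> * 2 powr real DIM('a) * 2 powr (-\<beta>)"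
        by (simp add: \<theta>_def \<beta>_def powr_powr powr_add[symmetric]) (simp add: algebra_simps)
      finally have "norm (u (x + h) - u x) powr p * norm h powr (-\<beta>)
        \<le> (\<theta> * 2 powr real DIM('a) * 2 powr (-\<beta>) * norm (u (x + 2 *\<^sub>R h) - u x) powr p
          + D * norm (?\<Delta> h x) powr p) * norm h powr (-\<beta>)"
        by (intro mult_right_mono) auto
      also have "\<dots> = (\<theta> * 2 powr real DIM('a)) * (norm (u (x + 2 *\<^sub>R h) - u x) powr p * norm (2 *\<^sub>R h) powr (-\<beta>))
          + D * (\<bar>norm (?\<Delta> h x) * norm h\<bar> powr p * norm h powr (-(\<beta> + p)))"
        using False by (simp add: powr_mult abs_mult powr_diff powr_minus powr_add field_simps)
      finally show ?thesis .
    qed simp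
    have "slobodeckij p s u \<le> (\<integral>\<^sup>+h. (\<integral>\<^sup>+x.
        ennreal (\<theta> * 2 powr real DIM('a)) * ennreal (norm (u (x + 2 *\<^sub>R h) - u x) powr p * norm (2 *\<^sub>R h) powr (-\<beta>))
        + ennreal D * ennreal (\<bar>norm (?\<Delta> h x) * norm h\<bar> powr p * norm h powr (-(\<beta> + p))) \<partial>lborel) \<partial>lborel)"
      unfolding slobodeckij_def \<beta>_def[symmetric]
      using pt D \<theta> by (intro nn_integral_mono)
        (simp add: ennreal_plus[symmetric] ennreal_mult'[symmetric] ennreal_leI del: ennreal_plus)
    also have "\<dots> = (\<integral>\<^sup>+h. ennreal (\<theta> * 2 powr real DIM('a)) * G (2 *\<^sub>R h) + ennreal D *
        (\<integral>\<^sup>+x. ennreal (\<bar>norm (?\<Delta> h x) * norm h\<bar> powr p * norm h powr (-(\<beta> + p))) \<partial>lborel) \<partial>lborel)"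
      by (intro nn_integral_cong) (simp add: nn_integral_add nn_integral_cmult G_def)
    also have "\<dots> = ennreal \<theta> * (ennreal (2 ^ DIM('a)) * (\<integral>\<^sup>+h. G (2 *\<^sub>R h) \<partial>lborel))
        + ennreal D * weighted_pair_integral p (\<beta> + p) (\<lambda>h x. norm (?\<Delta> h x) * norm h)"
      unfolding weighted_pair_integral_def using \<theta>
      by (simp add: nn_integral_add nn_integral_cmult powr_realpow ennreal_mult mult.assoc)
    also have "\<dots> \<le> ennreal \<theta> * slobodeckij p s u + ennreal D * (ennreal C * projected_slobodeckij p s u)"
      using S[OF u] by (intro add_mono mult_left_mono) (auto simp: G2[symmetric] G \<beta>_def)
    finally have main: "slobodeckij p s u \<le> ennreal \<theta> * slobodeckij p s u + ennreal D * (ennreal C * projected_slobodeckij p s u)" .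
    show "slobodeckij p s u \<le> ennreal (D * C / (1 - \<theta>)) * projected_slobodeckij p s u"
    proof (cases "projected_slobodeckij p s u")
      case (real y)
      \<comment> \<open>Here the finiteness of the seminorm enters: only a finite w allows the term
        \<theta> * w to be subtracted.\<close>
      obtain w where w: "slobodeckij p s u = ennreal w" "w \<ge> 0" using fin by (cases "slobodeckij p s u") auto
      have "w \<le> \<theta> * w + D * (C * y)"
        using main real w C D \<theta> by (simp add: ennreal_mult'[symmetric] ennreal_plus[symmetric] del: ennreal_plus)
      then have "w \<le> D * C / (1 - \<theta>) * y" using \<theta> by (simp add: field_simps)
      then show ?thesis using real w C D \<theta> by (simp add: ennreal_mult'[symmetric] ennreal_leI)
    next
      case top
      then show ?thesis using C D \<theta> by (simp add: ennreal_mult_top)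
    qed
  qed
qed

section \<open>The fractional Sobolev inequality\<close>

text \<open>By Chebyshev the set where g exceeds g x / 2 has measure at most (2 / g x) powr P * Z.
  In a ball about x of twice that volume, g is at most g x / 2 on at least half of the ball. There
  the increment is at least g x / 2 and the kernel at least its value at the radius t.\<close>

lemma sobolev_pointwise:
  fixes g :: "'a::euclidean_space \<Rightarrow> real" and p s :: real
  assumes g[measurable]: "g \<in> borel_measurable borel" and g0: "g x > 0"
    and p: "p > 0" and s: "0 < s" "s * p < DIM('a)"
    and P: "P = DIM('a) * p / (DIM('a) - s * p)"
    and v: "v = unit_ball_vol (real DIM('a))"
    and Z: "Z > 0" "(\<integral>\<^sup>+y. ennreal (\<bar>g y\<bar> powr P) \<partial>lborel) = ennreal Z"
  shows "ennreal (((1/2) powr p * (v / 2) * (2 * 2 powr P / v) powr (- (s * p / DIM('a))))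
      * Z powr (- (s * p / DIM('a))) * g x powr P)
    \<le> (\<integral>\<^sup>+h. ennreal (\<bar>g (x + h) - g x\<bar> powr p * norm h powr (-(real DIM('a) + s * p))) \<partial>lborel)"
proof -
  define d where "d = real DIM('a)"
  have d: "d > 0" "d > s * p" using s by (auto simp: d_def)
  have P0: "P > 0" using p d by (simp add: P d_def[symmetric])
  have v0: "v > 0" by (simp add: v)
  \<comment> \<open>Makes the volume of the ball of radius t, that is v * T, twice the Chebyshev
    bound.\<close>
  define T where "T = 2 * (2 / g x) powr P * Z / v"
  have T: "T > 0" using g0 Z v0 by (simp add: T_def)
  define t where "t = T powr (1 / d)"
  have t: "t > 0" using T by (simp add: t_def)
  have td: "v * t ^ DIM('a) = 2 * (2 / g x) powr P * Z"
  proof -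
    have "t ^ DIM('a) = T" using T d
      by (simp add: t_def powr_realpow[symmetric] powr_powr d_def)
    then show ?thesis using v0 by (simp add: T_def)
  qed
  define B where "B = {h \<in> ball 0 t. g (x + h) > g x / 2}"
  define A where "A = {h \<in> ball 0 t. g (x + h) \<le> g x / 2}"
  have [measurable]: "A \<in> sets borel" "B \<in> sets borel"
    unfolding A_def B_def by measurable
  have AB: "ball 0 t = A \<union> B" "A \<inter> B = {}" by (auto simp: A_def B_def)
  have eball: "emeasure lborel (ball (0::'a) t) = ennreal (2 * (2 / g x) powr P * Z)"
    using t by (simp add: emeasure_ball v[symmetric] td)
  have "ennreal ((g x / 2) powr P) * emeasure lborel B
      = (\<integral>\<^sup>+h. ennreal ((g x / 2) powr P) * indicator B h \<partial>lborel)"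
    by (subst nn_integral_cmult_indicator) auto
  also have "\<dots> \<le> (\<integral>\<^sup>+h. ennreal (\<bar>g (h + x)\<bar> powr P) \<partial>lborel)"
    using g0 P0 by (intro nn_integral_mono)
      (auto simp: indicator_def B_def add.commute intro!: ennreal_leI powr_mono2)
  also have "\<dots> = ennreal Z"
    by (subst nn_integral_lborel_shift[of "\<lambda>y. ennreal (\<bar>g y\<bar> powr P)"]) (auto simp: Z)
  finally have "ennreal ((g x / 2) powr P) * emeasure lborel B \<le> ennreal Z" .
  moreover obtain b where b: "emeasure lborel B = ennreal b" "b \<ge> 0"
  proof -
    have "emeasure lborel B \<le> emeasure lborel (ball (0::'a) t)"
      by (intro emeasure_mono) (auto simp: B_def)
    then show ?thesis using that eball by (cases "emeasure lborel B") (auto simp: top_unique)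
  qed
  ultimately have "(g x / 2) powr P * b \<le> Z"
    using Z by (simp add: ennreal_mult'[symmetric])
  then have b2: "b \<le> (2 / g x) powr P * Z"
    using g0 by (simp add: powr_divide field_simps)
  obtain a where a: "emeasure lborel A = ennreal a" "a \<ge> 0"
  proof -
    have "emeasure lborel A \<le> emeasure lborel (ball (0::'a) t)"
      by (intro emeasure_mono) (auto simp: A_def)
    then show ?thesis using that eball by (cases "emeasure lborel A") (auto simp: top_unique)
  qed
  have "emeasure lborel (A \<union> B) = emeasure lborel A + emeasure lborel B"
    using AB by (intro plus_emeasure[symmetric]) auto
  then have "ennreal (2 * (2 / g x) powr P * Z) = ennreal (a + b)"
    using a b eball AB by simp
  then have "2 * (2 / g x) powr P * Z = a + b"
    using a b Z by (subst (asm) ennreal_inj) auto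
  then have a2: "a \<ge> (2 / g x) powr P * Z" using b2 by simp
  have "((1/2) powr p * (v / 2) * (2 * 2 powr P / v) powr (- (s * p / d))) * Z powr (- (s * p / d)) * g x powr P
      = (g x / 2) powr p * t powr (-(d + s * p)) * ((2 / g x) powr P * Z)"
  proof -
    have e1: "(2 / g x) powr P * Z = v / 2 * t powr d"
      using td t by (simp add: d_def powr_realpow)
    have e2: "t powr (-(d + s * p)) * t powr d = t powr (- (s * p))"
      by (simp add: powr_add[symmetric])
    have e3: "t powr (- (s * p)) = T powr (- (s * p / d))"
      by (simp add: t_def powr_powr)
    have e4: "T = (2 * 2 powr P / v) * Z * g x powr (- P)"
      using g0 by (simp add: T_def powr_divide powr_minus field_simps)
    define W where "W = 2 * 2 powr P / v"
    have W: "W > 0" using v0 by (simp add: W_def)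
    have e5: "T powr (- (s * p / d)) = (2 * 2 powr P / v) powr (- (s * p / d)) * Z powr (- (s * p / d))
        * g x powr (P * (s * p / d))"
      unfolding e4 W_def[symmetric] using W Z by (simp add: powr_mult powr_powr)
    \<comment> \<open>The scaling relation that singles out the Sobolev exponent: the power of g x
      hidden in the radius raises g x powr p to g x powr P.\<close>
    have e6: "p + P * (s * p / d) = P"
      using d by (simp add: P d_def[symmetric] field_simps)
    have e7: "(g x / 2) powr p * g x powr (P * (s * p / d)) = (1/2) powr p * g x powr P"
      using g0 by (subst (2) e6[symmetric]) (simp add: powr_add powr_divide)
    have "(g x / 2) powr p * t powr (-(d + s * p)) * ((2 / g x) powr P * Z)
        = (g x / 2) powr p * (v / 2) * (t powr (-(d + s * p)) * t powr d)"
      unfolding e1 by (simp add: mult_ac)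
    also have "\<dots> = (v / 2) * (2 * 2 powr P / v) powr (- (s * p / d)) * Z powr (- (s * p / d))
        * ((g x / 2) powr p * g x powr (P * (s * p / d)))"
      unfolding e2 e3 e5 by (simp add: mult_ac)
    finally show ?thesis unfolding e7 by (simp add: mult_ac)
  qed
  also have "\<dots> \<le> (g x / 2) powr p * t powr (-(d + s * p)) * a"
    by (intro mult_left_mono a2) auto
  finally have "ennreal (((1/2) powr p * (v / 2) * (2 * 2 powr P / v) powr (- (s * p / d))) * Z powr (- (s * p / d)) * g x powr P)
      \<le> ennreal ((g x / 2) powr p * t powr (-(d + s * p))) * emeasure lborel A"
    using a by (simp add: ennreal_mult'[symmetric] ennreal_leI)
  also have "\<dots> = (\<integral>\<^sup>+h. ennreal ((g x / 2) powr p * t powr (-(d + s * p))) * indicator A h \<partial>lborel)"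
    by (subst nn_integral_cmult_indicator) auto
  also have "\<dots> \<le> (\<integral>\<^sup>+h. ennreal (\<bar>g (x + h) - g x\<bar> powr p * norm h powr (-(d + s * p))) \<partial>lborel)"
  proof (intro nn_integral_mono)
    fix h :: 'a
    show "ennreal ((g x / 2) powr p * t powr (-(d + s * p))) * indicator A h
        \<le> ennreal (\<bar>g (x + h) - g x\<bar> powr p * norm h powr (-(d + s * p)))"
    proof (cases "h \<in> A")
      case True
      then have h: "norm h < t" "g (x + h) \<le> g x / 2" by (auto simp: A_def)
      then have "h \<noteq> 0" using g0 by auto
      then have "(g x / 2) powr p * t powr (-(d + s * p)) \<le> \<bar>g (x + h) - g x\<bar> powr p * norm h powr (-(d + s * p))"
        using h g0 p d mult_pos_pos[OF s(1) p] by (intro mult_mono[OF powr_mono2 powr_mono2']) auto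
      then show ?thesis using True by (simp add: ennreal_leI)
    qed simp
  qed
  finally show ?thesis by (simp add: d_def)
qed

text \<open>Integrating the pointwise bound in x gives c * Z powr (1 - s p / d) \<le> \<omega>,
  which is solved for Z. This requires Z to be finite from the start; truncated functions provide
  that.\<close>

lemma sobolev_truncated:
  fixes g :: "'a::euclidean_space \<Rightarrow> real" and p s :: real
  assumes g[measurable]: "g \<in> borel_measurable borel" and g0: "\<And>x. g x \<ge> 0"
    and p: "p > 0" and s: "0 < s" "s * p < DIM('a)"
    and P: "P = DIM('a) * p / (DIM('a) - s * p)"
    and c: "c = (1/2) powr p * (unit_ball_vol (real DIM('a)) / 2)
        * (2 * 2 powr P / unit_ball_vol (real DIM('a))) powr (- (s * p / DIM('a)))"
    and Z: "Z \<ge> 0" "(\<integral>\<^sup>+y. ennreal (g y powr P) \<partial>lborel) = ennreal Z"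
    and \<omega>: "\<omega> \<ge> 0" "slobodeckij p s g \<le> ennreal \<omega>"
  shows "Z \<le> (\<omega> / c) powr (DIM('a) / (DIM('a) - s * p))"
proof (cases "Z = 0")
  case False
  then have Zp: "Z > 0" using Z by simp
  define d where "d = real DIM('a)"
  have d: "d > 0" "d > s * p" using s by (auto simp: d_def)
  have c0: "c > 0" unfolding c using unit_ball_vol_pos[of "real DIM('a)", OF of_nat_0_le_iff]
    by (intro mult_pos_pos) (auto simp: less_imp_neq[symmetric])
  have ag: "\<bar>g y\<bar> = g y" for y using g0[of y] by simp
  let ?\<Gamma> = "\<lambda>x. \<integral>\<^sup>+h. ennreal (\<bar>g (x + h) - g x\<bar> powr p * norm h powr (-(d + s * p))) \<partial>lborel"
  have "ennreal (c * Z powr (- (s * p / d)) * Z) = (\<integral>\<^sup>+x. ennreal (c * Z powr (- (s * p / d))) * ennreal (g x powr P) \<partial>lborel)"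
    using c0 Z by (subst nn_integral_cmult) (auto simp: ennreal_mult'[symmetric])
  also have "\<dots> \<le> (\<integral>\<^sup>+x. ?\<Gamma> x \<partial>lborel)"
  proof (intro nn_integral_mono)
    fix x
    show "ennreal (c * Z powr (- (s * p / d))) * ennreal (g x powr P) \<le> ?\<Gamma> x"
    proof (cases "g x = 0")
      case False
      then have "g x > 0" using g0[of x] by simp
      from sobolev_pointwise[OF g this p s P refl Zp, folded c] Z(2) c0
      show ?thesis unfolding ag by (simp add: d_def ennreal_mult'[symmetric])
    qed simp
  qed
  also have "\<dots> = slobodeckij p s g"
    unfolding slobodeckij_def d_def real_norm_def by (rule lborel_pair.Fubini') measurable
  also have "\<dots> \<le> ennreal \<omega>" by (rule \<omega>)
  finally have "c * Z powr (- (s * p / d)) * Z \<le> \<omega>" using \<omega> by simp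
  moreover have "Z powr (- (s * p / d)) * Z = Z powr (1 - s * p / d)"
    using Zp powr_mult_base[of Z "- (s * p / d)"] by (simp add: mult.commute)
  ultimately have "c * Z powr (1 - s * p / d) \<le> \<omega>"
    by (metis mult.assoc)
  then have "Z powr (1 - s * p / d) \<le> \<omega> / c"
    using c0 by (simp add: pos_le_divide_eq mult.commute)
  then have "(Z powr (1 - s * p / d)) powr (d / (d - s * p)) \<le> (\<omega> / c) powr (d / (d - s * p))"
    using d by (intro powr_mono2) auto
  also have "(Z powr (1 - s * p / d)) powr (d / (d - s * p)) = Z"
  proof -
    have "(1 - s * p / d) * (d / (d - s * p)) = 1" using d by (simp add: field_simps)
    then show ?thesis using Zp by (simp only: powr_powr) simp
  qed
  finally show ?thesis by (simp add: d_def)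
qed simp

text \<open>The truncation min (norm (u x)) n does not increase the seminorm, being a 1-Lipschitz
  function of u. Since P > p, its P-th power is at most n powr (P - p) * norm (u x) powr p, so its
  integral is finite. The bound is uniform in n and passes to the limit monotonically; integrability
  of the p-th power is used only qualitatively.\<close>

theorem fractional_sobolev_inequality:
  fixes p s :: real
  assumes p: "p > 0" and s: "0 < s" "s * p < DIM('a::euclidean_space)"
  obtains C where "C > 0" and
    "\<And>(u :: 'a \<Rightarrow> 'b::euclidean_space) \<omega>. u \<in> borel_measurable borel \<Longrightarrow>
      (\<integral>\<^sup>+x. ennreal (norm (u x) powr p) \<partial>lborel) < \<infinity> \<Longrightarrow> \<omega> \<ge> 0 \<Longrightarrow> slobodeckij p s u \<le> ennreal \<omega> \<Longrightarrow>
      (\<integral>\<^sup>+x. ennreal (norm (u x) powr (DIM('a) * p / (DIM('a) - s * p))) \<partial>lborel)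
        \<le> ennreal (C * \<omega> powr (DIM('a) / (DIM('a) - s * p)))"
proof -
  define d where "d = real DIM('a)"
  have d: "d > 0" "d > s * p" using s by (auto simp: d_def)
  define P where "P = d * p / (d - s * p)"
  have Pp: "P > p" using d p s by (simp add: P_def field_simps)
  define c where "c = (1/2) powr p * (unit_ball_vol d / 2)
        * (2 * 2 powr P / unit_ball_vol d) powr (- (s * p / d))"
  have c0: "c > 0" unfolding c_def using unit_ball_vol_pos[OF less_imp_le[OF d(1)]]
    by (intro mult_pos_pos) (auto simp: less_imp_neq[symmetric])
  define \<gamma> where "\<gamma> = d / (d - s * p)"
  show thesis
  proof (rule that[of "(1 / c) powr \<gamma>"])
    fix u :: "'a \<Rightarrow> 'b" and \<omega>
    assume u[measurable]: "u \<in> borel_measurable borel" and \<omega>: "\<omega> \<ge> 0"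
      and fin: "(\<integral>\<^sup>+x. ennreal (norm (u x) powr p) \<partial>lborel) < \<infinity>"
      and slob: "slobodeckij p s u \<le> ennreal \<omega>"
    define g where "g n x = min (norm (u x)) (real n)" for n :: nat and x
    have [measurable]: "g n \<in> borel_measurable borel" for n unfolding g_def by measurable
    have g0: "g n x \<ge> 0" for n x by (simp add: g_def)
    have "slobodeckij p s (g n) \<le> slobodeckij p s u" for n
      unfolding slobodeckij_def
    proof (intro nn_integral_mono ennreal_leI mult_right_mono powr_mono2)
      fix x h
      have "\<bar>min a m - min b m\<bar> \<le> \<bar>a - b\<bar>" for a b m :: real by linarith
      then have "\<bar>g n (x + h) - g n x\<bar> \<le> \<bar>norm (u (x + h)) - norm (u x)\<bar>"
        by (simp add: g_def)
      also have "\<dots> \<le> norm (u (x + h) - u x)" by (rule norm_triangle_ineq3)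
      finally show "norm (g n (x + h) - g n x) \<le> norm (u (x + h) - u x)" by simp
    qed (use p in auto)
    then have gs: "slobodeckij p s (g n) \<le> ennreal \<omega>" for n using slob order_trans by blast
    have bound: "(\<integral>\<^sup>+x. ennreal (g n x powr P) \<partial>lborel) \<le> ennreal ((\<omega> / c) powr \<gamma>)" for n
    proof -
      have "(\<integral>\<^sup>+x. ennreal (g n x powr P) \<partial>lborel)
          \<le> (\<integral>\<^sup>+x. ennreal (real n powr (P - p)) * ennreal (norm (u x) powr p) \<partial>lborel)"
      proof (intro nn_integral_mono)
        fix x
        have "g n x powr P = g n x powr (P - p) * g n x powr p" by (simp add: powr_add[symmetric])
        also have "\<dots> \<le> real n powr (P - p) * norm (u x) powr p"
          using Pp p g0 by (intro mult_mono powr_mono2) (auto simp: g_def)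
        finally show "ennreal (g n x powr P) \<le> ennreal (real n powr (P - p)) * ennreal (norm (u x) powr p)"
          by (simp add: ennreal_mult'[symmetric] ennreal_leI)
      qed
      also have "\<dots> < \<infinity>"
        using fin by (simp add: nn_integral_cmult ennreal_mult_less_top)
      finally obtain Z where Z: "Z \<ge> 0" "(\<integral>\<^sup>+x. ennreal (g n x powr P) \<partial>lborel) = ennreal Z"
        by (cases "\<integral>\<^sup>+x. ennreal (g n x powr P) \<partial>lborel") auto
      have "Z \<le> (\<omega> / c) powr (DIM('a) / (DIM('a) - s * p))"
        by (rule sobolev_truncated[of "g n", OF _ g0 p s P_def[unfolded d_def] c_def[unfolded d_def] Z \<omega> gs]) auto
      then show ?thesis by (simp add: Z \<gamma>_def d_def ennreal_leI)
    qed
    have "(\<lambda>n. \<integral>\<^sup>+x. ennreal (g n x powr P) \<partial>lborel) \<longlonglongrightarrow> (\<integral>\<^sup>+x. ennreal (norm (u x) powr P) \<partial>lborel)"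
    proof (rule nn_integral_LIMSEQ)
      show "incseq (\<lambda>n x. ennreal (g n x powr P))"
        using Pp p g0 by (auto simp: incseq_def le_fun_def g_def intro!: ennreal_leI powr_mono2)
      fix x
      obtain m :: nat where m: "norm (u x) \<le> real m" using real_arch_simple by blast
      have "eventually (\<lambda>n. ennreal (g n x powr P) = ennreal (norm (u x) powr P)) sequentially"
        using eventually_ge_at_top[of m] by eventually_elim (use m in \<open>simp add: g_def min_def\<close>)
      then show "(\<lambda>n. ennreal (g n x powr P)) \<longlonglongrightarrow> ennreal (norm (u x) powr P)"
        by (rule tendsto_eventually)
    qed measurable
    then have "(\<integral>\<^sup>+x. ennreal (norm (u x) powr P) \<partial>lborel) \<le> ennreal ((\<omega> / c) powr \<gamma>)"
      using bound by (intro LIMSEQ_le_const2) auto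
    also have "(\<omega> / c) powr \<gamma> = (1 / c) powr \<gamma> * \<omega> powr \<gamma>"
      using \<omega> c0 by (simp add: powr_divide)
    finally show "(\<integral>\<^sup>+x. ennreal (norm (u x) powr (DIM('a) * p / (DIM('a) - s * p))) \<partial>lborel)
        \<le> ennreal ((1 / c) powr \<gamma> * \<omega> powr (DIM('a) / (DIM('a) - s * p)))"
      by (simp add: P_def \<gamma>_def d_def)
  qed (use c0 in auto)
qed

section \<open>Continuity of translations\<close>

lemma nn_integral_Holder:
  fixes f g :: "'a \<Rightarrow> real"
  assumes [measurable]: "f \<in> borel_measurable M" "g \<in> borel_measurable M"
    and f0: "\<And>x. f x \<ge> 0" and g0: "\<And>x. g x \<ge> 0"
    and ab: "a > 1" "b > 1" "1 / a + 1 / b = 1"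
    and X: "X \<ge> 0" "(\<integral>\<^sup>+x. ennreal (f x powr a) \<partial>M) \<le> ennreal X"
    and Y: "Y \<ge> 0" "(\<integral>\<^sup>+x. ennreal (g x powr b) \<partial>M) \<le> ennreal Y"
  shows "(\<integral>\<^sup>+x. ennreal (f x * g x) \<partial>M) \<le> ennreal (X powr (1 / a) * Y powr (1 / b))"
proof -
  \<comment> \<open>The normalisation behind Young's inequality divides by powers of X and Y. If one
    of them is 0, a factor vanishes almost everywhere.\<close>
  have zero: "(\<integral>\<^sup>+x. ennreal (f x * g x) \<partial>M) = 0"
    if "(\<integral>\<^sup>+x. ennreal (h x powr c) \<partial>M) \<le> 0" "\<And>x. h x = 0 \<Longrightarrow> f x * g x = 0"
      and h[measurable]: "h \<in> borel_measurable M" for h and c :: real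
  proof -
    have "AE x in M. ennreal (h x powr c) = 0"
      using that(1) by (subst nn_integral_0_iff_AE[symmetric]) auto
    then have "AE x in M. ennreal (f x * g x) = 0"
    proof eventually_elim
      case (elim x)
      then have "h x = 0" by (simp add: ennreal_eq_0_iff)
      then show ?case using that(2)[of x] by auto
    qed
    then show ?thesis by (subst nn_integral_0_iff_AE) auto
  qed
  consider "X = 0" | "Y = 0" | "X > 0" "Y > 0" using X(1) Y(1) by fastforce
  then show ?thesis
  proof cases
    case 1
    then show ?thesis using zero[of f a] X(2) by simp
  next
    case 2
    then show ?thesis using zero[of g b] Y(2) by simp
  next
    case 3
    let ?x = "X powr (1 / a)" and ?y = "Y powr (1 / b)"
    have pt: "f x * g x \<le> ?x * ?y / (a * X) * f x powr a + ?x * ?y / (b * Y) * g x powr b" for x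
    proof -
      have "(f x / ?x) * (g x / ?y) \<le> (f x / ?x) powr a / a + (g x / ?y) powr b / b"
        using f0 g0 ab by (intro Youngs_inequality) auto
      also have "\<dots> = f x powr a / (a * X) + g x powr b / (b * Y)"
        using f0 g0 3 ab by (simp add: powr_divide powr_powr mult.commute)
      finally have "(f x / ?x) * (g x / ?y) * (?x * ?y) \<le> (f x powr a / (a * X) + g x powr b / (b * Y)) * (?x * ?y)"
        by (rule mult_right_mono) simp
      then show ?thesis using 3 by (simp add: algebra_simps)
    qed
    have "(\<integral>\<^sup>+x. ennreal (f x * g x) \<partial>M) \<le> (\<integral>\<^sup>+x. ennreal (?x * ?y / (a * X)) * ennreal (f x powr a)
        + ennreal (?x * ?y / (b * Y)) * ennreal (g x powr b) \<partial>M)"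
      using pt 3 ab by (intro nn_integral_mono)
        (simp add: ennreal_plus[symmetric] ennreal_mult'[symmetric] ennreal_leI del: ennreal_plus)
    also have "\<dots> = ennreal (?x * ?y / (a * X)) * (\<integral>\<^sup>+x. ennreal (f x powr a) \<partial>M)
        + ennreal (?x * ?y / (b * Y)) * (\<integral>\<^sup>+x. ennreal (g x powr b) \<partial>M)"
      by (simp add: nn_integral_add nn_integral_cmult)
    also have "\<dots> \<le> ennreal (?x * ?y / (a * X)) * ennreal X + ennreal (?x * ?y / (b * Y)) * ennreal Y"
      by (intro add_mono mult_left_mono X Y) auto
    also have "\<dots> = ennreal (?x * ?y / a + ?x * ?y / b)"
      using 3 ab by (simp add: ennreal_mult'[symmetric] ennreal_plus[symmetric] del: ennreal_plus)
    also have "?x * ?y / a + ?x * ?y / b = ?x * ?y * (1 / a + 1 / b)" by (simp add: algebra_simps)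
    finally show ?thesis by (simp add: ab)
  qed
qed

text \<open>Enclose A in an open U of slightly larger measure. A point of A moved out of A by z
  either lands in U - A, which is small and translation invariant, or leaves U; then it lies within
  norm z of the complement of U. These boundary strips decrease to the empty set inside a set of
  finite measure.\<close>

lemma emeasure_translation_diff_small:
  fixes A :: "'a::euclidean_space set"
  assumes A[measurable]: "A \<in> sets borel" and fin: "emeasure lborel A < \<infinity>" and e: "e > 0"
  obtains \<delta> where "\<delta> > 0" and
    "\<And>z. norm z < \<delta> \<Longrightarrow> emeasure lborel {x \<in> A. x + z \<notin> A} \<le> ennreal e"
proof -
  obtain U where U: "open U" "A \<subseteq> U" "emeasure lborel (U - A) < ennreal (e / 2)"
    using outer_regular_lborel[OF A, of "e / 2"] e by auto
  have [measurable]: "U \<in> sets borel" using U by auto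
  have "emeasure lborel U = emeasure lborel (U - A) + emeasure lborel A"
    using U by (subst plus_emeasure) (auto intro!: arg_cong[where f="emeasure lborel"])
  then have Ufin: "emeasure lborel U < \<infinity>"
    using U fin by (simp add: less_top[symmetric]) (metis ennreal_less_top not_less_iff_gr_or_eq order_less_trans)
  \<comment> \<open>The distance to the complement characterises membership only for a nonempty
    complement.\<close>
  then have Une: "- U \<noteq> {}" by (metis Compl_UNIV_eq double_complement emeasure_lborel_UNIV less_irrefl)
  define S where "S n = {x \<in> U. infdist x (- U) \<le> 1 / real (Suc n)}" for n
  have [measurable]: "(\<lambda>x. infdist x (- U)) \<in> borel_measurable borel"
    by (intro borel_measurable_continuous_onI continuous_on_infdist continuous_on_id)
  have [measurable]: "S n \<in> sets borel" for n unfolding S_def by measurable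
  have "(\<Inter>n. S n) = {}"
  proof -
    have False if x: "x \<in> (\<Inter>n. S n)" for x
    proof -
      have "infdist x (- U) \<le> 1 / real (Suc n)" for n using x by (auto simp: S_def)
      then have "infdist x (- U) \<le> 0"
        by (intro LIMSEQ_le_const[OF LIMSEQ_inverse_real_of_nat]) (auto simp: inverse_eq_divide)
      then have "infdist x (- U) = 0" using infdist_nonneg[of x "-U"] by linarith
      then have "x \<in> - U" using in_closed_iff_infdist_zero[of "- U" x] U(1) Une by (auto simp: closed_Compl)
      then show False using x by (auto simp: S_def)
    qed
    then show ?thesis by auto
  qed
  moreover have "(\<lambda>n. emeasure lborel (S n)) \<longlonglongrightarrow> emeasure lborel (\<Inter>n. S n)"
  proof (rule Lim_emeasure_decseq)
    show "decseq S"
    proof (rule decseq_SucI, rule subsetI)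
      fix n x assume "x \<in> S (Suc n)"
      moreover have "1 / real (Suc (Suc n)) \<le> 1 / real (Suc n)" by (simp add: divide_simps)
      ultimately show "x \<in> S n" unfolding S_def by auto
    qed
    show "emeasure lborel (S n) \<noteq> \<infinity>" for n
    proof -
      have "emeasure lborel (S n) \<le> emeasure lborel U" by (intro emeasure_mono) (auto simp: S_def)
      then show ?thesis using Ufin by auto
    qed
  qed auto
  ultimately have "(\<lambda>n. emeasure lborel (S n)) \<longlonglongrightarrow> 0" by simp
  then have "eventually (\<lambda>n. emeasure lborel (S n) < ennreal (e / 2)) sequentially"
    using e by (intro order_tendstoD(2)[of _ 0]) (auto simp: ennreal_less_zero_iff)
  then obtain n where n: "emeasure lborel (S n) < ennreal (e / 2)"
    by (auto simp: eventually_sequentially)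
  show thesis
  proof (rule that[of "1 / real (Suc n)"])
    fix z :: 'a assume z: "norm z < 1 / real (Suc n)"
    have sub: "{x \<in> A. x + z \<notin> A} \<subseteq> {x. x + z \<in> U - A} \<union> S n"
    proof
      fix x assume x: "x \<in> {x \<in> A. x + z \<notin> A}"
      have "x \<in> S n" if "x + z \<notin> U"
      proof -
        have "infdist x (- U) \<le> dist x (x + z)" using that by (intro infdist_le) auto
        then show ?thesis using z x U by (auto simp: S_def dist_norm)
      qed
      then show "x \<in> {x. x + z \<in> U - A} \<union> S n" using x by auto
    qed
    have "emeasure lborel {x \<in> A. x + z \<notin> A} \<le> emeasure lborel ({x. x + z \<in> U - A} \<union> S n)"
      by (intro emeasure_mono sub) measurable
    also have "\<dots> \<le> emeasure lborel {x. x + z \<in> U - A} + emeasure lborel (S n)"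
      by (intro emeasure_subadditive) measurable
    also have "emeasure lborel {x. x + z \<in> U - A} = (\<integral>\<^sup>+x. indicator (U - A) (x + z) \<partial>lborel)"
    proof -
      have "(\<integral>\<^sup>+x. indicator (U - A) (x + z) \<partial>lborel) = (\<integral>\<^sup>+x. indicator {x. x + z \<in> U - A} x \<partial>lborel)"
        by (simp add: indicator_def)
      also have "\<dots> = emeasure lborel {x. x + z \<in> U - A}"
        by (intro nn_integral_indicator) measurable
      finally show ?thesis by simp
    qed
    also have "\<dots> = emeasure lborel (U - A)"
      by (subst nn_integral_lborel_shift) auto
    also have "\<dots> + emeasure lborel (S n) \<le> ennreal (e / 2) + ennreal (e / 2)"
      using n U by (intro add_mono) auto
    also have "\<dots> = ennreal e" using e by (simp add: ennreal_plus[symmetric] del: ennreal_plus)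
    finally show "emeasure lborel {x \<in> A. x + z \<notin> A} \<le> ennreal e" .
  qed auto
qed

text \<open>The usual density argument as an induction over integrable functions: indicators are the
  previous lemma, and sums and dominated limits preserve the property by the triangle
  inequality.\<close>

lemma translation_continuous_L1:
  fixes g :: "'a::euclidean_space \<Rightarrow> 'b::{banach, second_countable_topology}"
  assumes "integrable lborel g"
  shows "\<forall>e>0. \<exists>\<delta>>0. \<forall>z. norm z < \<delta> \<longrightarrow> (\<integral>\<^sup>+x. ennreal (norm (g (x + z) - g x)) \<partial>lborel) \<le> ennreal e"
  using assms
proof (induction rule: integrable_induct)
  case (base A c)
  have A[measurable]: "A \<in> sets borel" using base by simp
  show ?case
  proof (intro allI impI)
    fix e :: real assume e: "e > 0"
    define e' where "e' = e / 2 / (norm c + 1)"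
    have e': "e' > 0" using e by (simp add: e'_def add_nonneg_pos)
    obtain \<delta> where \<delta>: "\<delta> > 0"
      "\<And>z. norm z < \<delta> \<Longrightarrow> emeasure lborel {x \<in> A. x + z \<notin> A} \<le> ennreal e'"
      using emeasure_translation_diff_small[OF A base(2) e'] by blast
    show "\<exists>\<delta>>0. \<forall>z. norm z < \<delta> \<longrightarrow>
        (\<integral>\<^sup>+x. ennreal (norm (indicator A (x + z) *\<^sub>R c - indicator A x *\<^sub>R c)) \<partial>lborel) \<le> ennreal e"
    proof (intro exI[of _ \<delta>] conjI allI impI \<delta>(1))
      fix z :: 'a assume z: "norm z < \<delta>"
      \<comment> \<open>The difference is supported where exactly one of x and x + z lies in A:
        either x leaves A under z, or x + z leaves A under -z.\<close>
      have "(\<integral>\<^sup>+x. ennreal (norm (indicator A (x + z) *\<^sub>R c - indicator A x *\<^sub>R c)) \<partial>lborel)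
        = (\<integral>\<^sup>+x. ennreal (norm c) * (indicator {x \<in> A. x + (- z) \<notin> A} (x + z) + indicator {x \<in> A. x + z \<notin> A} x) \<partial>lborel)"
        by (intro nn_integral_cong) (auto simp: indicator_def)
      also have "\<dots> = ennreal (norm c) * ((\<integral>\<^sup>+x. indicator {x \<in> A. x + (- z) \<notin> A} (x + z) \<partial>lborel)
          + emeasure lborel {x \<in> A. x + z \<notin> A})"
        by (simp add: nn_integral_cmult nn_integral_add)
      also have "(\<integral>\<^sup>+x. indicator {x \<in> A. x + (- z) \<notin> A} (x + z) \<partial>lborel) = emeasure lborel {x \<in> A. x + (- z) \<notin> A}"
        by (subst nn_integral_lborel_shift) auto
      also have "ennreal (norm c) * (emeasure lborel {x \<in> A. x + (- z) \<notin> A} + emeasure lborel {x \<in> A. x + z \<notin> A})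
          \<le> ennreal (norm c) * (ennreal e' + ennreal e')"
        using z by (intro mult_left_mono add_mono \<delta>(2)) auto
      also have "\<dots> = ennreal (norm c * (2 * e'))"
        using e' by (simp add: ennreal_mult'[symmetric] ennreal_plus[symmetric] del: ennreal_plus)
      also have "\<dots> \<le> ennreal e"
      proof (intro ennreal_leI)
        have "norm c * (2 * e') \<le> (norm c + 1) * (2 * e')"
          using e' by (intro mult_right_mono) auto
        also have "\<dots> = e"
          using norm_ge_zero[of c] by (simp add: e'_def field_simps add_nonneg_eq_0_iff)
        finally show "norm c * (2 * e') \<le> e" .
      qed
      finally show "(\<integral>\<^sup>+x. ennreal (norm (indicator A (x + z) *\<^sub>R c - indicator A x *\<^sub>R c)) \<partial>lborel) \<le> ennreal e" .
    qed
  qed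
next
  case (add f g)
  have [measurable]: "f \<in> borel_measurable borel" "g \<in> borel_measurable borel"
    using add.hyps by auto
  show ?case
  proof (intro allI impI)
    fix e :: real assume e: "e > 0"
    then have e2: "e / 2 > 0" by simp
    from add.IH(1)[rule_format, OF e2] obtain d1 where d1: "d1 > 0"
      "\<And>z. norm z < d1 \<Longrightarrow> (\<integral>\<^sup>+x. ennreal (norm (f (x + z) - f x)) \<partial>lborel) \<le> ennreal (e / 2)"
      by blast
    from add.IH(2)[rule_format, OF e2] obtain d2 where d2: "d2 > 0"
      "\<And>z. norm z < d2 \<Longrightarrow> (\<integral>\<^sup>+x. ennreal (norm (g (x + z) - g x)) \<partial>lborel) \<le> ennreal (e / 2)"
      by blast
    show "\<exists>\<delta>>0. \<forall>z. norm z < \<delta> \<longrightarrow> (\<integral>\<^sup>+x. ennreal (norm (f (x + z) + g (x + z) - (f x + g x))) \<partial>lborel) \<le> ennreal e"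
    proof (intro exI[of _ "min d1 d2"] conjI allI impI)
      fix z :: 'a assume z: "norm z < min d1 d2"
      have "(\<integral>\<^sup>+x. ennreal (norm (f (x + z) + g (x + z) - (f x + g x))) \<partial>lborel)
        \<le> (\<integral>\<^sup>+x. ennreal (norm (f (x + z) - f x)) + ennreal (norm (g (x + z) - g x)) \<partial>lborel)"
        by (intro nn_integral_mono)
          (simp add: ennreal_plus[symmetric] ennreal_leI add_diff_add norm_triangle_ineq del: ennreal_plus)
      also have "\<dots> = (\<integral>\<^sup>+x. ennreal (norm (f (x + z) - f x)) \<partial>lborel) + (\<integral>\<^sup>+x. ennreal (norm (g (x + z) - g x)) \<partial>lborel)"
        by (intro nn_integral_add) measurable
      also have "\<dots> \<le> ennreal (e / 2) + ennreal (e / 2)"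
        using z by (intro add_mono d1(2) d2(2)) auto
      finally show "(\<integral>\<^sup>+x. ennreal (norm (f (x + z) + g (x + z) - (f x + g x))) \<partial>lborel) \<le> ennreal e"
        using e by (simp add: ennreal_plus[symmetric] del: ennreal_plus)
    qed (use d1 d2 in auto)
  qed
next
  case (lim f s)
  have [measurable]: "f \<in> borel_measurable borel" "s i \<in> borel_measurable borel" for i
    using lim.hyps(1)[of i] lim.hyps(4) by auto
  have "(\<lambda>i. \<integral>\<^sup>+x. ennreal (norm (s i x - f x)) \<partial>lborel) \<longlonglongrightarrow> (\<integral>\<^sup>+x. 0 \<partial>(lborel :: 'a measure))"
  proof (rule nn_integral_dominated_convergence[where w="\<lambda>x. ennreal (3 * norm (f x))"])
    show "AE x in lborel. ennreal (norm (s i x - f x)) \<le> ennreal (3 * norm (f x))" for i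
    proof (intro AE_I2 ennreal_leI)
      fix x
      show "norm (s i x - f x) \<le> 3 * norm (f x)"
        using norm_triangle_ineq4[of "s i x" "f x"] lim.hyps(3)[of x i] by simp
    qed
    show "(\<integral>\<^sup>+x. ennreal (3 * norm (f x)) \<partial>lborel) < \<infinity>"
      using lim.hyps(4) by (simp add: ennreal_mult' nn_integral_cmult ennreal_mult_less_top integrable_iff_bounded)
    show "AE x in lborel. (\<lambda>i. ennreal (norm (s i x - f x))) \<longlonglongrightarrow> 0"
    proof (intro AE_I2)
      fix x
      have "(\<lambda>i. norm (s i x - f x)) \<longlonglongrightarrow> 0"
        using lim.hyps(2)[of x] by (simp add: LIM_zero tendsto_norm_zero)
      then show "(\<lambda>i. ennreal (norm (s i x - f x))) \<longlonglongrightarrow> 0"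
        by (intro tendsto_ennrealI[of _ 0, simplified])
    qed
  qed measurable
  then have conv: "(\<lambda>i. \<integral>\<^sup>+x. ennreal (norm (s i x - f x)) \<partial>lborel) \<longlonglongrightarrow> 0" by simp
  show ?case
  proof (intro allI impI)
    fix e :: real assume e: "e > 0"
    have "eventually (\<lambda>i. (\<integral>\<^sup>+x. ennreal (norm (s i x - f x)) \<partial>lborel) < ennreal (e / 3)) sequentially"
      using e by (intro order_tendstoD(2)[OF conv]) (simp add: ennreal_less_zero_iff)
    then obtain i where i: "(\<integral>\<^sup>+x. ennreal (norm (s i x - f x)) \<partial>lborel) < ennreal (e / 3)"
      by (auto simp: eventually_sequentially)
    have e3: "e / 3 > 0" using e by simp
    from lim.IH[rule_format, OF e3, of i] obtain \<delta> where \<delta>: "\<delta> > 0"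
      "\<And>z. norm z < \<delta> \<Longrightarrow> (\<integral>\<^sup>+x. ennreal (norm (s i (x + z) - s i x)) \<partial>lborel) \<le> ennreal (e / 3)"
      by blast
    show "\<exists>\<delta>>0. \<forall>z. norm z < \<delta> \<longrightarrow> (\<integral>\<^sup>+x. ennreal (norm (f (x + z) - f x)) \<partial>lborel) \<le> ennreal e"
    proof (intro exI[of _ \<delta>] conjI allI impI \<delta>(1))
      fix z :: 'a assume z: "norm z < \<delta>"
      have tri: "norm (f (x + z) - f x) \<le> norm (s i (x + z) - f (x + z)) + norm (s i (x + z) - s i x) + norm (s i x - f x)" for x
        by norm
      have "(\<integral>\<^sup>+x. ennreal (norm (f (x + z) - f x)) \<partial>lborel)
        \<le> (\<integral>\<^sup>+x. (ennreal (norm (s i (x + z) - f (x + z))) + ennreal (norm (s i (x + z) - s i x))) + ennreal (norm (s i x - f x)) \<partial>lborel)"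
        by (intro nn_integral_mono) (simp add: ennreal_plus[symmetric] ennreal_leI tri del: ennreal_plus)
      also have "\<dots> = ((\<integral>\<^sup>+x. ennreal (norm (s i (x + z) - f (x + z))) \<partial>lborel)
          + (\<integral>\<^sup>+x. ennreal (norm (s i (x + z) - s i x)) \<partial>lborel)) + (\<integral>\<^sup>+x. ennreal (norm (s i x - f x)) \<partial>lborel)"
        by (simp add: nn_integral_add)
      also have "(\<integral>\<^sup>+x. ennreal (norm (s i (x + z) - f (x + z))) \<partial>lborel) = (\<integral>\<^sup>+x. ennreal (norm (s i x - f x)) \<partial>lborel)"
        by (rule nn_integral_lborel_shift) measurable
      also have "((\<integral>\<^sup>+x. ennreal (norm (s i x - f x)) \<partial>lborel) + (\<integral>\<^sup>+x. ennreal (norm (s i (x + z) - s i x)) \<partial>lborel))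
          + (\<integral>\<^sup>+x. ennreal (norm (s i x - f x)) \<partial>lborel) \<le> (ennreal (e / 3) + ennreal (e / 3)) + ennreal (e / 3)"
        using z i by (intro add_mono \<delta>(2)) auto
      also have "\<dots> = ennreal e" using e by (simp add: ennreal_plus[symmetric] del: ennreal_plus)
      finally show "(\<integral>\<^sup>+x. ennreal (norm (f (x + z) - f x)) \<partial>lborel) \<le> ennreal e" .
    qed
  qed
qed

text \<open>Reduction to the case of L^1. Cutting off large values of g makes \<open>G n\<close>
  bounded, cutting off small values makes it integrable, since there norm (g x) is at most a
  constant times its b-th power. For a function bounded by N, the b-th power of an increment is at
  most (2 * N) powr (b - 1) times the increment.\<close>

lemma translation_continuous_Lp:
  fixes g :: "'a::euclidean_space \<Rightarrow> 'b::euclidean_space" and b :: real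
  assumes g[measurable]: "g \<in> borel_measurable borel" and b: "b \<ge> 1"
    and fin: "(\<integral>\<^sup>+x. ennreal (norm (g x) powr b) \<partial>lborel) < \<infinity>" and e: "e > 0"
  obtains \<delta> where "\<delta> > 0" and
    "\<And>z. norm z < \<delta> \<Longrightarrow> (\<integral>\<^sup>+x. ennreal (norm (g (x + z) - g x) powr b) \<partial>lborel) \<le> ennreal e"
proof -
  define G where "G n x = (if 1 / real (Suc n) \<le> norm (g x) \<and> norm (g x) \<le> real (Suc n) then g x else 0)" for n x
  have [measurable]: "G n \<in> borel_measurable borel" for n unfolding G_def by measurable
  have "(\<lambda>n. \<integral>\<^sup>+x. ennreal (norm (G n x - g x) powr b) \<partial>lborel) \<longlonglongrightarrow> (\<integral>\<^sup>+x. 0 \<partial>(lborel :: 'a measure))"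
  proof (rule nn_integral_dominated_convergence[where w="\<lambda>x. ennreal (norm (g x) powr b)"])
    show "AE x in lborel. ennreal (norm (G n x - g x) powr b) \<le> ennreal (norm (g x) powr b)" for n
      by (intro AE_I2 ennreal_leI) (auto simp: G_def)
    show "AE x in lborel. (\<lambda>n. ennreal (norm (G n x - g x) powr b)) \<longlonglongrightarrow> 0"
    proof (intro AE_I2)
      fix x
      obtain m :: nat where m: "norm (g x) \<le> real m" using real_arch_simple by blast
      obtain k :: nat where k: "g x \<noteq> 0 \<Longrightarrow> 1 / real (Suc k) \<le> norm (g x)"
        using nat_approx_posE[of "norm (g x)"] by (metis less_imp_le zero_less_norm_iff)
      have "eventually (\<lambda>n. ennreal (norm (G n x - g x) powr b) = 0) sequentially"
        using eventually_ge_at_top[of m] eventually_ge_at_top[of k]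
      proof eventually_elim
        case (elim n)
        have "1 / real (Suc n) \<le> 1 / real (Suc k)" using elim by (simp add: divide_simps)
        then have "G n x = g x" using elim m k unfolding G_def by (cases "g x = 0") auto
        then show ?case using b by simp
      qed
      then show "(\<lambda>n. ennreal (norm (G n x - g x) powr b)) \<longlonglongrightarrow> 0" by (rule tendsto_eventually)
    qed
  qed (use fin in auto)
  then have conv: "(\<lambda>n. \<integral>\<^sup>+x. ennreal (norm (G n x - g x) powr b) \<partial>lborel) \<longlonglongrightarrow> 0" by simp
  \<comment> \<open>Three terms of size e' appear below, with the common factor 4 powr b.\<close>
  define e' where "e' = e / (3 * 4 powr b)"
  have e': "e' > 0" using e by (simp add: e'_def)
  have "eventually (\<lambda>n. (\<integral>\<^sup>+x. ennreal (norm (G n x - g x) powr b) \<partial>lborel) < ennreal e') sequentially"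
    using e' by (intro order_tendstoD(2)[OF conv]) (simp add: ennreal_less_zero_iff)
  then obtain n where n: "(\<integral>\<^sup>+x. ennreal (norm (G n x - g x) powr b) \<partial>lborel) < ennreal e'"
    by (auto simp: eventually_sequentially)
  define N where "N = real (Suc n)"
  have N: "N > 0" by (simp add: N_def)
  have Gb: "norm (G n x) \<le> N" for x by (auto simp: G_def N_def)
  have "integrable lborel (G n)"
  proof (rule integrableI_bounded)
    have "norm (G n x) \<le> N powr (b - 1) * norm (g x) powr b" for x
    proof (cases "1 / N \<le> norm (g x) \<and> norm (g x) \<le> N")
      case True
      then have pos: "norm (g x) > 0" using N by (metis divide_pos_pos less_le_trans zero_less_one)
      have "norm (g x) * 1 \<le> norm (g x) * (N * norm (g x)) powr (b - 1)"
        using True N b pos by (intro mult_left_mono ge_one_powr_ge_zero) (auto simp: divide_simps mult.commute)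
      also have "\<dots> = N powr (b - 1) * norm (g x) powr b"
        using N pos by (simp add: powr_mult powr_diff)
      finally show ?thesis using True by (simp add: G_def N_def)
    next
      case False
      then have "G n x = 0" unfolding G_def N_def[symmetric] by auto
      then show ?thesis by simp
    qed
    then have "(\<integral>\<^sup>+x. ennreal (norm (G n x)) \<partial>lborel) \<le> (\<integral>\<^sup>+x. ennreal (N powr (b - 1)) * ennreal (norm (g x) powr b) \<partial>lborel)"
      by (intro nn_integral_mono) (simp add: ennreal_mult'[symmetric] ennreal_leI)
    also have "\<dots> < \<infinity>" using fin by (simp add: nn_integral_cmult ennreal_mult_less_top)
    finally show "(\<integral>\<^sup>+x. ennreal (norm (G n x)) \<partial>lborel) < \<infinity>" .
  qed measurable
  \<comment> \<open>The tolerance compensates the factor (2 * N) powr (b - 1) lost in passing from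
    first to b-th powers.\<close>
  from translation_continuous_L1[OF this, rule_format, of "e' / (2 * N) powr (b - 1)"] e' N obtain \<delta> where \<delta>: "\<delta> > 0" "\<And>z. norm z < \<delta> \<Longrightarrow>
      (\<integral>\<^sup>+x. ennreal (norm (G n (x + z) - G n x)) \<partial>lborel) \<le> ennreal (e' / (2 * N) powr (b - 1))"
    by auto
  show thesis
  proof (rule that[OF \<delta>(1)])
    fix z :: 'a assume z: "norm z < \<delta>"
    have pt: "norm (g (x + z) - g x) powr b \<le> 4 powr b * (norm (G n (x + z) - g (x + z)) powr b
        + norm (G n x - g x) powr b + (2 * N) powr (b - 1) * norm (G n (x + z) - G n x))" for x
    proof -
      let ?A = "norm (G n (x + z) - g (x + z))" and ?B = "norm (G n x - g x)" and ?C = "norm (G n (x + z) - G n x)"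
      have "norm (g (x + z) - g x) \<le> ?A + (?B + ?C)" by norm
      then have "norm (g (x + z) - g x) powr b \<le> (?A + (?B + ?C)) powr b"
        using b by (intro powr_mono2) auto
      also have "\<dots> \<le> 2 powr b * (?A powr b + (?B + ?C) powr b)"
        using b by (intro powr_add_le) auto
      also have "\<dots> \<le> 2 powr b * (2 powr b * ?A powr b + 2 powr b * (?B powr b + ?C powr b))"
      proof (intro mult_left_mono add_mono powr_add_le)
        have "1 * ?A powr b \<le> 2 powr b * ?A powr b"
          using b by (intro mult_right_mono ge_one_powr_ge_zero) auto
        then show "?A powr b \<le> 2 powr b * ?A powr b" by simp
      qed (use b in auto)
      also have "\<dots> = 4 powr b * (?A powr b + ?B powr b + ?C powr b)"
        using powr_mult[of 2 2 b] by (simp add: algebra_simps)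
      also have "?C powr b \<le> (2 * N) powr (b - 1) * ?C"
      proof -
        have "?C \<le> 2 * N" using norm_triangle_ineq4[of "G n (x + z)" "G n x"] Gb[of x] Gb[of "x + z"] by linarith
        then have "?C powr (b - 1) * ?C \<le> (2 * N) powr (b - 1) * ?C"
          using b by (intro mult_right_mono powr_mono2) auto
        then show ?thesis using b powr_mult_base[of ?C "b - 1"] by (simp add: mult.commute)
      qed
      finally show ?thesis by (simp add: mult_left_mono)
    qed
    have "(\<integral>\<^sup>+x. ennreal (norm (g (x + z) - g x) powr b) \<partial>lborel)
      \<le> (\<integral>\<^sup>+x. ennreal (4 powr b) * ((ennreal (norm (G n (x + z) - g (x + z)) powr b) + ennreal (norm (G n x - g x) powr b))
        + ennreal ((2 * N) powr (b - 1)) * ennreal (norm (G n (x + z) - G n x))) \<partial>lborel)"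
      using pt by (intro nn_integral_mono)
        (simp add: ennreal_plus[symmetric] ennreal_mult'[symmetric] ennreal_leI del: ennreal_plus)
    also have "\<dots> = ennreal (4 powr b) * (((\<integral>\<^sup>+x. ennreal (norm (G n (x + z) - g (x + z)) powr b) \<partial>lborel)
        + (\<integral>\<^sup>+x. ennreal (norm (G n x - g x) powr b) \<partial>lborel))
        + ennreal ((2 * N) powr (b - 1)) * (\<integral>\<^sup>+x. ennreal (norm (G n (x + z) - G n x)) \<partial>lborel))"
      by (simp add: nn_integral_add nn_integral_cmult)
    also have "(\<integral>\<^sup>+x. ennreal (norm (G n (x + z) - g (x + z)) powr b) \<partial>lborel) = (\<integral>\<^sup>+x. ennreal (norm (G n x - g x) powr b) \<partial>lborel)"
      by (rule nn_integral_lborel_shift) measurable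
    also have "ennreal (4 powr b) * (((\<integral>\<^sup>+x. ennreal (norm (G n x - g x) powr b) \<partial>lborel)
        + (\<integral>\<^sup>+x. ennreal (norm (G n x - g x) powr b) \<partial>lborel))
        + ennreal ((2 * N) powr (b - 1)) * (\<integral>\<^sup>+x. ennreal (norm (G n (x + z) - G n x)) \<partial>lborel))
      \<le> ennreal (4 powr b) * ((ennreal e' + ennreal e') + ennreal ((2 * N) powr (b - 1)) * ennreal (e' / (2 * N) powr (b - 1)))"
      using n z by (intro add_mono mult_left_mono \<delta>(2)) auto
    also have "\<dots> = ennreal e"
      using e' N by (simp add: ennreal_plus[symmetric] ennreal_mult'[symmetric] del: ennreal_plus) (simp add: e'_def)
    finally show "(\<integral>\<^sup>+x. ennreal (norm (g (x + z) - g x) powr b) \<partial>lborel) \<le> ennreal e" .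
  qed
qed

text \<open>Fubini reduces the claim to single translations, for which Hoelder's inequality and
  continuity of translations suffice. The map \<iota> allows two uses: the identity for the force
  term, and z \<mapsto> (z, z) for the energy, where mollifying a function of one point translates a
  function of pairs along the diagonal.\<close>

lemma mollified_pairing_close:
  fixes F G :: "'b::euclidean_space \<Rightarrow> 'c::euclidean_space" and \<iota> :: "'a::euclidean_space \<Rightarrow> 'b"
  assumes [measurable]: "F \<in> borel_measurable borel" "G \<in> borel_measurable borel"
    and \<iota>: "linear \<iota>" and ab: "a > 1" "b > 1" "1 / a + 1 / b = 1"
    and F: "(\<integral>\<^sup>+x. ennreal (norm (F x) powr a) \<partial>lborel) < \<infinity>"
    and G: "(\<integral>\<^sup>+x. ennreal (norm (G x) powr b) \<partial>lborel) < \<infinity>"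
    and e: "e > 0"
  obtains \<delta> where "\<delta> > 0" and
    "\<And>\<eta>. \<eta> \<in> borel_measurable borel \<Longrightarrow> (\<And>z. \<eta> z \<ge> 0) \<Longrightarrow> (\<integral>\<^sup>+z. ennreal (\<eta> z) \<partial>lborel) = 1 \<Longrightarrow>
      (\<And>z. \<eta> z \<noteq> 0 \<Longrightarrow> norm z < \<delta>) \<Longrightarrow>
      (\<integral>\<^sup>+x. ennreal \<bar>F x \<bullet> (LINT z|lborel. \<eta> z *\<^sub>R G (x - \<iota> z)) - F x \<bullet> G x\<bar> \<partial>lborel) \<le> ennreal e"
proof -
  obtain X where X: "X \<ge> 0" "(\<integral>\<^sup>+x. ennreal (norm (F x) powr a) \<partial>lborel) = ennreal X"
    using F by (cases "\<integral>\<^sup>+x. ennreal (norm (F x) powr a) \<partial>lborel") auto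
  obtain Y where Y: "Y \<ge> 0" "(\<integral>\<^sup>+x. ennreal (norm (G x) powr b) \<partial>lborel) = ennreal Y"
    using G by (cases "\<integral>\<^sup>+x. ennreal (norm (G x) powr b) \<partial>lborel") auto
  \<comment> \<open>Solves X powr (1 / a) * e' powr (1 / b) \<le> e; the summand 1 covers X =
    0.\<close>
  define e' where "e' = (e / (X powr (1 / a) + 1)) powr b"
  have e': "e' > 0" using e by (auto simp: e'_def add_nonneg_pos less_imp_neq[symmetric])
  obtain \<delta>' where \<delta>': "\<delta>' > 0"
    "\<And>z. norm z < \<delta>' \<Longrightarrow> (\<integral>\<^sup>+x. ennreal (norm (G (x + z) - G x) powr b) \<partial>lborel) \<le> ennreal e'"
    using translation_continuous_Lp[of G b e'] G e' ab by auto
  obtain c where c: "c > 0" "\<And>z. norm (\<iota> z) \<le> c * norm z"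
    using linear_bounded_pos[OF \<iota>] by blast
  have [measurable]: "\<iota> \<in> borel_measurable borel"
    using \<iota> by (intro borel_measurable_continuous_onI linear_continuous_on) (simp add: linear_conv_bounded_linear)
  show thesis
  proof (rule that[of "\<delta>' / c"])
    show "\<delta>' / c > 0" using \<delta>' c by simp
    fix \<eta> :: "'a \<Rightarrow> real"
    assume [measurable]: "\<eta> \<in> borel_measurable borel" and \<eta>0: "\<And>z. \<eta> z \<ge> 0"
      and \<eta>1: "(\<integral>\<^sup>+z. ennreal (\<eta> z) \<partial>lborel) = 1" and \<eta>s: "\<And>z. \<eta> z \<noteq> 0 \<Longrightarrow> norm z < \<delta>' / c"
    have shift: "(\<integral>\<^sup>+x. ennreal (norm (G (x - w)) powr b) \<partial>lborel) = ennreal Y" for w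
      using nn_integral_lborel_shift[of "\<lambda>x. ennreal (norm (G x) powr b)" "- w"] Y by simp
    \<comment> \<open>Finiteness of the double integral ensures that, for almost every x with F x
      \<noteq> 0, the convolution integral converges absolutely. Where F x = 0 its value is
      irrelevant.\<close>
    have "(\<integral>\<^sup>+x. \<integral>\<^sup>+z. ennreal (\<eta> z * (norm (F x) * norm (G (x - \<iota> z)))) \<partial>lborel \<partial>lborel)
      = (\<integral>\<^sup>+z. \<integral>\<^sup>+x. ennreal (\<eta> z * (norm (F x) * norm (G (x - \<iota> z)))) \<partial>lborel \<partial>lborel)"
      by (rule lborel_pair.Fubini') measurable
    also have "\<dots> = (\<integral>\<^sup>+z. ennreal (\<eta> z) * (\<integral>\<^sup>+x. ennreal (norm (F x) * norm (G (x - \<iota> z))) \<partial>lborel) \<partial>lborel)"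
      by (simp add: ennreal_mult' \<eta>0 nn_integral_cmult)
    also have "\<dots> \<le> (\<integral>\<^sup>+z. ennreal (\<eta> z) * ennreal (X powr (1 / a) * Y powr (1 / b)) \<partial>lborel)"
    proof (intro nn_integral_mono mult_left_mono)
      fix z
      show "(\<integral>\<^sup>+x. ennreal (norm (F x) * norm (G (x - \<iota> z))) \<partial>lborel) \<le> ennreal (X powr (1 / a) * Y powr (1 / b))"
        by (rule nn_integral_Holder) (use X Y ab shift in auto)
    qed auto
    also have "\<dots> < \<infinity>" using \<eta>1 by (simp add: nn_integral_multc)
    finally have "AE x in lborel. (\<integral>\<^sup>+z. ennreal (\<eta> z * (norm (F x) * norm (G (x - \<iota> z)))) \<partial>lborel) \<noteq> \<infinity>"
      by (intro nn_integral_PInf_AE) auto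
    then have "AE x in lborel. ennreal \<bar>F x \<bullet> (LINT z|lborel. \<eta> z *\<^sub>R G (x - \<iota> z)) - F x \<bullet> G x\<bar>
        \<le> (\<integral>\<^sup>+z. ennreal (\<eta> z * (norm (F x) * norm (G (x - \<iota> z) - G x))) \<partial>lborel)"
    proof eventually_elim
      case (elim x)
      show ?case
      proof (cases "F x = 0")
        case False
        have "(\<integral>\<^sup>+z. ennreal (\<eta> z * (norm (F x) * norm (G (x - \<iota> z)))) \<partial>lborel)
          = ennreal (norm (F x)) * (\<integral>\<^sup>+z. ennreal (norm (\<eta> z *\<^sub>R G (x - \<iota> z))) \<partial>lborel)"
          by (subst nn_integral_cmult[symmetric]) (auto simp: ennreal_mult'[symmetric] \<eta>0 mult_ac)
        then have "(\<integral>\<^sup>+z. ennreal (norm (\<eta> z *\<^sub>R G (x - \<iota> z))) \<partial>lborel) < \<infinity>"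
          using elim False by (auto simp: ennreal_mult_eq_top_iff less_top)
        then have i1: "integrable lborel (\<lambda>z. \<eta> z *\<^sub>R G (x - \<iota> z))"
          by (intro integrableI_bounded) auto
        have \<eta>i: "integrable lborel \<eta>" "integral\<^sup>L lborel \<eta> = 1"
          using \<eta>1 \<eta>0 by (auto intro!: integrableI_nonneg simp: integral_eq_nn_integral)
        have "F x \<bullet> (LINT z|lborel. \<eta> z *\<^sub>R G (x - \<iota> z)) - F x \<bullet> G x
          = F x \<bullet> (LINT z|lborel. \<eta> z *\<^sub>R G (x - \<iota> z) - \<eta> z *\<^sub>R G x)"
          using i1 \<eta>i by (simp add: inner_diff_right)
        also have "\<bar>\<dots>\<bar> \<le> norm (F x) * norm (LINT z|lborel. \<eta> z *\<^sub>R G (x - \<iota> z) - \<eta> z *\<^sub>R G x)"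
          by (rule Cauchy_Schwarz_ineq2)
        finally have "ennreal \<bar>F x \<bullet> (LINT z|lborel. \<eta> z *\<^sub>R G (x - \<iota> z)) - F x \<bullet> G x\<bar>
          \<le> ennreal (norm (F x)) * ennreal (norm (LINT z|lborel. \<eta> z *\<^sub>R G (x - \<iota> z) - \<eta> z *\<^sub>R G x))"
          by (simp add: ennreal_mult'[symmetric] ennreal_leI)
        also have "\<dots> \<le> ennreal (norm (F x)) * (\<integral>\<^sup>+z. ennreal (norm (\<eta> z *\<^sub>R G (x - \<iota> z) - \<eta> z *\<^sub>R G x)) \<partial>lborel)"
          using i1 \<eta>i by (intro mult_left_mono integral_norm_bound_ennreal) auto
        also have "\<dots> = (\<integral>\<^sup>+z. ennreal (\<eta> z * (norm (F x) * norm (G (x - \<iota> z) - G x))) \<partial>lborel)"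
          by (subst nn_integral_cmult[symmetric])
            (auto simp: ennreal_mult'[symmetric] \<eta>0 mult_ac scaleR_diff_right[symmetric] simp del: scaleR_diff_right)
        finally show ?thesis .
      qed simp
    qed
    then have "(\<integral>\<^sup>+x. ennreal \<bar>F x \<bullet> (LINT z|lborel. \<eta> z *\<^sub>R G (x - \<iota> z)) - F x \<bullet> G x\<bar> \<partial>lborel)
      \<le> (\<integral>\<^sup>+x. \<integral>\<^sup>+z. ennreal (\<eta> z * (norm (F x) * norm (G (x - \<iota> z) - G x))) \<partial>lborel \<partial>lborel)"
      by (rule nn_integral_mono_AE)
    also have "\<dots> = (\<integral>\<^sup>+z. \<integral>\<^sup>+x. ennreal (\<eta> z * (norm (F x) * norm (G (x - \<iota> z) - G x))) \<partial>lborel \<partial>lborel)"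
      by (rule lborel_pair.Fubini') measurable
    also have "\<dots> = (\<integral>\<^sup>+z. ennreal (\<eta> z) * (\<integral>\<^sup>+x. ennreal (norm (F x) * norm (G (x - \<iota> z) - G x)) \<partial>lborel) \<partial>lborel)"
      by (simp add: ennreal_mult' \<eta>0 nn_integral_cmult)
    also have "\<dots> \<le> (\<integral>\<^sup>+z. ennreal (\<eta> z) * ennreal e \<partial>lborel)"
    proof (intro nn_integral_mono)
      fix z
      show "ennreal (\<eta> z) * (\<integral>\<^sup>+x. ennreal (norm (F x) * norm (G (x - \<iota> z) - G x)) \<partial>lborel) \<le> ennreal (\<eta> z) * ennreal e"
      proof (cases "\<eta> z = 0")
        case False
        have "norm (- \<iota> z) < \<delta>'"
          using c(2)[of z] \<eta>s[OF False] c(1) by (simp add: field_simps)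
        then have 1: "(\<integral>\<^sup>+x. ennreal (norm (G (x - \<iota> z) - G x) powr b) \<partial>lborel) \<le> ennreal e'"
          using \<delta>'(2)[of "- \<iota> z"] by simp
        have "(\<integral>\<^sup>+x. ennreal (norm (F x) * norm (G (x - \<iota> z) - G x)) \<partial>lborel) \<le> ennreal (X powr (1 / a) * e' powr (1 / b))"
          by (rule nn_integral_Holder) (use X ab e' 1 in auto)
        also have "e' powr (1 / b) = e / (X powr (1 / a) + 1)"
          using ab e by (simp add: e'_def powr_powr add_nonneg_nonneg)
        also have "X powr (1 / a) * (e / (X powr (1 / a) + 1)) \<le> e"
          using e by (simp add: divide_simps add_nonneg_pos)
        finally show ?thesis by (simp add: mult_left_mono ennreal_leI)
      qed simp
    qed
    also have "\<dots> = ennreal e" using \<eta>1 by (simp add: nn_integral_multc)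
    finally show "(\<integral>\<^sup>+x. ennreal \<bar>F x \<bullet> (LINT z|lborel. \<eta> z *\<^sub>R G (x - \<iota> z)) - F x \<bullet> G x\<bar> \<partial>lborel) \<le> ennreal e" .
  qed
qed

section \<open>Mollification\<close>

lemma continuous_compact_supp_bounded:
  fixes f :: "'a::euclidean_space \<Rightarrow> 'b::real_normed_vector"
  assumes "continuous_on UNIV f" "compact (supp f)"
  obtains B where "B > 0" "\<And>x. norm (f x) \<le> B"
proof -
  have "compact (f ` supp f)"
    using assms by (intro compact_continuous_image continuous_on_subset[OF assms(1)]) auto
  then obtain B where B: "B > 0" "\<And>y. y \<in> f ` supp f \<Longrightarrow> norm y \<le> B"
    using compact_imp_bounded[of "f ` supp f"] unfolding bounded_pos by blast
  have "norm (f x) \<le> B" for x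
  proof (cases "f x = 0")
    case False
    then have "x \<in> supp f" unfolding supp_def using closure_subset[of "{x. f x \<noteq> 0}"] by auto
    then show ?thesis using B by auto
  qed (use B in simp)
  then show thesis by (rule that[OF B(1)])
qed

lemma continuous_compact_supp_uniform:
  fixes f :: "'a::euclidean_space \<Rightarrow> 'b::real_normed_vector"
  assumes c: "continuous_on UNIV f" and s: "compact (supp f)" and e: "e > 0"
  obtains \<delta> where "\<delta> > 0" "\<And>x y. dist x y < \<delta> \<Longrightarrow> dist (f x) (f y) \<le> e"
proof -
  obtain R where R: "R > 0" "\<And>x. x \<in> supp f \<Longrightarrow> norm x \<le> R"
    using compact_imp_bounded[OF s] unfolding bounded_pos by blast
  have z: "f x = 0" if "norm x > R" for x
  proof (rule ccontr)
    assume "f x \<noteq> 0"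
    then have "x \<in> supp f" unfolding supp_def using closure_subset[of "{x. f x \<noteq> 0}"] by auto
    from R(2)[OF this] that show False by simp
  qed
  have "uniformly_continuous_on (cball 0 (R + 1)) f"
    using c by (intro compact_uniformly_continuous continuous_on_subset[OF c]) auto
  then obtain d where d: "d > 0"
    "\<And>x y. x \<in> cball 0 (R + 1) \<Longrightarrow> y \<in> cball 0 (R + 1) \<Longrightarrow> dist y x < d \<Longrightarrow> dist (f y) (f x) < e"
    unfolding uniformly_continuous_on_def using e by force
  show thesis
  \<comment> \<open>At distance below 1, a pair not contained in the ball of radius R + 1 has both
    points outside the ball of radius R, where f vanishes.\<close>
  proof (rule that[of "min d 1"])
    fix x y :: 'a assume xy: "dist x y < min d 1"
    show "dist (f x) (f y) \<le> e"
    proof (cases "norm x \<le> R + 1 \<and> norm y \<le> R + 1")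
      case True
      then have "dist (f x) (f y) < e" using xy by (intro d(2)) auto
      then show ?thesis by simp
    next
      case False
      have "norm x \<le> norm y + dist x y" "norm y \<le> norm x + dist x y"
        using norm_triangle_sub[of x y] norm_triangle_sub[of y x] by (simp_all add: dist_norm norm_minus_commute)
      then have "norm x > R" "norm y > R" using False xy by linarith+
      then show ?thesis using z[of x] z[of y] e by simp
    qed
  qed (use d in auto)
qed

text \<open>Smooth functions of compact support are closed under directional derivatives. This
  allows uniform continuity and boundedness to be applied to the derivatives and drives the
  induction for convolutions.\<close>

lemma smooth_partial_derivative:
  fixes f :: "'a::euclidean_space \<Rightarrow> 'b::real_normed_vector"
  assumes f: "\<forall>k. Ck k f" "compact (supp f)"
  shows "\<forall>k. Ck k (\<lambda>x. frechet_derivative f (at x) v)"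
    and "compact (supp (\<lambda>x. frechet_derivative f (at x) v))"
    and "(f has_derivative frechet_derivative f (at x)) (at x)"
    and "continuous_on UNIV f"
proof -
  show 1: "\<forall>k. Ck k (\<lambda>x. frechet_derivative f (at x) v)"
    using f(1) Ck.simps(2) by blast
  have d: "f differentiable_on UNIV"
    using f(1) Ck.simps(2) by blast
  show "(f has_derivative frechet_derivative f (at x)) (at x)"
    using d frechet_derivative_works unfolding differentiable_on_def by auto
  show "continuous_on UNIV f" using f(1) Ck.simps(1) by blast
  have "{x. frechet_derivative f (at x) v \<noteq> 0} \<subseteq> supp f"
  proof
    fix x assume x: "x \<in> {x. frechet_derivative f (at x) v \<noteq> 0}"
    show "x \<in> supp f"
    proof (rule ccontr)
      assume nx: "x \<notin> supp f"
      have "open (- supp f)" by (simp add: supp_def open_Compl)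
      moreover have "f y = 0" if "y \<in> - supp f" for y
        using that closure_subset[of "{x. f x \<noteq> 0}"] by (auto simp: supp_def)
      ultimately have "(f has_derivative (\<lambda>_. 0)) (at x)"
        using nx by (intro has_derivative_transform_within_open[OF has_derivative_const[of 0]]) auto
      then have "frechet_derivative f (at x) = (\<lambda>_. 0)"
        by (rule frechet_derivative_at[symmetric])
      then show False using x by simp
    qed
  qed
  then have "supp (\<lambda>x. frechet_derivative f (at x) v) \<subseteq> supp f"
    unfolding supp_def by (metis closure_closure closure_mono)
  then show "compact (supp (\<lambda>x. frechet_derivative f (at x) v))"
    using f(2) by (metis closed_closure compact_Int_closed inf.absorb_iff2 supp_def)
qed

text \<open>The mean value theorem on the segment from p to p + h. Closeness of the derivatives is
  assumed for basis vectors only, because uniform continuity is available for one directional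
  derivative at a time; summing over the basis costs the dimension.\<close>

lemma smooth_linearization_bound:
  fixes f :: "'a::euclidean_space \<Rightarrow> real" and e :: real
  assumes f: "\<And>x. (f has_derivative f' x) (at x)"
    and bound: "\<And>b q. b \<in> Basis \<Longrightarrow> norm (q - p) \<le> norm h \<Longrightarrow> \<bar>f' q b - f' p b\<bar> \<le> e"
  shows "\<bar>f (p + h) - f p - f' p h\<bar> \<le> DIM('a) * e * norm h"
proof -
  have "((\<lambda>t. f (p + t *\<^sub>R h)) has_derivative (\<lambda>s. f' (p + t *\<^sub>R h) (s *\<^sub>R h))) (at t within {0..1})" for t :: real
  proof -
    have "((\<lambda>t. p + t *\<^sub>R h) has_derivative (\<lambda>s. s *\<^sub>R h)) (at t within {0..1})"
      by (auto intro!: derivative_eq_intros)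
    from has_derivative_compose[OF this f] show ?thesis .
  qed
  then obtain t where t: "t \<in> {0<..<1}" "f (p + 1 *\<^sub>R h) - f (p + 0 *\<^sub>R h) = f' (p + t *\<^sub>R h) ((1 - 0) *\<^sub>R h)"
    using mvt_simple[of 0 1 "\<lambda>t. f (p + t *\<^sub>R h)" "\<lambda>t s. f' (p + t *\<^sub>R h) (s *\<^sub>R h)"] by auto
  have lin: "linear (f' q)" for q using f by (rule has_derivative_linear)
  have ex: "f' q h = (\<Sum>b\<in>Basis. (h \<bullet> b) * f' q b)" for q
  proof -
    have "f' q h = f' q (\<Sum>b\<in>Basis. (h \<bullet> b) *\<^sub>R b)" by (simp add: euclidean_representation)
    also have "\<dots> = (\<Sum>b\<in>Basis. (h \<bullet> b) * f' q b)"
      by (simp add: linear_sum[OF lin] linear_scale[OF lin])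
    finally show ?thesis .
  qed
  have "f (p + h) - f p - f' p h = f' (p + t *\<^sub>R h) h - f' p h" using t by simp
  also have "\<dots> = (\<Sum>b\<in>Basis. (h \<bullet> b) * (f' (p + t *\<^sub>R h) b - f' p b))"
    unfolding ex by (simp add: sum_subtractf right_diff_distrib)
  also have "\<bar>\<dots>\<bar> \<le> (\<Sum>b\<in>(Basis::'a set). norm h * e)"
  proof (rule order_trans[OF sum_abs sum_mono])
    fix b :: 'a assume b: "b \<in> Basis"
    have "norm (p + t *\<^sub>R h - p) \<le> norm h" using t by (simp add: mult_left_le_one_le)
    then show "\<bar>(h \<bullet> b) * (f' (p + t *\<^sub>R h) b - f' p b)\<bar> \<le> norm h * e"
      unfolding abs_mult using b by (intro mult_mono Basis_le_norm bound) auto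
  qed
  finally show ?thesis by (simp add: mult_ac)
qed

text \<open>All regularity is carried by \<eta>. Its linearization error is small compared with norm
  (w - x), uniformly in y by uniform continuity of the derivatives, so integrability of g alone
  justifies differentiation under the integral.\<close>

lemma convolution_has_derivative:
  fixes g :: "'a::euclidean_space \<Rightarrow> 'b::euclidean_space" and \<eta> :: "'a \<Rightarrow> real"
  assumes g: "integrable lborel g" and \<eta>: "\<forall>k. Ck k \<eta>" "compact (supp \<eta>)"
  shows "((\<lambda>x. LINT y|lborel. \<eta> (x - y) *\<^sub>R g y) has_derivative
    (\<lambda>v. LINT y|lborel. frechet_derivative \<eta> (at (x - y)) v *\<^sub>R g y)) (at x)"
proof -
  note [measurable] = borel_measurable_integrable[OF g]
  let ?D = "\<lambda>q. frechet_derivative \<eta> (at q)"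
  have int: "integrable lborel (\<lambda>y. f (w - y) *\<^sub>R g y)"
    if f: "continuous_on UNIV f" "compact (supp f)" for f :: "'a \<Rightarrow> real" and w
  proof -
    obtain B where B: "B > 0" "\<And>x. norm (f x) \<le> B"
      using continuous_compact_supp_bounded[OF f] by blast
    have [measurable]: "f \<in> borel_measurable borel" using f(1) by (rule borel_measurable_continuous_onI)
    show ?thesis
    proof (rule Bochner_Integration.integrable_bound[of lborel "\<lambda>y. B *\<^sub>R g y"])
      show "AE y in lborel. norm (f (w - y) *\<^sub>R g y) \<le> norm (B *\<^sub>R g y)"
        using B by (intro AE_I2) (auto intro!: mult_right_mono order_trans[OF B(2)])
    qed (use g in auto)
  qed
  have int\<eta>: "integrable lborel (\<lambda>y. \<eta> (w - y) *\<^sub>R g y)" for w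
    by (intro int smooth_partial_derivative(4) \<eta>)
  have intD: "integrable lborel (\<lambda>y. ?D (w - y) v *\<^sub>R g y)" for w v
    using smooth_partial_derivative[OF smooth_partial_derivative(1,2)[OF \<eta>]] smooth_partial_derivative(2)[OF \<eta>]
    by (intro int[of "\<lambda>q. ?D q v"]) auto
  have lin: "linear (?D q)" for q
    using smooth_partial_derivative(3)[OF \<eta>] by (rule has_derivative_linear)
  show ?thesis
    unfolding has_derivative_at_alt
  proof (intro conjI allI impI)
    have "linear (\<lambda>v. LINT y|lborel. ?D (x - y) v *\<^sub>R g y)"
    proof (rule linearI)
      fix v w
      show "(LINT y|lborel. ?D (x - y) (v + w) *\<^sub>R g y)
          = (LINT y|lborel. ?D (x - y) v *\<^sub>R g y) + (LINT y|lborel. ?D (x - y) w *\<^sub>R g y)"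
        by (simp add: linear_add[OF lin] scaleR_add_left intD)
      fix r
      show "(LINT y|lborel. ?D (x - y) (r *\<^sub>R v) *\<^sub>R g y) = r *\<^sub>R (LINT y|lborel. ?D (x - y) v *\<^sub>R g y)"
        by (simp add: linear_scale[OF lin] flip: scaleR_scaleR)
    qed
    then show "bounded_linear (\<lambda>v. LINT y|lborel. ?D (x - y) v *\<^sub>R g y)"
      by (simp add: linear_conv_bounded_linear)
    fix e :: real assume e: "e > 0"
    define I where "I = (LINT y|lborel. norm (g y))"
    have I: "I \<ge> 0" by (simp add: I_def)
    \<comment> \<open>Compensates the dimension from the linearization bound and the integral I of
      norm (g y); adding 1 avoids division by 0.\<close>
    define e' where "e' = e / real DIM('a) / (I + 1)"
    have e': "e' > 0" using e I by (simp add: e'_def)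
    have "\<exists>\<delta>>0. \<forall>q p. dist q p < \<delta> \<longrightarrow> dist (?D q b) (?D p b) \<le> e'" for b
      using continuous_compact_supp_uniform[OF smooth_partial_derivative(4)[OF smooth_partial_derivative(1,2)[OF \<eta>]]
        smooth_partial_derivative(2)[OF \<eta>] e'] by metis
    then obtain \<delta> where \<delta>: "\<And>b. \<delta> b > 0" "\<And>b q p. dist q p < \<delta> b \<Longrightarrow> dist (?D q b) (?D p b) \<le> e'"
      by metis
    define d where "d = Min (\<delta> ` Basis)"
    have d: "d > 0" "\<And>b. b \<in> Basis \<Longrightarrow> d \<le> \<delta> b"
      using \<delta>(1) by (auto simp: d_def)
    show "\<exists>d>0. \<forall>w. norm (w - x) < d \<longrightarrow>
      norm ((LINT y|lborel. \<eta> (w - y) *\<^sub>R g y) - (LINT y|lborel. \<eta> (x - y) *\<^sub>R g y)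
        - (LINT y|lborel. ?D (x - y) (w - x) *\<^sub>R g y)) \<le> e * norm (w - x)"
    proof (intro exI[of _ d] conjI allI impI d(1))
      fix w assume w: "norm (w - x) < d"
      have pt: "\<bar>\<eta> (w - y) - \<eta> (x - y) - ?D (x - y) (w - x)\<bar> \<le> DIM('a) * e' * norm (w - x)" for y
      proof -
        have "\<bar>\<eta> ((x - y) + (w - x)) - \<eta> (x - y) - ?D (x - y) (w - x)\<bar> \<le> DIM('a) * e' * norm (w - x)"
        proof (rule smooth_linearization_bound[where f=\<eta> and f'="\<lambda>q. frechet_derivative \<eta> (at q)"
              and p="x - y" and h="w - x"])
          show "(\<eta> has_derivative ?D q) (at q)" for q by (rule smooth_partial_derivative(3)[OF \<eta>])
          fix b q :: 'a assume "b \<in> Basis" "norm (q - (x - y)) \<le> norm (w - x)"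
          then have "dist q (x - y) < \<delta> b" using w d(2)[of b] by (simp add: dist_norm)
          from \<delta>(2)[OF this] show "\<bar>?D q b - ?D (x - y) b\<bar> \<le> e'" by (simp add: dist_real_def)
        qed
        then show ?thesis by simp
      qed
      have "(LINT y|lborel. \<eta> (w - y) *\<^sub>R g y) - (LINT y|lborel. \<eta> (x - y) *\<^sub>R g y)
        - (LINT y|lborel. ?D (x - y) (w - x) *\<^sub>R g y)
        = (LINT y|lborel. (\<eta> (w - y) - \<eta> (x - y) - ?D (x - y) (w - x)) *\<^sub>R g y)"
        using int\<eta> intD by (simp add: scaleR_diff_left)
      also have "norm \<dots> \<le> (LINT y|lborel. norm ((\<eta> (w - y) - \<eta> (x - y) - ?D (x - y) (w - x)) *\<^sub>R g y))"
        by (rule integral_norm_bound)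
      also have "\<dots> \<le> (LINT y|lborel. (DIM('a) * e' * norm (w - x)) * norm (g y))"
      proof (rule integral_mono)
        show "integrable lborel (\<lambda>y. norm ((\<eta> (w - y) - \<eta> (x - y) - ?D (x - y) (w - x)) *\<^sub>R g y))"
          unfolding scaleR_diff_left using int\<eta> intD by (intro integrable_norm Bochner_Integration.integrable_diff)
        show "norm ((\<eta> (w - y) - \<eta> (x - y) - ?D (x - y) (w - x)) *\<^sub>R g y)
            \<le> (DIM('a) * e' * norm (w - x)) * norm (g y)" for y
          using pt[of y] by (simp add: mult_right_mono)
      qed (use g in auto)
      also have "\<dots> = DIM('a) * e' * norm (w - x) * I"
        by (simp add: I_def)
      also have "\<dots> = e * (I / (I + 1)) * norm (w - x)"
        by (simp add: e'_def)
      also have "\<dots> \<le> e * 1 * norm (w - x)"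
        using I e by (intro mult_right_mono mult_left_mono) auto
      finally show "norm ((LINT y|lborel. \<eta> (w - y) *\<^sub>R g y) - (LINT y|lborel. \<eta> (x - y) *\<^sub>R g y)
        - (LINT y|lborel. ?D (x - y) (w - x) *\<^sub>R g y)) \<le> e * norm (w - x)" by simp
    qed
  qed
qed

section \<open>Mollifications as test functions\<close>

lemma convolution_Ck:
  fixes g :: "'a::euclidean_space \<Rightarrow> 'b::euclidean_space" and \<eta> :: "'a \<Rightarrow> real"
  assumes g: "integrable lborel g" and \<eta>: "\<forall>k. Ck k \<eta>" "compact (supp \<eta>)"
  shows "Ck k (\<lambda>x. LINT y|lborel. \<eta> (x - y) *\<^sub>R g y)"
  using \<eta>
proof (induction k arbitrary: \<eta>)
  case 0
  then show ?case
    using has_derivative_continuous[OF convolution_has_derivative[OF g 0]]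
    by (simp add: continuous_on_eq_continuous_at)
next
  case (Suc k)
  note der = convolution_has_derivative[OF g Suc.prems]
  have "frechet_derivative (\<lambda>x. LINT y|lborel. \<eta> (x - y) *\<^sub>R g y) (at x) v
      = (LINT y|lborel. frechet_derivative \<eta> (at (x - y)) v *\<^sub>R g y)" for x v
    by (simp add: frechet_derivative_at[OF der, symmetric])
  moreover have "Ck k (\<lambda>x. LINT y|lborel. frechet_derivative \<eta> (at (x - y)) v *\<^sub>R g y)" for v
    by (rule Suc.IH) (use smooth_partial_derivative[OF Suc.prems] in auto)
  moreover have "(\<lambda>x. LINT y|lborel. \<eta> (x - y) *\<^sub>R g y) differentiable_on UNIV"
    unfolding differentiable_on_def by (intro ballI differentiableI[OF der])
  ultimately show ?case by simp
qed

text \<open>The mollified function is smooth because \<eta> is, and it vanishes at distance \<delta>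
  from the ball carrying g; no regularity of g beyond integrability enters.\<close>

lemma convolution_test_function:
  fixes g :: "'a::euclidean_space \<Rightarrow> 'b::euclidean_space" and \<eta> :: "'a \<Rightarrow> real"
  assumes g: "integrable lborel g" and gz: "\<And>y. y \<notin> cball c R \<Longrightarrow> g y = 0"
    and \<eta>: "\<eta> \<in> test_functions UNIV" and \<eta>z: "\<And>z. \<eta> z \<noteq> 0 \<Longrightarrow> norm z < \<delta>"
  shows "(\<lambda>x. LINT z|lborel. \<eta> z *\<^sub>R g (x - z)) \<in> test_functions UNIV"
    and "x \<notin> cball c (R + \<delta>) \<Longrightarrow> (LINT z|lborel. \<eta> z *\<^sub>R g (x - z)) = 0"
proof -
  have \<eta>': "\<forall>k. Ck k \<eta>" "compact (supp \<eta>)" using \<eta> by (auto simp: test_functions_def)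
  have [measurable]: "g \<in> borel_measurable borel" using g by auto
  have [measurable]: "\<eta> \<in> borel_measurable borel"
    using smooth_partial_derivative(4)[OF \<eta>'] by (rule borel_measurable_continuous_onI)
  \<comment> \<open>Averages of translates of g suit the convergence argument, whereas derivatives
    fall on \<eta> only in the form \<eta> (x - y). A reflection of the variable relates the
    two.\<close>
  have refl: "(LINT z|lborel. \<eta> z *\<^sub>R g (x - z)) = (LINT y|lborel. \<eta> (x - y) *\<^sub>R g y)" for x
  proof -
    have "(lborel :: 'a measure) = distr lborel borel (\<lambda>z. x + (-1) *\<^sub>R z)"
      using lborel_affine[of "-1" x] by (simp add: density_1)
    then have "(LINT y|lborel. \<eta> (x - y) *\<^sub>R g y)
        = (LINT y|distr lborel borel (\<lambda>z. x + (-1) *\<^sub>R z). \<eta> (x - y) *\<^sub>R g y)" by simp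
    also have "\<dots> = (LINT z|lborel. \<eta> z *\<^sub>R g (x - z))"
      by (subst integral_distr) auto
    finally show ?thesis by simp
  qed
  show z: "(LINT z|lborel. \<eta> z *\<^sub>R g (x - z)) = 0" if x: "x \<notin> cball c (R + \<delta>)" for x
  proof -
    have "\<eta> z *\<^sub>R g (x - z) = 0" for z
    proof (cases "\<eta> z = 0")
      case False
      have "dist c x \<le> dist c (x - z) + norm z"
        using dist_triangle[of c x "x - z"] by (simp add: dist_norm)
      then have "x - z \<notin> cball c R" using x \<eta>z[OF False] by auto
      then show ?thesis using gz by simp
    qed simp
    then show ?thesis by (simp only: Bochner_Integration.integral_zero)
  qed
  have "supp (\<lambda>x. LINT z|lborel. \<eta> z *\<^sub>R g (x - z)) \<subseteq> cball c (R + \<delta>)"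
    unfolding supp_def by (rule closure_minimal[OF _ closed_cball]) (use z in blast)
  then have "compact (supp (\<lambda>x. LINT z|lborel. \<eta> z *\<^sub>R g (x - z)))"
    using compact_Int_closed[OF compact_cball[of c "R + \<delta>"], of "supp (\<lambda>x. LINT z|lborel. \<eta> z *\<^sub>R g (x - z))"]
    by (simp add: supp_def inf.absorb2)
  moreover have "\<forall>k. Ck k (\<lambda>x. LINT z|lborel. \<eta> z *\<^sub>R g (x - z))"
    unfolding refl using convolution_Ck[OF g \<eta>'] by simp
  ultimately show "(\<lambda>x. LINT z|lborel. \<eta> z *\<^sub>R g (x - z)) \<in> test_functions UNIV"
    by (simp add: test_functions_def)
qed

text \<open>The factor c serves the induction: each differentiation multiplies it by m.\<close>

lemma Ck_affine:
  fixes f :: "'a::euclidean_space \<Rightarrow> real"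
  assumes "Ck k f"
  shows "Ck k (\<lambda>z. c * f (x0 + m *\<^sub>R z))"
  using assms
proof (induction k arbitrary: f c)
  case 0
  then show ?case
    by (auto intro!: continuous_intros continuous_on_compose2[of UNIV f])
next
  case (Suc k)
  have f: "(f has_derivative frechet_derivative f (at x)) (at x)" for x
    using Suc.prems frechet_derivative_works by (auto simp: differentiable_on_def)
  have der: "((\<lambda>z. c * f (x0 + m *\<^sub>R z)) has_derivative
      (\<lambda>v. c * frechet_derivative f (at (x0 + m *\<^sub>R z)) (m *\<^sub>R v))) (at z)" for z
  proof -
    have "((\<lambda>z. x0 + m *\<^sub>R z) has_derivative (\<lambda>v. m *\<^sub>R v)) (at z)"
      by (auto intro!: derivative_eq_intros)
    from has_derivative_compose[OF this f] show ?thesis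
      by (intro has_derivative_mult_right)
  qed
  have "frechet_derivative (\<lambda>z. c * f (x0 + m *\<^sub>R z)) (at z) v
      = (c * m) * frechet_derivative f (at (x0 + m *\<^sub>R z)) v" for z v
    unfolding frechet_derivative_at[OF der[of z], symmetric]
    by (simp add: linear_scale[OF has_derivative_linear[OF f]])
  moreover have "Ck k (\<lambda>z. (c * m) * frechet_derivative f (at (x0 + m *\<^sub>R z)) v)" for v
    by (rule Suc.IH) (use Suc.prems in auto)
  moreover have "(\<lambda>z. c * f (x0 + m *\<^sub>R z)) differentiable_on UNIV"
    unfolding differentiable_on_def by (intro ballI differentiableI[OF der])
  ultimately show ?case by simp
qed

text \<open>Using the cut-off as the bump avoids an explicit construction. It is recentred at the
  origin, shrunk by m = r / \<delta> and divided by its mass J, which is finite, and positive by the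
  assumption on the integral.\<close>

lemma small_mollifier:
  fixes \<psi> :: "'a::euclidean_space \<Rightarrow> real"
  assumes \<psi>: "\<psi> \<in> test_functions (ball x0 r)" and \<psi>0: "\<And>x. \<psi> x \<ge> 0"
    and nz: "(\<integral>\<^sup>+x. ennreal (\<psi> x) \<partial>lborel) \<noteq> 0" and r: "r > 0" and \<delta>: "\<delta> > 0"
  obtains \<eta> :: "'a \<Rightarrow> real" where "\<eta> \<in> test_functions UNIV" "\<eta> \<in> borel_measurable borel" "\<And>z. \<eta> z \<ge> 0"
    "(\<integral>\<^sup>+z. ennreal (\<eta> z) \<partial>lborel) = 1" "\<And>z. \<eta> z \<noteq> 0 \<Longrightarrow> norm z < \<delta>"
proof -
  have C: "\<forall>k. Ck k \<psi>" "compact (supp \<psi>)" "supp \<psi> \<subseteq> ball x0 r" using \<psi> by (auto simp: test_functions_def)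
  have cont: "continuous_on UNIV \<psi>" by (rule smooth_partial_derivative(4)[OF C(1,2)])
  then have [measurable]: "\<psi> \<in> borel_measurable borel" by (rule borel_measurable_continuous_onI)
  have sub: "\<psi> x \<noteq> 0 \<Longrightarrow> x \<in> ball x0 r" for x
    using C(3) closure_subset[of "{x. \<psi> x \<noteq> 0}"] by (auto simp: supp_def)
  obtain B where B: "B > 0" "\<And>x. norm (\<psi> x) \<le> B"
    using continuous_compact_supp_bounded[OF cont C(2)] by blast
  have "(\<integral>\<^sup>+x. ennreal (\<psi> x) \<partial>lborel) \<le> (\<integral>\<^sup>+x. ennreal B * indicator (ball x0 r) x \<partial>lborel)"
  proof (rule nn_integral_mono)
    fix x
    show "ennreal (\<psi> x) \<le> ennreal B * indicator (ball x0 r) x"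
      using sub[of x] B(2)[of x] by (cases "\<psi> x = 0") (auto simp: ennreal_leI)
  qed
  also have "\<dots> = ennreal B * emeasure lborel (ball x0 r)" by (simp add: nn_integral_cmult_indicator)
  also have "\<dots> < \<infinity>" using emeasure_lborel_ball_finite[of x0 r] by (simp add: ennreal_mult_less_top)
  finally obtain J where J: "J \<ge> 0" "(\<integral>\<^sup>+x. ennreal (\<psi> x) \<partial>lborel) = ennreal J"
    by (cases "\<integral>\<^sup>+x. ennreal (\<psi> x) \<partial>lborel") auto
  have Jp: "J > 0" using J nz by (cases "J = 0") auto
  define m where "m = r / \<delta>"
  have m: "m > 0" using r \<delta> by (simp add: m_def)
  define \<eta> where "\<eta> z = (m ^ DIM('a) / J) * \<psi> (x0 + m *\<^sub>R z)" for z
  have \<eta>z: "norm z < \<delta>" if "\<eta> z \<noteq> 0" for z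
  proof -
    have "x0 + m *\<^sub>R z \<in> ball x0 r" using that by (intro sub) (auto simp: \<eta>_def)
    then have "m * norm z < r" using m by (simp add: dist_norm)
    then show ?thesis using r \<delta> by (simp add: m_def field_simps)
  qed
  have "supp \<eta> \<subseteq> cball 0 \<delta>"
    unfolding supp_def by (rule closure_minimal) (use \<eta>z in \<open>auto simp: less_imp_le\<close>)
  then have "compact (supp \<eta>)"
    using compact_Int_closed[OF compact_cball[of 0 \<delta>], of "supp \<eta>"] by (simp add: supp_def inf.absorb2)
  moreover have "Ck k \<eta>" for k
    unfolding \<eta>_def[abs_def] by (intro Ck_affine C(1)[rule_format])
  ultimately have 1: "\<eta> \<in> test_functions UNIV"
    by (simp add: test_functions_def)
  have 2: "\<eta> \<in> borel_measurable borel" unfolding \<eta>_def by measurable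
  have "(\<integral>\<^sup>+z. ennreal (\<eta> z) \<partial>lborel) = ennreal (1 / J) * (ennreal (m ^ DIM('a)) * (\<integral>\<^sup>+z. ennreal (\<psi> (x0 + m *\<^sub>R z)) \<partial>lborel))"
    using Jp m \<psi>0 by (simp add: \<eta>_def nn_integral_cmult[symmetric] ennreal_mult'[symmetric])
  also have "ennreal (m ^ DIM('a)) * (\<integral>\<^sup>+z. ennreal (\<psi> (x0 + m *\<^sub>R z)) \<partial>lborel) = ennreal J"
    using nn_integral_lborel_affine[of "\<lambda>x. ennreal (\<psi> x)" m x0] m J by simp
  also have "ennreal (1 / J) * ennreal J = 1" using Jp by (simp add: ennreal_mult'[symmetric])
  finally have 3: "(\<integral>\<^sup>+z. ennreal (\<eta> z) \<partial>lborel) = 1" .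
  have 4: "\<eta> z \<ge> 0" for z using \<psi>0 m Jp by (simp add: \<eta>_def)
  show thesis by (rule that[of \<eta>]) (use 1 2 3 4 \<eta>z in auto)
qed

text \<open>The form in which the gradient hypothesis on the cut-off enters all later
  estimates.\<close>

lemma gradient_bound_imp_lipschitz:
  fixes \<psi> :: "real ^ 'n \<Rightarrow> real"
  assumes \<psi>: "\<psi> \<in> test_functions S" and L: "\<And>x. norm (gradient \<psi> x) \<le> L"
  shows "\<bar>\<psi> x - \<psi> y\<bar> \<le> L * norm (x - y)"
proof -
  have C: "\<forall>k. Ck k \<psi>" "compact (supp \<psi>)" using \<psi> by (auto simp: test_functions_def)
  note der = smooth_partial_derivative(3)[OF C]
  have "norm (\<psi> x - \<psi> y) \<le> L * norm (x - y)"
  proof (rule differentiable_bound[of UNIV \<psi> "\<lambda>x. frechet_derivative \<psi> (at x)"])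
    fix q
    have lin: "linear (frechet_derivative \<psi> (at q))" by (rule has_derivative_linear[OF der])
    have "frechet_derivative \<psi> (at q) h = gradient \<psi> q \<bullet> h" for h
    proof -
      have "frechet_derivative \<psi> (at q) h = frechet_derivative \<psi> (at q) (\<Sum>i\<in>UNIV. (h $ i) *\<^sub>R axis i 1)"
        by (simp add: basis_expansion scalar_mult_eq_scaleR[symmetric])
      also have "\<dots> = (\<Sum>i\<in>UNIV. (h $ i) * frechet_derivative \<psi> (at q) (axis i 1))"
        by (simp add: linear_sum[OF lin] linear_scale[OF lin])
      finally show ?thesis by (simp add: gradient_def inner_vec_def mult.commute)
    qed
    then have "\<bar>frechet_derivative \<psi> (at q) h\<bar> \<le> L * norm h" for h
      using Cauchy_Schwarz_ineq2[of "gradient \<psi> q" h] mult_right_mono[OF L[of q] norm_ge_zero[of h]] by simp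
    then show "onorm (frechet_derivative \<psi> (at q)) \<le> L"
      by (intro onorm_le) auto
  qed (use der in auto)
  then show ?thesis by simp
qed

section \<open>Gagliardo seminorms as integrals over pairs\<close>

lemma borel_measurable_fst_euclidean [measurable]:
  "fst \<in> borel_measurable (borel :: ('a::euclidean_space \<times> 'b::euclidean_space) measure)"
  by (intro borel_measurable_continuous_onI continuous_on_fst continuous_on_id)

lemma borel_measurable_snd_euclidean [measurable]:
  "snd \<in> borel_measurable (borel :: ('a::euclidean_space \<times> 'b::euclidean_space) measure)"
  by (intro borel_measurable_continuous_onI continuous_on_snd continuous_on_id)

lemma nn_integral_lborel_pair:
  fixes G :: "'a::euclidean_space \<times> 'b::euclidean_space \<Rightarrow> ennreal"
  assumes [measurable]: "G \<in> borel_measurable borel"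
  shows "(\<integral>\<^sup>+z. G z \<partial>lborel) = (\<integral>\<^sup>+x. \<integral>\<^sup>+y. G (x, y) \<partial>lborel \<partial>lborel)"
    and "(\<integral>\<^sup>+z. G z \<partial>lborel) = (\<integral>\<^sup>+y. \<integral>\<^sup>+x. G (x, y) \<partial>lborel \<partial>lborel)"
proof -
  have m: "G \<in> borel_measurable (lborel \<Otimes>\<^sub>M lborel)" by (simp add: lborel_prod)
  show 1: "(\<integral>\<^sup>+z. G z \<partial>lborel) = (\<integral>\<^sup>+x. \<integral>\<^sup>+y. G (x, y) \<partial>lborel \<partial>lborel)"
    using lborel.nn_integral_fst[OF m] by (simp add: lborel_prod)
  show "(\<integral>\<^sup>+z. G z \<partial>lborel) = (\<integral>\<^sup>+y. \<integral>\<^sup>+x. G (x, y) \<partial>lborel \<partial>lborel)"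
    unfolding 1 by (rule lborel_pair.Fubini') (use m in simp)
qed

text \<open>Links the seminorms, defined through increments h, with integrals over pairs of points,
  where the two points can be exchanged.\<close>

lemma nn_integral_lborel_pair_increment:
  fixes G :: "'a::euclidean_space \<times> 'a \<Rightarrow> ennreal"
  assumes [measurable]: "G \<in> borel_measurable borel"
  shows "(\<integral>\<^sup>+z. G z \<partial>lborel) = (\<integral>\<^sup>+h. \<integral>\<^sup>+x. G (x + h, x) \<partial>lborel \<partial>lborel)"
proof -
  have [measurable]: "(\<lambda>(h, x). G (x + h, x)) \<in> borel_measurable (borel \<Otimes>\<^sub>M borel)"
    "G \<in> borel_measurable (borel \<Otimes>\<^sub>M borel)"
    unfolding borel_prod by measurable
  have "(\<integral>\<^sup>+z. G z \<partial>lborel) = (\<integral>\<^sup>+y. \<integral>\<^sup>+x. G (x, y) \<partial>lborel \<partial>lborel)"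
    by (rule nn_integral_lborel_pair(2)) measurable
  also have "\<dots> = (\<integral>\<^sup>+y. \<integral>\<^sup>+h. G (h + y, y) \<partial>lborel \<partial>lborel)"
    by (intro nn_integral_cong nn_integral_lborel_shift[of "\<lambda>x. G (x, y)" for y, symmetric]) measurable
  also have "\<dots> = (\<integral>\<^sup>+h. \<integral>\<^sup>+y. G (h + y, y) \<partial>lborel \<partial>lborel)"
    by (rule lborel_pair.Fubini') (simp add: add.commute[of "fst _"] split_beta', measurable)
  finally show ?thesis by (simp add: add.commute)
qed

lemma borel_measurable_projected_difference [measurable]:
  assumes [measurable]: "u \<in> borel_measurable borel"
  shows "(\<lambda>z. projected_difference u (fst z) (snd z)) \<in> borel_measurable borel"
  unfolding projected_difference_def by measurable

lemma abs_projected_difference_le: "\<bar>projected_difference u x y\<bar> \<le> norm (u x - u y)"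
proof -
  have "\<bar>projected_difference u x y\<bar> \<le> norm (u x - u y) * norm ((x - y) /\<^sub>R norm (x - y))"
    unfolding projected_difference_def by (rule Cauchy_Schwarz_ineq2)
  also have "\<dots> \<le> norm (u x - u y) * 1"
    by (intro mult_left_mono) (cases "x = y", auto)
  finally show ?thesis by simp
qed

lemma slobodeckij_pair:
  fixes u :: "'a::euclidean_space \<Rightarrow> 'b::euclidean_space"
  assumes [measurable]: "u \<in> borel_measurable borel"
  shows "slobodeckij p s u = (\<integral>\<^sup>+z. ennreal (norm (u (fst z) - u (snd z)) powr p
    * norm (fst z - snd z) powr (-(real DIM('a) + s * p))) \<partial>lborel)"
  by (subst nn_integral_lborel_pair_increment) (auto simp: slobodeckij_def)

lemma projected_slobodeckij_pair:
  fixes u :: "real ^ 'n \<Rightarrow> real ^ 'n"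
  assumes [measurable]: "u \<in> borel_measurable borel" and p: "p > 0"
  shows "projected_slobodeckij p s u = (\<integral>\<^sup>+z. ennreal (\<bar>projected_difference u (fst z) (snd z)\<bar> powr p
    * norm (fst z - snd z) powr (-(real CARD('n) + s * p))) \<partial>lborel)"
proof -
  have "\<bar>projected_difference u (x + h) x\<bar> powr p * norm h powr (-(real CARD('n) + s * p))
      = \<bar>(u (x + h) - u x) \<bullet> h\<bar> powr p * norm h powr (-(real CARD('n) + s * p + p))" for x h
  proof (cases "h = 0")
    case False
    have "\<bar>projected_difference u (x + h) x\<bar> = \<bar>(u (x + h) - u x) \<bullet> h\<bar> * norm h powr (-1)"
      by (simp add: projected_difference_def abs_mult powr_minus mult.commute)
    then have "\<bar>projected_difference u (x + h) x\<bar> powr p = \<bar>(u (x + h) - u x) \<bullet> h\<bar> powr p * norm h powr (-p)"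
      by (simp add: powr_divide powr_minus_divide)
    moreover have "norm h powr (-p) * norm h powr (-(real CARD('n) + s * p)) = norm h powr (-(real CARD('n) + s * p + p))"
      by (simp add: powr_add[symmetric])
    ultimately show ?thesis by (simp only: mult.assoc)
  qed simp
  then show ?thesis
    by (subst nn_integral_lborel_pair_increment)
      (auto simp: projected_slobodeckij_def weighted_pair_integral_def)
qed

lemma projected_slobodeckij_le:
  fixes u :: "real ^ 'n \<Rightarrow> real ^ 'n"
  assumes "u \<in> borel_measurable borel" and p: "p > 0"
  shows "projected_slobodeckij p s u \<le> slobodeckij p s u"
  unfolding projected_slobodeckij_pair[OF assms] slobodeckij_pair[OF assms(1)]
  using p abs_projected_difference_le
  by (intro nn_integral_mono ennreal_leI) (auto intro!: mult_mono powr_mono2)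

section \<open>Kernel integrals and products with Lipschitz functions\<close>

lemma nn_integral_lipschitz_kernel_near:
  fixes s p :: real
  assumes p: "p > 0" and s: "0 < s" "s < 1"
  obtains C where "C > 0" and
    "\<And>R x. R > 0 \<Longrightarrow> (\<integral>\<^sup>+y. ennreal (norm (y - x) powr p * norm (y - x) powr (-(real DIM('a) + s * p)))
      * indicator (ball x R) y \<partial>(lborel :: 'a::euclidean_space measure)) \<le> ennreal (C * R powr (p - s * p))"
proof -
  \<comment> \<open>Because s < 1, the Lipschitz factor norm (y - x) powr p more than compensates
    the singularity of the kernel.\<close>
  have "p - s * p > 0" using p s by (simp add: algebra_simps)
  then obtain C where C: "C > 0" "\<And>R. R > 0 \<Longrightarrow> (\<integral>\<^sup>+h. ennreal (norm h powr (p - s * p - DIM('a)))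
      * indicator (ball (0::'a) R) h \<partial>lborel) \<le> ennreal (C * R powr (p - s * p))"
    using nn_integral_norm_powr_near[where 'a='a] by blast
  show thesis
  proof (rule that[OF C(1)])
    fix R :: real and x :: 'a assume R: "R > 0"
    have "(\<integral>\<^sup>+y. ennreal (norm (y - x) powr p * norm (y - x) powr (-(real DIM('a) + s * p))) * indicator (ball x R) y \<partial>lborel)
      = (\<integral>\<^sup>+h. ennreal (norm h powr p * norm h powr (-(real DIM('a) + s * p))) * indicator (ball (0::'a) R) h \<partial>lborel)"
      by (subst nn_integral_lborel_shift[of _ x, symmetric])
        (auto intro!: nn_integral_cong simp: indicator_def dist_norm)
    also have "\<dots> = (\<integral>\<^sup>+h. ennreal (norm h powr (p - s * p - DIM('a))) * indicator (ball (0::'a) R) h \<partial>lborel)"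
      by (simp add: powr_add[symmetric] algebra_simps)
    finally show "(\<integral>\<^sup>+y. ennreal (norm (y - x) powr p * norm (y - x) powr (-(real DIM('a) + s * p)))
      * indicator (ball x R) y \<partial>lborel) \<le> ennreal (C * R powr (p - s * p))"
      using C(2)[OF R] by simp
  qed
qed

lemma nn_integral_kernel_far:
  fixes s p :: real
  assumes p: "p > 0" and s: "0 < s"
  obtains C where "C > 0" and
    "\<And>R x. R > 0 \<Longrightarrow> (\<integral>\<^sup>+y. ennreal (norm (y - x) powr (-(real DIM('a) + s * p)))
      * indicator (- ball x R) y \<partial>(lborel :: 'a::euclidean_space measure)) \<le> ennreal (C * R powr (- (s * p)))"
proof -
  have "s * p > 0" using p s by simp
  then obtain C where C: "C > 0" "\<And>R. R > 0 \<Longrightarrow> (\<integral>\<^sup>+h. ennreal (norm h powr (-(DIM('a) + s * p)))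
      * indicator (- ball (0::'a) R) h \<partial>lborel) \<le> ennreal (C * R powr (- (s * p)))"
    using nn_integral_norm_powr_far[where 'a='a] by blast
  show thesis
  proof (rule that[OF C(1)])
    fix R :: real and x :: 'a assume R: "R > 0"
    have "(\<integral>\<^sup>+y. ennreal (norm (y - x) powr (-(real DIM('a) + s * p))) * indicator (- ball x R) y \<partial>lborel)
      = (\<integral>\<^sup>+h. ennreal (norm h powr (-(real DIM('a) + s * p))) * indicator (- ball (0::'a) R) h \<partial>lborel)"
      by (subst nn_integral_lborel_shift[of _ x, symmetric])
        (auto intro!: nn_integral_cong simp: indicator_def dist_norm)
    then show "(\<integral>\<^sup>+y. ennreal (norm (y - x) powr (-(real DIM('a) + s * p)))
      * indicator (- ball x R) y \<partial>lborel) \<le> ennreal (C * R powr (- (s * p)))"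
      using C(2)[OF R] by simp
  qed
qed

text \<open>Write \<theta> x u x - \<theta> y u y as \<theta> x (u x - u y) + (\<theta> x - \<theta>
  y) u y. The first part is controlled by the seminorm of u. For the second, the kernel integral of
  \<bar>\<theta> x - \<theta> y\<bar> powr p is bounded uniformly in y. Only finiteness is claimed,
  as needed for the later absorption.\<close>

lemma slobodeckij_lipschitz_multiple:
  fixes u :: "'a::euclidean_space \<Rightarrow> 'b::euclidean_space" and \<theta> :: "'a \<Rightarrow> real" and p s L :: real
  assumes u[measurable]: "u \<in> borel_measurable borel" and \<theta>m[measurable]: "\<theta> \<in> borel_measurable borel"
    and p: "p \<ge> 1" and s: "0 < s" "s < 1"
    and Lp: "(\<integral>\<^sup>+x. ennreal (norm (u x) powr p) \<partial>lborel) < \<infinity>" and fin: "slobodeckij p s u < \<infinity>"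
    and \<theta>1: "\<And>x. \<bar>\<theta> x\<bar> \<le> 1" and \<theta>L: "\<And>x y. \<bar>\<theta> x - \<theta> y\<bar> \<le> L * norm (x - y)"
  shows "slobodeckij p s (\<lambda>x. \<theta> x *\<^sub>R u x) < \<infinity>"
proof -
  define \<beta> where "\<beta> = real DIM('a) + s * p"
  obtain C1 where C1: "C1 > 0" "\<And>R x. R > 0 \<Longrightarrow> (\<integral>\<^sup>+y. ennreal (norm (y - x) powr p * norm (y - x) powr (-\<beta>))
      * indicator (ball x R) y \<partial>(lborel :: 'a measure)) \<le> ennreal (C1 * R powr (p - s * p))"
    using nn_integral_lipschitz_kernel_near[of p s, where 'a='a] p s unfolding \<beta>_def by auto
  obtain C2 where C2: "C2 > 0" "\<And>R x. R > 0 \<Longrightarrow> (\<integral>\<^sup>+y. ennreal (norm (y - x) powr (-\<beta>))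
      * indicator (- ball x R) y \<partial>(lborel :: 'a measure)) \<le> ennreal (C2 * R powr (- (s * p)))"
    using nn_integral_kernel_far[of p s, where 'a='a] p s unfolding \<beta>_def by auto
  \<comment> \<open>Splits at distance 1: the Lipschitz bound inside, and \<bar>\<theta> y -
    \<theta> x\<bar> \<le> 2 outside.\<close>
  define K where "K = \<bar>L\<bar> powr p * C1 + 2 powr p * C2"
  have K: "K \<ge> 0" using C1 C2 by (simp add: K_def)
  have inner: "(\<integral>\<^sup>+y. ennreal (\<bar>\<theta> y - \<theta> x\<bar> powr p * norm (y - x) powr (-\<beta>)) \<partial>lborel) \<le> ennreal K" for x
  proof -
    have "(\<integral>\<^sup>+y. ennreal (\<bar>\<theta> y - \<theta> x\<bar> powr p * norm (y - x) powr (-\<beta>)) \<partial>lborel)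
      \<le> (\<integral>\<^sup>+y. ennreal (\<bar>L\<bar> powr p) * (ennreal (norm (y - x) powr p * norm (y - x) powr (-\<beta>)) * indicator (ball x 1) y)
        + ennreal (2 powr p) * (ennreal (norm (y - x) powr (-\<beta>)) * indicator (- ball x 1) y) \<partial>lborel)"
    proof (rule nn_integral_mono)
      fix y
      show "ennreal (\<bar>\<theta> y - \<theta> x\<bar> powr p * norm (y - x) powr (-\<beta>))
        \<le> ennreal (\<bar>L\<bar> powr p) * (ennreal (norm (y - x) powr p * norm (y - x) powr (-\<beta>)) * indicator (ball x 1) y)
        + ennreal (2 powr p) * (ennreal (norm (y - x) powr (-\<beta>)) * indicator (- ball x 1) y)"
      proof (cases "y \<in> ball x 1")
        case True
        have "\<bar>\<theta> y - \<theta> x\<bar> \<le> \<bar>L\<bar> * norm (y - x)"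
          using \<theta>L[of y x] mult_right_mono[OF abs_ge_self norm_ge_zero] by (rule order_trans)
        then have "\<bar>\<theta> y - \<theta> x\<bar> powr p \<le> \<bar>L\<bar> powr p * norm (y - x) powr p"
          using p powr_mono2[of p "\<bar>\<theta> y - \<theta> x\<bar>" "\<bar>L\<bar> * norm (y - x)"] by (simp add: powr_mult)
        then have "\<bar>\<theta> y - \<theta> x\<bar> powr p * norm (y - x) powr (-\<beta>)
            \<le> (\<bar>L\<bar> powr p * norm (y - x) powr p) * norm (y - x) powr (-\<beta>)"
          by (rule mult_right_mono) simp
        then show ?thesis using True by (simp add: ennreal_mult'[symmetric] ennreal_leI mult.assoc)
      next
        case False
        have "\<bar>\<theta> y - \<theta> x\<bar> \<le> 2" using \<theta>1[of x] \<theta>1[of y] by linarith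
        then have "\<bar>\<theta> y - \<theta> x\<bar> powr p * norm (y - x) powr (-\<beta>) \<le> 2 powr p * norm (y - x) powr (-\<beta>)"
          using p by (intro mult_right_mono powr_mono2) auto
        then show ?thesis using False by (simp add: ennreal_mult'[symmetric] ennreal_leI)
      qed
    qed
    also have "\<dots> = ennreal (\<bar>L\<bar> powr p) * (\<integral>\<^sup>+y. ennreal (norm (y - x) powr p * norm (y - x) powr (-\<beta>)) * indicator (ball x 1) y \<partial>lborel)
        + ennreal (2 powr p) * (\<integral>\<^sup>+y. ennreal (norm (y - x) powr (-\<beta>)) * indicator (- ball x 1) y \<partial>lborel)"
      by (simp add: nn_integral_add nn_integral_cmult)
    also have "\<dots> \<le> ennreal (\<bar>L\<bar> powr p) * ennreal (C1 * 1 powr (p - s * p)) + ennreal (2 powr p) * ennreal (C2 * 1 powr (- (s * p)))"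
      by (intro add_mono mult_left_mono C1 C2) auto
    also have "\<dots> = ennreal K"
      using C1 C2 by (simp add: K_def ennreal_mult'[symmetric] ennreal_plus[symmetric] del: ennreal_plus)
    finally show ?thesis .
  qed
  have "slobodeckij p s (\<lambda>x. \<theta> x *\<^sub>R u x) = (\<integral>\<^sup>+z. ennreal (norm (\<theta> (fst z) *\<^sub>R u (fst z) - \<theta> (snd z) *\<^sub>R u (snd z)) powr p
      * norm (fst z - snd z) powr (-\<beta>)) \<partial>lborel)"
    by (subst slobodeckij_pair) (auto simp: \<beta>_def)
  also have "\<dots> \<le> (\<integral>\<^sup>+z. ennreal (2 powr p) * (ennreal (norm (u (fst z) - u (snd z)) powr p * norm (fst z - snd z) powr (-\<beta>))
      + ennreal (norm (u (snd z)) powr p * (\<bar>\<theta> (fst z) - \<theta> (snd z)\<bar> powr p * norm (fst z - snd z) powr (-\<beta>)))) \<partial>lborel)"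
  proof (rule nn_integral_mono)
    fix z :: "'a \<times> 'a"
    obtain x y where z: "z = (x, y)" by fastforce
    have "\<theta> x *\<^sub>R u x - \<theta> y *\<^sub>R u y = \<theta> x *\<^sub>R (u x - u y) + (\<theta> x - \<theta> y) *\<^sub>R u y"
      by (simp add: algebra_simps)
    then have "norm (\<theta> x *\<^sub>R u x - \<theta> y *\<^sub>R u y) \<le> \<bar>\<theta> x\<bar> * norm (u x - u y) + \<bar>\<theta> x - \<theta> y\<bar> * norm (u y)"
      by (metis norm_scaleR norm_triangle_ineq)
    also have "\<dots> \<le> norm (u x - u y) + \<bar>\<theta> x - \<theta> y\<bar> * norm (u y)"
      using \<theta>1[of x] by (simp add: mult_left_le_one_le)
    finally have "norm (\<theta> x *\<^sub>R u x - \<theta> y *\<^sub>R u y) powr p \<le> (norm (u x - u y) + \<bar>\<theta> x - \<theta> y\<bar> * norm (u y)) powr p"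
      using p by (intro powr_mono2) auto
    also have "\<dots> \<le> 2 powr p * (norm (u x - u y) powr p + (\<bar>\<theta> x - \<theta> y\<bar> * norm (u y)) powr p)"
      using p by (intro powr_add_le) auto
    finally have "norm (\<theta> x *\<^sub>R u x - \<theta> y *\<^sub>R u y) powr p * norm (x - y) powr (-\<beta>)
      \<le> 2 powr p * (norm (u x - u y) powr p + (\<bar>\<theta> x - \<theta> y\<bar> * norm (u y)) powr p) * norm (x - y) powr (-\<beta>)"
      by (rule mult_right_mono) simp
    also have "\<dots> = 2 powr p * (norm (u x - u y) powr p * norm (x - y) powr (-\<beta>)
        + norm (u y) powr p * (\<bar>\<theta> x - \<theta> y\<bar> powr p * norm (x - y) powr (-\<beta>)))"
      by (simp add: powr_mult algebra_simps)
    finally show "ennreal (norm (\<theta> (fst z) *\<^sub>R u (fst z) - \<theta> (snd z) *\<^sub>R u (snd z)) powr p * norm (fst z - snd z) powr (-\<beta>))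
      \<le> ennreal (2 powr p) * (ennreal (norm (u (fst z) - u (snd z)) powr p * norm (fst z - snd z) powr (-\<beta>))
      + ennreal (norm (u (snd z)) powr p * (\<bar>\<theta> (fst z) - \<theta> (snd z)\<bar> powr p * norm (fst z - snd z) powr (-\<beta>))))"
      by (simp add: z ennreal_mult'[symmetric] ennreal_plus[symmetric] ennreal_leI del: ennreal_plus)
  qed
  also have "\<dots> = ennreal (2 powr p) * (slobodeckij p s u
      + (\<integral>\<^sup>+z. ennreal (norm (u (snd z)) powr p * (\<bar>\<theta> (fst z) - \<theta> (snd z)\<bar> powr p * norm (fst z - snd z) powr (-\<beta>))) \<partial>lborel))"
    by (simp add: nn_integral_cmult nn_integral_add slobodeckij_pair \<beta>_def)
  also have "(\<integral>\<^sup>+z. ennreal (norm (u (snd z)) powr p * (\<bar>\<theta> (fst z) - \<theta> (snd z)\<bar> powr p * norm (fst z - snd z) powr (-\<beta>))) \<partial>lborel)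
     = (\<integral>\<^sup>+y. ennreal (norm (u y) powr p) * (\<integral>\<^sup>+x. ennreal (\<bar>\<theta> x - \<theta> y\<bar> powr p * norm (x - y) powr (-\<beta>)) \<partial>lborel) \<partial>lborel)"
    by (subst nn_integral_lborel_pair(2)) (auto simp: ennreal_mult' nn_integral_cmult)
  also have "ennreal (2 powr p) * (slobodeckij p s u + \<dots>)
      \<le> ennreal (2 powr p) * (slobodeckij p s u + (\<integral>\<^sup>+y. ennreal (norm (u y) powr p) * ennreal K \<partial>lborel))"
    by (intro mult_left_mono add_left_mono nn_integral_mono inner) auto
  also have "\<dots> < \<infinity>"
    using fin Lp by (simp add: nn_integral_multc ennreal_mult_less_top)
  finally show ?thesis .
qed

lemma integral_diff_le_nn_integral:
  fixes F G :: "'a \<Rightarrow> real"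
  assumes F: "integrable M F" and G[measurable]: "G \<in> borel_measurable M"
    and le: "(\<integral>\<^sup>+x. ennreal \<bar>G x - F x\<bar> \<partial>M) \<le> ennreal e" and e: "e \<ge> 0"
  shows "\<bar>integral\<^sup>L M G - integral\<^sup>L M F\<bar> \<le> e"
proof -
  have [measurable]: "F \<in> borel_measurable M" using F by auto
  have GF: "integrable M (\<lambda>x. G x - F x)"
    using le by (intro integrableI_bounded) (auto simp: le_less_trans[OF _ ennreal_less_top])
  then have "integrable M (\<lambda>x. (G x - F x) + F x)" using F by (intro Bochner_Integration.integrable_add)
  then have "integrable M G" by simp
  then have "integral\<^sup>L M G - integral\<^sup>L M F = (LINT x|M. G x - F x)" using F by simp
  moreover have "ennreal (norm (LINT x|M. G x - F x)) \<le> ennreal e"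
    using integral_norm_bound_ennreal[OF GF] le by (simp add: order_trans)
  ultimately show ?thesis using e by simp
qed

section \<open>The energy form\<close>

lemma powr_diff_le:
  fixes a b p :: real
  assumes "0 \<le> b" "b \<le> a" "p \<ge> 1"
  shows "a powr p - b powr p \<le> p * a powr (p - 1) * (a - b)"
proof -
  \<comment> \<open>The mean value theorem is applied away from 0, where the derivative of
    \<open>powr\<close> is available; b = 0 is computed directly.\<close>
  consider "b = a" | "b = 0" "a > 0" | "0 < b" "b < a" using assms by fastforce
  then show ?thesis
  proof cases
    case 2
    have "a powr (p - 1) * a = a powr p" using 2 powr_mult_base[of a "p - 1"] by (simp add: mult.commute)
    then have "p * (a powr (p - 1) * a) = p * a powr p" by simp
    moreover have "1 * a powr p \<le> p * a powr p" using assms by (intro mult_right_mono) auto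
    ultimately show ?thesis using 2 by (simp add: mult.assoc)
  next
    case 3
    have "\<exists>z. z > b \<and> z < a \<and> a powr p - b powr p = (a - b) * (p * z powr (p - 1))"
      using 3 by (intro MVT2) (auto intro!: has_real_derivative_powr)
    then obtain z where z: "b < z" "z < a" "a powr p - b powr p = (a - b) * (p * z powr (p - 1))" by blast
    have "z powr (p - 1) \<le> a powr (p - 1)" using z 3 assms by (intro powr_mono2) auto
    then have "(a - b) * (p * z powr (p - 1)) \<le> (a - b) * (p * a powr (p - 1))"
      using 3 assms by (intro mult_left_mono) auto
    then show ?thesis using z(3) by (simp add: mult_ac)
  qed simp
qed

text \<open>With t = \<alpha> * \<bar>a - b\<bar> and v = (\<alpha> - \<gamma>) * \<bar>b\<bar>, the
  main part is t powr p. Replacing \<gamma> powr p by \<alpha> powr p costs at most p * t powr (p -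
  1) * v; the assumption \<gamma> \<le> \<alpha> is what puts \<alpha> into this bound. Half of the
  main part absorbs the error.\<close>

lemma energy_lower_bound_ordered:
  fixes a b \<alpha> \<gamma> p :: real
  assumes p: "p \<ge> 2" and \<gamma>: "0 \<le> \<gamma>" "\<gamma> \<le> \<alpha>"
  shows "2 powr (-p-1) * \<bar>\<alpha> * a - \<gamma> * b\<bar> powr p - ((2 * p) powr p + 1) * \<bar>\<alpha> - \<gamma>\<bar> powr p * \<bar>b\<bar> powr p
    \<le> \<bar>a - b\<bar> powr (p - 2) * (a - b) * (\<alpha> powr p * a - \<gamma> powr p * b)"
proof -
  define t where "t = \<alpha> * \<bar>a - b\<bar>"
  define v where "v = (\<alpha> - \<gamma>) * \<bar>b\<bar>"
  have t0: "t \<ge> 0" and v0: "v \<ge> 0" using \<gamma> by (simp_all add: t_def v_def)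
  have X1: "\<bar>a - b\<bar> powr (p - 2) * \<bar>a - b\<bar> = \<bar>a - b\<bar> powr (p - 1)"
    using powr_mult_base[of "\<bar>a - b\<bar>" "p - 2"] by (simp add: mult.commute)
  have X2: "\<bar>a - b\<bar> powr (p - 2) * (a - b) * (a - b) = \<bar>a - b\<bar> powr p"
  proof -
    have "\<bar>a - b\<bar> powr (p - 2) * (a - b) * (a - b) = (\<bar>a - b\<bar> powr (p - 2) * \<bar>a - b\<bar>) * \<bar>a - b\<bar>"
      by (simp add: mult.assoc abs_mult_self_eq)
    also have "\<dots> = \<bar>a - b\<bar> powr p"
      unfolding X1 using powr_mult_base[of "\<bar>a - b\<bar>" "p - 1"] by (simp add: mult.commute)
    finally show ?thesis .
  qed
  have tp: "t powr p = \<alpha> powr p * \<bar>a - b\<bar> powr p" and vp: "v powr p = \<bar>\<alpha> - \<gamma>\<bar> powr p * \<bar>b\<bar> powr p"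
    and tp1: "t powr (p - 1) = \<alpha> powr (p - 1) * \<bar>a - b\<bar> powr (p - 1)"
    using \<gamma> by (simp_all add: t_def v_def powr_mult)
  \<comment> \<open>Instead of the sharp Young inequality: either v is at most t / (2 p) and half of
    t powr p suffices, or t is less than 2 p v and is replaced by it.\<close>
  have young: "p * t powr (p - 1) * v \<le> t powr p / 2 + (2 * p) powr p * v powr p"
  proof (cases "2 * p * v \<le> t")
    case True
    have "t powr (p - 1) * (p * v) \<le> t powr (p - 1) * (t / 2)" using True by (intro mult_left_mono) auto
    also have "\<dots> = t powr p / 2" using t0 powr_mult_base[of t "p - 1"] by (simp add: mult.commute)
    finally have "p * t powr (p - 1) * v \<le> t powr p / 2" by (simp add: mult_ac)
    then show ?thesis by (simp add: add_increasing2)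
  next
    case False
    have "p * t powr (p - 1) * v \<le> p * (2 * p * v) powr (p - 1) * v"
      using False t0 v0 p by (intro mult_right_mono mult_left_mono powr_mono2) auto
    also have "\<dots> \<le> (2 * p * v) powr (p - 1) * (2 * p * v)"
      using v0 p by (simp add: mult_ac mult_left_mono)
    also have "\<dots> = (2 * p * v) powr p"
      using v0 p powr_mult_base[of "2 * p * v" "p - 1"] by (simp add: mult.commute)
    also have "\<dots> = (2 * p) powr p * v powr p" using v0 p by (simp add: powr_mult)
    finally show ?thesis by (simp add: add_increasing)
  qed
  have "\<bar>\<alpha> * a - \<gamma> * b\<bar> = \<bar>\<alpha> * (a - b) + (\<alpha> - \<gamma>) * b\<bar>" by (simp add: algebra_simps)
  also have "\<dots> \<le> t + v" using \<gamma> by (simp add: t_def v_def abs_mult abs_triangle_ineq[THEN order_trans])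
  finally have "\<bar>\<alpha> * a - \<gamma> * b\<bar> powr p \<le> (t + v) powr p" using p by (intro powr_mono2) auto
  also have "\<dots> \<le> 2 powr p * (t powr p + v powr p)" using t0 v0 p by (intro powr_add_le) auto
  \<comment> \<open>The factor 2 powr (-p-1) reduces the constant 2 powr p of the sum inequality to
    1 / 2, the share of t powr p that survives the absorption.\<close>
  finally have "2 powr (-p-1) * \<bar>\<alpha> * a - \<gamma> * b\<bar> powr p \<le> 2 powr (-p-1) * (2 powr p * (t powr p + v powr p))"
    by (rule mult_left_mono) simp
  also have "\<dots> = (t powr p + v powr p) / 2"
    by (simp add: mult.assoc[symmetric] powr_add[symmetric] powr_minus_divide)
  finally have 1: "2 powr (-p-1) * \<bar>\<alpha> * a - \<gamma> * b\<bar> powr p \<le> (t powr p + v powr p) / 2" .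
  have "\<alpha> powr p * \<bar>a - b\<bar> powr p - \<bar>a - b\<bar> powr (p - 1) * (\<alpha> powr p - \<gamma> powr p) * \<bar>b\<bar>
    \<le> \<bar>a - b\<bar> powr (p - 2) * (a - b) * (\<alpha> powr p * a - \<gamma> powr p * b)"
  proof -
    have mono: "\<gamma> powr p \<le> \<alpha> powr p" using \<gamma> p by (intro powr_mono2) auto
    have "\<bar>a - b\<bar> powr (p - 2) * (a - b) * (\<alpha> powr p * a - \<gamma> powr p * b)
      = \<alpha> powr p * (\<bar>a - b\<bar> powr (p - 2) * (a - b) * (a - b))
        + \<bar>a - b\<bar> powr (p - 2) * (a - b) * (\<alpha> powr p - \<gamma> powr p) * b"
      by (simp add: algebra_simps)
    moreover have "\<bar>\<bar>a - b\<bar> powr (p - 2) * (a - b) * (\<alpha> powr p - \<gamma> powr p) * b\<bar>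
      = \<bar>a - b\<bar> powr (p - 1) * (\<alpha> powr p - \<gamma> powr p) * \<bar>b\<bar>"
      using mono by (simp add: abs_mult X1)
    ultimately show ?thesis unfolding X2 by linarith
  qed
  moreover have "\<bar>a - b\<bar> powr (p - 1) * (\<alpha> powr p - \<gamma> powr p) * \<bar>b\<bar> \<le> p * t powr (p - 1) * v"
  proof -
    have "\<bar>a - b\<bar> powr (p - 1) * (\<alpha> powr p - \<gamma> powr p) * \<bar>b\<bar>
      \<le> \<bar>a - b\<bar> powr (p - 1) * (p * \<alpha> powr (p - 1) * (\<alpha> - \<gamma>)) * \<bar>b\<bar>"
      using \<gamma> p by (intro mult_right_mono mult_left_mono powr_diff_le) auto
    then show ?thesis unfolding tp1 v_def by (simp add: mult_ac)
  qed
  ultimately have "t powr p - (t powr p / 2 + (2 * p) powr p * v powr p)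
      \<le> \<bar>a - b\<bar> powr (p - 2) * (a - b) * (\<alpha> powr p * a - \<gamma> powr p * b)"
    using young unfolding tp by linarith
  moreover have "W - (K + V) \<le> R"
    if "T - (T / 2 + K) \<le> R" "W \<le> (T + V) / 2" "V \<ge> 0" for T K R W V :: real
    using that by (simp add: field_simps)
  ultimately have "2 powr (-p-1) * \<bar>\<alpha> * a - \<gamma> * b\<bar> powr p - ((2 * p) powr p + 1) * v powr p
      \<le> \<bar>a - b\<bar> powr (p - 2) * (a - b) * (\<alpha> powr p * a - \<gamma> powr p * b)"
    using 1 powr_ge_zero[of v p] unfolding distrib_right[of _ 1] mult_1_left by blast
  then show ?thesis by (simp add: vp mult.assoc)
qed

text \<open>Exchanging the two points leaves the energy unchanged, so the point with the larger
  cut-off value may be put first. Which of a and b then enters the error depends on the order, hence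
  the sum of both.\<close>

lemma energy_lower_bound:
  fixes a b \<alpha> \<gamma> p :: real
  assumes p: "p \<ge> 2" and "0 \<le> \<gamma>" "0 \<le> \<alpha>"
  shows "2 powr (-p-1) * \<bar>\<alpha> * a - \<gamma> * b\<bar> powr p
      - ((2 * p) powr p + 1) * \<bar>\<alpha> - \<gamma>\<bar> powr p * (\<bar>a\<bar> powr p + \<bar>b\<bar> powr p)
    \<le> \<bar>a - b\<bar> powr (p - 2) * (a - b) * (\<alpha> powr p * a - \<gamma> powr p * b)"
proof -
  have C: "((2 * p) powr p + 1) * \<bar>\<alpha> - \<gamma>\<bar> powr p * c \<le> ((2 * p) powr p + 1) * \<bar>\<alpha> - \<gamma>\<bar> powr p * (\<bar>a\<bar> powr p + \<bar>b\<bar> powr p)"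
    if "c = \<bar>a\<bar> powr p \<or> c = \<bar>b\<bar> powr p" for c
    using that by (intro mult_left_mono) (auto simp: add_nonneg_nonneg)
  show ?thesis
  proof (cases "\<gamma> \<le> \<alpha>")
    case True
    show ?thesis using energy_lower_bound_ordered[OF p assms(2) True, of a b] C[of "\<bar>b\<bar> powr p"] by simp
  next
    case False
    have sym: "\<bar>b - a\<bar> = \<bar>a - b\<bar>" "\<bar>\<gamma> * b - \<alpha> * a\<bar> = \<bar>\<alpha> * a - \<gamma> * b\<bar>" "\<bar>\<gamma> - \<alpha>\<bar> = \<bar>\<alpha> - \<gamma>\<bar>"
      by (simp_all add: abs_minus_commute)
    have sym': "t * (b - a) * (\<gamma> powr p * b - \<alpha> powr p * a) = t * (a - b) * (\<alpha> powr p * a - \<gamma> powr p * b)" for t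
      by (simp add: algebra_simps)
    have "2 powr (-p-1) * \<bar>\<alpha> * a - \<gamma> * b\<bar> powr p - ((2 * p) powr p + 1) * \<bar>\<alpha> - \<gamma>\<bar> powr p * \<bar>a\<bar> powr p
      \<le> \<bar>a - b\<bar> powr (p - 2) * (a - b) * (\<alpha> powr p * a - \<gamma> powr p * b)"
      using energy_lower_bound_ordered[OF p assms(3), of \<gamma> b a, unfolded sym sym'] False by simp
    from order_trans[OF diff_left_mono[OF C] this] show ?thesis by simp
  qed
qed

text \<open>The product (a - b) * a is negative only if b has the sign of a and exceeds it in
  modulus; then \<bar>a - b\<bar> \<le> \<bar>b\<bar>. This is the origin of the exponent p - 1 in
  the tail term.\<close>

lemma energy_lower_bound_far:
  fixes a b p :: real
  assumes p: "p \<ge> 2"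
  shows "- (\<bar>b\<bar> powr (p - 1) * \<bar>a\<bar>) \<le> \<bar>a - b\<bar> powr (p - 2) * (a - b) * a"
proof (cases "(a - b) * a \<ge> 0")
  case True
  then have "\<bar>a - b\<bar> powr (p - 2) * ((a - b) * a) \<ge> 0" by (rule mult_nonneg_nonneg[OF powr_ge_zero])
  moreover have "\<bar>b\<bar> powr (p - 1) * \<bar>a\<bar> \<ge> 0" by simp
  ultimately show ?thesis unfolding mult.assoc by linarith
next
  case False
  then have ab: "\<bar>a - b\<bar> \<le> \<bar>b\<bar>" by (auto simp: not_le mult_less_0_iff)
  have "\<bar>\<bar>a - b\<bar> powr (p - 2) * (a - b) * a\<bar> = (\<bar>a - b\<bar> * \<bar>a - b\<bar> powr (p - 2)) * \<bar>a\<bar>"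
    by (simp add: abs_mult)
  also have "\<dots> = \<bar>a - b\<bar> powr (p - 1) * \<bar>a\<bar>"
    by (subst powr_mult_base) auto
  also have "\<dots> \<le> \<bar>b\<bar> powr (p - 1) * \<bar>a\<bar>"
    using ab p by (intro mult_right_mono powr_mono2) auto
  finally show ?thesis by linarith
qed

section \<open>The integrand as a pairing on the space of pairs\<close>

definition nonlocal_integrand ::
    "real \<Rightarrow> real \<Rightarrow> (real ^ 'n \<Rightarrow> real ^ 'n \<Rightarrow> real)
      \<Rightarrow> (real ^ 'n \<Rightarrow> real ^ 'n) \<Rightarrow> (real ^ 'n \<Rightarrow> real ^ 'n) \<Rightarrow> (real ^ 'n) \<times> (real ^ 'n) \<Rightarrow> real"
  where "nonlocal_integrand p s A u \<phi> z =
    A (fst z) (snd z) / norm (fst z - snd z) powr (real CARD('n) + s * p)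
      * \<bar>projected_difference u (fst z) (snd z)\<bar> powr (p - 2)
      * projected_difference u (fst z) (snd z) * projected_difference \<phi> (fst z) (snd z)"

text \<open>One of two factors of the integrand, the other being \<open>weighted_difference\<close>.
  The kernel exponent is divided in the proportion 1 / p' to 1 / p, so that the factors lie in L^p'
  and L^p over pairs and Hoelder's inequality applies; (p - 1) * p' = p makes the first norm a
  multiple of the projected seminorm.\<close>

definition flux ::
    "real \<Rightarrow> real \<Rightarrow> real \<Rightarrow> (real ^ 'n \<Rightarrow> real ^ 'n \<Rightarrow> real)
      \<Rightarrow> (real ^ 'n \<Rightarrow> real ^ 'n) \<Rightarrow> (real ^ 'n) \<times> (real ^ 'n) \<Rightarrow> real"
  where "flux p p' s A u z = A (fst z) (snd z)
      * (\<bar>projected_difference u (fst z) (snd z)\<bar> powr (p - 2)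
      * projected_difference u (fst z) (snd z))
      * norm (fst z - snd z) powr (-((real CARD('n) + s * p) / p'))"

definition weighted_difference ::
    "real \<Rightarrow> real \<Rightarrow> (real ^ 'n \<Rightarrow> real ^ 'n) \<Rightarrow> (real ^ 'n) \<times> (real ^ 'n) \<Rightarrow> real"
  where "weighted_difference p s \<phi> z = projected_difference \<phi> (fst z) (snd z)
      * norm (fst z - snd z) powr (-((real CARD('n) + s * p) / p))"

lemma nonlocal_integrand_eq:
  assumes "1 / p + 1 / p' = 1"
  shows "nonlocal_integrand p s A u \<phi> z = flux p p' s A u z \<bullet> weighted_difference p s \<phi> z"
proof -
  obtain x y where z: "z = (x, y)" by fastforce
  define \<beta> where "\<beta> = real CARD('a) + s * p"
  have "-(\<beta> / p') + -(\<beta> / p) = - (\<beta> * (1 / p + 1 / p'))" by (simp add: algebra_simps)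
  then have "norm (x - y) powr (-(\<beta> / p')) * norm (x - y) powr (-(\<beta> / p)) = 1 / norm (x - y) powr \<beta>"
    unfolding powr_add[symmetric] assms by (simp add: powr_minus_divide)
  then have kernel: "norm (x - y) powr (-(\<beta> / p')) * norm (x - y) powr (-(\<beta> / p)) = 1 / norm (x - y) powr \<beta>" .
  have reorder: "a * (t * D) * norm (x - y) powr (-(\<beta> / p')) * (D' * norm (x - y) powr (-(\<beta> / p)))
      = a / norm (x - y) powr \<beta> * t * D * D'" for a t D D' :: real
  proof -
    have 1: "a * (t * D) * k1 * (D' * k2) = a * t * D * D' * (k1 * k2)" for k1 k2 :: real
      by (simp only: mult_ac)
    show ?thesis unfolding 1 kernel by simp
  qed
  show ?thesis
    unfolding nonlocal_integrand_def flux_def weighted_difference_def z inner_real_def fst_conv snd_conv \<beta>_def[symmetric]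
    using reorder by simp
qed

lemma flux_measurable [measurable]:
  assumes [measurable]: "(\<lambda>z. A (fst z) (snd z)) \<in> borel_measurable borel" "u \<in> borel_measurable borel"
  shows "flux p p' s A u \<in> borel_measurable borel"
  unfolding flux_def[abs_def] by measurable

lemma weighted_difference_measurable [measurable]:
  assumes [measurable]: "\<phi> \<in> borel_measurable borel"
  shows "weighted_difference p s \<phi> \<in> borel_measurable borel"
  unfolding weighted_difference_def[abs_def] by measurable

lemma nn_integral_weighted_difference:
  assumes "\<phi> \<in> borel_measurable borel" "p > 0"
  shows "(\<integral>\<^sup>+z. ennreal (norm (weighted_difference p s \<phi> z) powr p) \<partial>lborel) = projected_slobodeckij p s \<phi>"
proof -
  have "norm (weighted_difference p s \<phi> z) powr p = \<bar>projected_difference \<phi> (fst z) (snd z)\<bar> powr p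
    * norm (fst z - snd z) powr (-(real CARD('a) + s * p))" for z
    using assms(2) by (simp add: weighted_difference_def abs_mult powr_mult powr_powr)
  then show ?thesis unfolding projected_slobodeckij_pair[OF assms] by simp
qed

lemma nn_integral_flux_le:
  assumes [measurable]: "(\<lambda>z. A (fst z) (snd z)) \<in> borel_measurable borel" "u \<in> borel_measurable borel"
    and A: "\<And>x y. \<bar>A x y\<bar> \<le> \<Lambda>" and p: "p \<ge> 2" "1 / p + 1 / p' = 1" "p' > 1"
  shows "(\<integral>\<^sup>+z. ennreal (norm (flux p p' s A u z) powr p') \<partial>lborel) \<le> ennreal (\<Lambda> powr p') * projected_slobodeckij p s u"
proof -
  have pp: "(p - 1) * p' = p" using p by (simp add: field_simps)
  have "norm (flux p p' s A u z) powr p' \<le> \<Lambda> powr p' * (\<bar>projected_difference u (fst z) (snd z)\<bar> powr p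
    * norm (fst z - snd z) powr (-(real CARD('a) + s * p)))" for z
  proof -
    let ?D = "\<bar>projected_difference u (fst z) (snd z)\<bar>" and ?k = "norm (fst z - snd z) powr (-((real CARD('a) + s * p) / p'))"
    have "norm (flux p p' s A u z) = \<bar>A (fst z) (snd z)\<bar> * (?D * ?D powr (p - 2)) * ?k"
      by (simp add: flux_def abs_mult mult_ac)
    also have "?D * ?D powr (p - 2) = ?D powr (p - 1)" by (subst powr_mult_base) auto
    also have "\<bar>A (fst z) (snd z)\<bar> * ?D powr (p - 1) * ?k \<le> \<Lambda> * ?D powr (p - 1) * ?k"
      by (intro mult_right_mono A) auto
    finally have "norm (flux p p' s A u z) powr p' \<le> (\<Lambda> * ?D powr (p - 1) * ?k) powr p'"
      using p by (intro powr_mono2) auto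
    also have "\<dots> = \<Lambda> powr p' * (?D powr p * norm (fst z - snd z) powr (-(real CARD('a) + s * p)))"
      using p pp order_trans[OF abs_ge_zero A] by (simp add: powr_mult powr_powr)
    finally show ?thesis .
  qed
  then have "(\<integral>\<^sup>+z. ennreal (norm (flux p p' s A u z) powr p') \<partial>lborel)
    \<le> (\<integral>\<^sup>+z. ennreal (\<Lambda> powr p') * ennreal (\<bar>projected_difference u (fst z) (snd z)\<bar> powr p
    * norm (fst z - snd z) powr (-(real CARD('a) + s * p))) \<partial>lborel)"
    by (intro nn_integral_mono) (simp add: ennreal_mult'[symmetric] ennreal_leI)
  also have "\<dots> = ennreal (\<Lambda> powr p') * projected_slobodeckij p s u"
    using p by (simp add: nn_integral_cmult projected_slobodeckij_pair)
  finally show ?thesis .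
qed

section \<open>Extension of the weak formulation\<close>

lemma integrable_pairing:
  fixes F G :: "'a \<Rightarrow> 'b::euclidean_space"
  assumes [measurable]: "F \<in> borel_measurable M" "G \<in> borel_measurable M"
    and ab: "a > 1" "b > 1" "1 / a + 1 / b = 1"
    and F: "(\<integral>\<^sup>+x. ennreal (norm (F x) powr a) \<partial>M) < \<infinity>"
    and G: "(\<integral>\<^sup>+x. ennreal (norm (G x) powr b) \<partial>M) < \<infinity>"
  shows "integrable M (\<lambda>x. F x \<bullet> G x)"
proof (rule integrableI_bounded)
  obtain X where X: "X \<ge> 0" "(\<integral>\<^sup>+x. ennreal (norm (F x) powr a) \<partial>M) = ennreal X"
    using F by (cases "\<integral>\<^sup>+x. ennreal (norm (F x) powr a) \<partial>M") auto
  obtain Y where Y: "Y \<ge> 0" "(\<integral>\<^sup>+x. ennreal (norm (G x) powr b) \<partial>M) = ennreal Y"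
    using G by (cases "\<integral>\<^sup>+x. ennreal (norm (G x) powr b) \<partial>M") auto
  have "(\<integral>\<^sup>+x. ennreal (norm (F x \<bullet> G x)) \<partial>M) \<le> (\<integral>\<^sup>+x. ennreal (norm (F x) * norm (G x)) \<partial>M)"
    by (intro nn_integral_mono ennreal_leI) (simp add: Cauchy_Schwarz_ineq2)
  also have "\<dots> \<le> ennreal (X powr (1 / a) * Y powr (1 / b))"
    by (rule nn_integral_Holder) (use ab X Y in auto)
  finally show "(\<integral>\<^sup>+x. ennreal (norm (F x \<bullet> G x)) \<partial>M) < \<infinity>"
    using le_less_trans ennreal_less_top by fastforce
qed measurable

text \<open>The mollified \<phi> is admissible, and both sides of its equation differ from those of
  \<phi> by an arbitrarily small amount. Since the mollification moves supports by at most r, only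
  test functions vanishing outside the ball of radius 2 r are needed; hence f may be replaced by 0
  outside that ball, and global integrability of f is no restriction.\<close>

lemma weak_formulation_extends:
  fixes A :: "real ^ 'n \<Rightarrow> real ^ 'n \<Rightarrow> real" and u f \<phi> :: "real ^ 'n \<Rightarrow> real ^ 'n"
    and \<psi> :: "real ^ 'n \<Rightarrow> real" and p p' s \<Lambda> q P r :: real
  assumes A[measurable]: "(\<lambda>z. A (fst z) (snd z)) \<in> borel_measurable borel" and A\<Lambda>: "\<And>x y. \<bar>A x y\<bar> \<le> \<Lambda>"
    and u[measurable]: "u \<in> borel_measurable borel" and ufin: "slobodeckij p s u < \<infinity>"
    and f[measurable]: "f \<in> borel_measurable borel" and fq: "(\<integral>\<^sup>+x. ennreal (norm (f x) powr q) \<partial>lborel) < \<infinity>"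
    and p: "p \<ge> 2" "1 / p + 1 / p' = 1" "p' > 1" and q: "q > 1" "P > 1" "1 / q + 1 / P = 1"
    and r: "r > 0" and \<psi>: "\<psi> \<in> test_functions (ball x1 r1)" "r1 > 0" "\<And>x. \<psi> x \<ge> 0"
    and nz: "(\<integral>\<^sup>+x. ennreal (\<psi> x) \<partial>lborel) \<noteq> 0"
    and \<phi>[measurable]: "\<phi> \<in> borel_measurable borel" and \<phi>z: "\<And>x. x \<notin> cball x0 r \<Longrightarrow> \<phi> x = 0"
    and \<phi>int: "integrable lborel \<phi>" and \<phi>fin: "slobodeckij p s \<phi> < \<infinity>"
    and \<phi>P: "(\<integral>\<^sup>+x. ennreal (norm (\<phi> x) powr P) \<partial>lborel) < \<infinity>"
    and weak: "\<And>\<phi>. \<phi> \<in> test_functions UNIV \<Longrightarrow> (\<And>x. x \<notin> cball x0 (2 * r) \<Longrightarrow> \<phi> x = 0) \<Longrightarrow>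
      (LINT z|lborel. nonlocal_integrand p s A u \<phi> z) = (LINT x|lborel. f x \<bullet> \<phi> x)"
  shows "integrable lborel (nonlocal_integrand p s A u \<phi>)"
    and "integrable lborel (\<lambda>x. f x \<bullet> \<phi> x)"
    and "(LINT z|lborel. nonlocal_integrand p s A u \<phi> z) = (LINT x|lborel. f x \<bullet> \<phi> x)"
proof -
  have ni: "nonlocal_integrand p s A u \<phi>' = (\<lambda>z. flux p p' s A u z \<bullet> weighted_difference p s \<phi>' z)" for \<phi>'
    using nonlocal_integrand_eq[OF p(2)] by blast
  have H: "(\<integral>\<^sup>+z. ennreal (norm (flux p p' s A u z) powr p') \<partial>lborel) < \<infinity>"
  proof -
    have "ennreal (\<Lambda> powr p') * projected_slobodeckij p s u < \<infinity>"
      using ufin projected_slobodeckij_le[OF u, of p s] p by (auto simp: ennreal_mult_less_top)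
    then show ?thesis using nn_integral_flux_le[OF A u A\<Lambda> p, of s] by (rule le_less_trans[rotated])
  qed
  have \<Phi>: "(\<integral>\<^sup>+z. ennreal (norm (weighted_difference p s \<phi> z) powr p) \<partial>lborel) < \<infinity>"
  proof -
    have p0: "p > 0" using p by simp
    show ?thesis
      unfolding nn_integral_weighted_difference[OF \<phi> p0]
      using projected_slobodeckij_le[OF \<phi> p0] \<phi>fin by (rule le_less_trans)
  qed
  have pp: "1 / p' + 1 / p = 1" "p > 1" using p by auto
  show 1: "integrable lborel (nonlocal_integrand p s A u \<phi>)"
    unfolding ni by (rule integrable_pairing[OF _ _ p(3) pp(2,1) H \<Phi>]) measurable
  show 2: "integrable lborel (\<lambda>x. f x \<bullet> \<phi> x)"
    by (rule integrable_pairing[OF _ _ q fq \<phi>P]) measurable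
  have close: "\<bar>(LINT z|lborel. nonlocal_integrand p s A u \<phi> z) - (LINT x|lborel. f x \<bullet> \<phi> x)\<bar> \<le> 2 * e"
    if e: "e > 0" for e
  proof -
    \<comment> \<open>The diagonal embedding: translating \<phi> by z translates its difference at
      (x, y) by (z, z).\<close>
    have lin: "linear (\<lambda>w::real^'n. (w, w))" by (intro linearI) auto
    obtain d1 where d1: "d1 > 0" and D1: "\<And>\<eta> :: real ^ 'n \<Rightarrow> real. \<eta> \<in> borel_measurable borel \<Longrightarrow> (\<And>z. \<eta> z \<ge> 0) \<Longrightarrow>
        (\<integral>\<^sup>+z. ennreal (\<eta> z) \<partial>lborel) = 1 \<Longrightarrow> (\<And>z. \<eta> z \<noteq> 0 \<Longrightarrow> norm z < d1) \<Longrightarrow>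
        (\<integral>\<^sup>+x. ennreal \<bar>flux p p' s A u x \<bullet> (LINT z|lborel. \<eta> z *\<^sub>R weighted_difference p s \<phi> (x - (z, z)))
          - flux p p' s A u x \<bullet> weighted_difference p s \<phi> x\<bar> \<partial>lborel) \<le> ennreal e"
      using mollified_pairing_close[OF flux_measurable[OF A u] weighted_difference_measurable[OF \<phi>] lin p(3) pp(2,1) H \<Phi> e]
      by blast
    obtain d2 where d2: "d2 > 0" and D2: "\<And>\<eta> :: real ^ 'n \<Rightarrow> real. \<eta> \<in> borel_measurable borel \<Longrightarrow> (\<And>z. \<eta> z \<ge> 0) \<Longrightarrow>
        (\<integral>\<^sup>+z. ennreal (\<eta> z) \<partial>lborel) = 1 \<Longrightarrow> (\<And>z. \<eta> z \<noteq> 0 \<Longrightarrow> norm z < d2) \<Longrightarrow>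
        (\<integral>\<^sup>+x. ennreal \<bar>f x \<bullet> (LINT z|lborel. \<eta> z *\<^sub>R \<phi> (x - z)) - f x \<bullet> \<phi> x\<bar> \<partial>lborel) \<le> ennreal e"
      using mollified_pairing_close[OF f \<phi> linear_ident q fq \<phi>P e] by blast
    \<comment> \<open>Small enough for both pairings; the bound by r keeps the support inside the
      ball of radius 2 r.\<close>
    define \<delta> where "\<delta> = min (min d1 d2) r"
    have \<delta>: "\<delta> > 0" using d1 d2 r by (simp add: \<delta>_def)
    obtain \<eta> :: "real ^ 'n \<Rightarrow> real" where \<eta>: "\<eta> \<in> test_functions UNIV" and [measurable]: "\<eta> \<in> borel_measurable borel"
      and \<eta>0: "\<And>z. \<eta> z \<ge> 0" and \<eta>1: "(\<integral>\<^sup>+z. ennreal (\<eta> z) \<partial>lborel) = 1" and \<eta>s: "\<And>z. \<eta> z \<noteq> 0 \<Longrightarrow> norm z < \<delta>"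
      using small_mollifier[OF \<psi>(1) \<psi>(3) nz \<psi>(2) \<delta>] by blast
    define \<phi>' where "\<phi>' x = (LINT z|lborel. \<eta> z *\<^sub>R \<phi> (x - z))" for x
    have \<phi>'m[measurable]: "\<phi>' \<in> borel_measurable borel" unfolding \<phi>'_def by measurable
    have test: "\<phi>' \<in> test_functions UNIV"
      unfolding \<phi>'_def by (rule convolution_test_function(1)[OF \<phi>int \<phi>z \<eta> \<eta>s])
    have "\<phi>' x = 0" if "x \<notin> cball x0 (2 * r)" for x
      unfolding \<phi>'_def
    proof (rule convolution_test_function(2)[OF \<phi>int \<phi>z \<eta> \<eta>s])
      show "x \<notin> cball x0 (r + \<delta>)" using that by (auto simp: \<delta>_def)
    qed
    from weak[OF test this]
    have eq: "(LINT z|lborel. nonlocal_integrand p s A u \<phi>' z) = (LINT x|lborel. f x \<bullet> \<phi>' x)" .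
    have \<eta>C: "\<forall>k. Ck k \<eta>" "compact (supp \<eta>)" using \<eta> by (auto simp: test_functions_def)
    obtain B where B: "B > 0" "\<And>x. norm (\<eta> x) \<le> B"
      using continuous_compact_supp_bounded[OF smooth_partial_derivative(4)[OF \<eta>C] \<eta>C(2)] by blast
    have conv_int: "integrable lborel (\<lambda>w. \<eta> w *\<^sub>R \<phi> (x - w))" for x
    proof (rule integrableI_bounded)
      have "(\<integral>\<^sup>+w. ennreal (norm (\<eta> w *\<^sub>R \<phi> (x - w))) \<partial>lborel) \<le> (\<integral>\<^sup>+w. ennreal B * ennreal (norm (\<phi> (x - w))) \<partial>lborel)"
        using B by (intro nn_integral_mono) (auto simp: ennreal_mult'[symmetric] intro!: ennreal_leI mult_right_mono)
      also have "\<dots> = ennreal B * (\<integral>\<^sup>+w. ennreal (norm (\<phi> w)) \<partial>lborel)"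
        using nn_integral_lborel_reflect[of "\<lambda>w. ennreal (norm (\<phi> w))" x] by (simp add: nn_integral_cmult)
      also have "\<dots> < \<infinity>" using \<phi>int by (simp add: ennreal_mult_less_top integrable_iff_bounded)
      finally show "(\<integral>\<^sup>+w. ennreal (norm (\<eta> w *\<^sub>R \<phi> (x - w))) \<partial>lborel) < \<infinity>" .
    qed measurable
    \<comment> \<open>The difference is linear in \<phi>, and the direction and the weight depend
      only on x - y, which diagonal translations preserve. Hence mollification commutes with forming
      weighted differences.\<close>
    have wd: "(LINT w|lborel. \<eta> w *\<^sub>R weighted_difference p s \<phi> (z - (w, w))) = weighted_difference p s \<phi>' z" for z
    proof -
      obtain x y where z: "z = (x, y)" by fastforce
      let ?k = "norm (x - y) powr (-((real CARD('n) + s * p) / p))" and ?v = "(x - y) /\<^sub>R norm (x - y)"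
      have "weighted_difference p s \<phi>' z = ((LINT w|lborel. \<eta> w *\<^sub>R \<phi> (x - w) - \<eta> w *\<^sub>R \<phi> (y - w)) \<bullet> ?v) * ?k"
        using conv_int by (simp add: weighted_difference_def z projected_difference_def \<phi>'_def)
      also have "\<dots> = (LINT w|lborel. ((\<eta> w *\<^sub>R \<phi> (x - w) - \<eta> w *\<^sub>R \<phi> (y - w)) \<bullet> ?v) * ?k)"
        using conv_int by simp
      also have "\<dots> = (LINT w|lborel. \<eta> w *\<^sub>R weighted_difference p s \<phi> (z - (w, w)))"
        by (intro Bochner_Integration.integral_cong)
          (auto simp: weighted_difference_def z projected_difference_def scaleR_diff_right[symmetric] simp del: scaleR_diff_right)
      finally show ?thesis by simp
    qed
    have "\<bar>(LINT z|lborel. nonlocal_integrand p s A u \<phi>' z) - (LINT z|lborel. nonlocal_integrand p s A u \<phi> z)\<bar> \<le> e"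
    proof (rule integral_diff_le_nn_integral[OF 1])
      show "(\<integral>\<^sup>+x. ennreal \<bar>nonlocal_integrand p s A u \<phi>' x - nonlocal_integrand p s A u \<phi> x\<bar> \<partial>lborel) \<le> ennreal e"
        using D1[of \<eta>] \<eta>0 \<eta>1 \<eta>s unfolding ni wd by (simp add: \<delta>_def)
    qed (use e ni in auto)
    moreover have "\<bar>(LINT x|lborel. f x \<bullet> \<phi>' x) - (LINT x|lborel. f x \<bullet> \<phi> x)\<bar> \<le> e"
    proof (rule integral_diff_le_nn_integral[OF 2])
      show "(\<integral>\<^sup>+x. ennreal \<bar>f x \<bullet> \<phi>' x - f x \<bullet> \<phi> x\<bar> \<partial>lborel) \<le> ennreal e"
        using D2[of \<eta>] \<eta>0 \<eta>1 \<eta>s by (simp add: \<delta>_def \<phi>'_def)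
    qed (use e in auto)
    ultimately show ?thesis using eq by linarith
  qed
  show "(LINT z|lborel. nonlocal_integrand p s A u \<phi> z) = (LINT x|lborel. f x \<bullet> \<phi> x)" (is "?l = ?r")
  proof (rule ccontr)
    assume "?l \<noteq> ?r"
    then have "\<bar>?l - ?r\<bar> / 4 > 0" by simp
    from close[OF this] show False using \<open>?l \<noteq> ?r\<close> by simp
  qed
qed

section \<open>Remainder terms of the Caccioppoli estimate\<close>

text \<open>No coercivity is extracted for such pairs: the left side is bounded by \<Lambda> *
  \<bar>a\<bar> powr p, which is simply added on the right. The left side is kept because Korn's
  inequality needs the seminorm over all pairs.\<close>

lemma energy_lower_bound_far_weighted:
  fixes a b p \<alpha> \<Lambda> A :: real
  assumes p: "p \<ge> 2" and A: "1 / \<Lambda> \<le> A" "A \<le> \<Lambda>" "\<Lambda> > 0" and \<alpha>: "0 \<le> \<alpha>" "\<alpha> \<le> 1"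
  shows "2 powr (-p-1) / \<Lambda> * \<bar>\<alpha> * a\<bar> powr p
    \<le> A * (\<bar>a - b\<bar> powr (p - 2) * (a - b) * (\<alpha> powr p * a)) + \<Lambda> * (\<bar>b\<bar> powr (p - 1) * \<bar>a\<bar> + \<bar>a\<bar> powr p)"
proof -
  have \<alpha>p: "0 \<le> \<alpha> powr p" "\<alpha> powr p \<le> 1" using \<alpha> p by (auto simp: powr_le1)
  have A0: "A > 0" using A by (meson divide_pos_pos less_le_trans zero_less_one)
  have "\<bar>\<alpha> * a\<bar> powr p \<le> \<bar>a\<bar> powr p"
    using \<alpha> p by (intro powr_mono2) (auto simp: abs_mult mult_left_le_one_le)
  moreover have "2 powr (-p-1) / \<Lambda> \<le> \<Lambda>"
  proof -
    have "2 powr (-p-1) \<le> (2::real) powr 0" using p by (intro powr_mono) auto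
    then have "2 powr (-p-1) / \<Lambda> \<le> 1 / \<Lambda>" using A by (intro divide_right_mono) auto
    then show ?thesis using A by linarith
  qed
  ultimately have 1: "2 powr (-p-1) / \<Lambda> * \<bar>\<alpha> * a\<bar> powr p \<le> \<Lambda> * \<bar>a\<bar> powr p"
    using A by (intro mult_mono) auto
  have "A * \<alpha> powr p \<le> A * 1" using \<alpha>p A0 by (intro mult_left_mono) auto
  then have c: "0 \<le> A * \<alpha> powr p" "A * \<alpha> powr p \<le> \<Lambda>"
    using \<alpha>p A A0 by (simp, linarith)
  have "A * \<alpha> powr p * - (\<bar>b\<bar> powr (p - 1) * \<bar>a\<bar>) \<le> A * \<alpha> powr p * (\<bar>a - b\<bar> powr (p - 2) * (a - b) * a)"
    using c by (intro mult_left_mono energy_lower_bound_far p) auto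
  moreover have "A * \<alpha> powr p * (\<bar>b\<bar> powr (p - 1) * \<bar>a\<bar>) \<le> \<Lambda> * (\<bar>b\<bar> powr (p - 1) * \<bar>a\<bar>)"
    using c by (intro mult_right_mono) auto
  ultimately have "- (\<Lambda> * (\<bar>b\<bar> powr (p - 1) * \<bar>a\<bar>)) \<le> A * \<alpha> powr p * (\<bar>a - b\<bar> powr (p - 2) * (a - b) * a)"
    by simp
  also have "\<dots> = A * (\<bar>a - b\<bar> powr (p - 2) * (a - b) * (\<alpha> powr p * a))" by (simp only: mult_ac)
  finally show ?thesis using 1 by (simp add: distrib_left)
qed

text \<open>Only the part with u at the second point. The symmetric part arises by exchanging x and
  y, so a single integral has to be estimated; \<open>far_remainder\<close> follows the same
  pattern.\<close>

definition near_remainder ::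
    "real \<Rightarrow> real \<Rightarrow> (real ^ 'n) set \<Rightarrow> (real ^ 'n \<Rightarrow> real) \<Rightarrow> (real ^ 'n \<Rightarrow> real ^ 'n) \<Rightarrow> real ^ 'n \<Rightarrow> real ^ 'n \<Rightarrow> real"
  where "near_remainder p \<beta> B \<psi> u x y =
    indicator B x * indicator B y * \<bar>\<psi> x - \<psi> y\<bar> powr p * norm (u y) powr p * norm (x - y) powr (-\<beta>)"

definition far_remainder ::
    "real \<Rightarrow> real \<Rightarrow> (real ^ 'n) set \<Rightarrow> (real ^ 'n) set \<Rightarrow> (real ^ 'n \<Rightarrow> real ^ 'n) \<Rightarrow> real ^ 'n \<Rightarrow> real ^ 'n \<Rightarrow> real"
  where "far_remainder p \<beta> B' B u x y = indicator B' x * indicator (- B) y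
    * (norm (u y) powr (p - 1) * norm (u x) + norm (u x) powr p) * norm (x - y) powr (-\<beta>)"

text \<open>The cut-off lives in B', inside B. If both points lie in B, the energy inequality with
  two cut-off values applies; if one lies in B' and the other outside B, one cut-off value is 0 and
  the far inequality applies; all other pairs contribute nothing to the energy.\<close>

lemma caccioppoli_pointwise:
  fixes u :: "real ^ 'n \<Rightarrow> real ^ 'n" and p s \<Lambda> :: real
  assumes p: "p \<ge> 2" and A: "\<And>x y. 1 / \<Lambda> \<le> A x y \<and> A x y \<le> \<Lambda>" and \<Lambda>: "\<Lambda> > 0"
    and \<psi>: "\<And>x. 0 \<le> \<psi> x \<and> \<psi> x \<le> 1" and supp: "\<And>x. \<psi> x \<noteq> 0 \<Longrightarrow> x \<in> B'" and BB: "B' \<subseteq> B"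
  defines "\<beta> \<equiv> real CARD('n) + s * p"
  shows "2 powr (-p-1) / \<Lambda> * (\<bar>projected_difference (\<lambda>x. \<psi> x *\<^sub>R u x) x y\<bar> powr p * norm (x - y) powr (-\<beta>))
    \<le> nonlocal_integrand p s A u (\<lambda>x. \<psi> x powr p *\<^sub>R u x) (x, y)
      + (\<Lambda> * ((2 * p) powr p + 1) * (near_remainder p \<beta> B \<psi> u x y + near_remainder p \<beta> B \<psi> u y x)
        + \<Lambda> * (far_remainder p \<beta> B' B u x y + far_remainder p \<beta> B' B u y x))"
proof -
  define e where "e = (x - y) /\<^sub>R norm (x - y)"
  define a b where "a = u x \<bullet> e" and "b = u y \<bullet> e"
  define k where "k = norm (x - y) powr (-\<beta>)"
  have k: "k \<ge> 0" by (simp add: k_def)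
  have e: "norm e \<le> 1" by (cases "x = y") (auto simp: e_def)
  have ab: "\<bar>a\<bar> \<le> norm (u x)" "\<bar>b\<bar> \<le> norm (u y)"
    unfolding a_def b_def using e by (metis Cauchy_Schwarz_ineq2 mult_left_le norm_ge_zero order_trans)+
  define Q where "Q = \<bar>a - b\<bar> powr (p - 2) * (a - b) * (\<psi> x powr p * a - \<psi> y powr p * b)"
  have pdw: "projected_difference (\<lambda>x. \<psi> x *\<^sub>R u x) x y = \<psi> x * a - \<psi> y * b"
    by (simp add: projected_difference_def a_def b_def e_def inner_diff_left right_diff_distrib)
  have pdu: "projected_difference u x y = a - b"
    by (simp add: projected_difference_def a_def b_def e_def inner_diff_left right_diff_distrib)
  have pdphi: "projected_difference (\<lambda>x. \<psi> x powr p *\<^sub>R u x) x y = \<psi> x powr p * a - \<psi> y powr p * b"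
    by (simp add: projected_difference_def a_def b_def e_def inner_diff_left right_diff_distrib)
  have I: "nonlocal_integrand p s A u (\<lambda>x. \<psi> x powr p *\<^sub>R u x) (x, y) = A x y * Q * k"
    unfolding nonlocal_integrand_def Q_def k_def fst_conv snd_conv \<beta>_def[symmetric] powr_minus_divide pdu pdphi
    by simp
  have near0: "near_remainder p \<beta> B \<psi> u x y \<ge> 0" "near_remainder p \<beta> B \<psi> u y x \<ge> 0"
    and far0: "far_remainder p \<beta> B' B u x y \<ge> 0" "far_remainder p \<beta> B' B u y x \<ge> 0"
    by (auto simp: near_remainder_def far_remainder_def intro!: mult_nonneg_nonneg add_nonneg_nonneg)
  have far_term: "\<Lambda> * (\<bar>b\<bar> powr (p - 1) * \<bar>a\<bar> + \<bar>a\<bar> powr p) * k \<le> \<Lambda> * ((norm (u y) powr (p - 1) * norm (u x) + norm (u x) powr p) * k)"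
    "\<Lambda> * (\<bar>a\<bar> powr (p - 1) * \<bar>b\<bar> + \<bar>b\<bar> powr p) * k \<le> \<Lambda> * ((norm (u x) powr (p - 1) * norm (u y) + norm (u y) powr p) * k)"
    unfolding mult.assoc using ab p \<Lambda> k
    by (auto intro!: mult_left_mono mult_right_mono add_mono mult_mono powr_mono2)
  let ?N = "\<Lambda> * ((2 * p) powr p + 1) * (near_remainder p \<beta> B \<psi> u x y + near_remainder p \<beta> B \<psi> u y x)"
  let ?F = "\<Lambda> * (far_remainder p \<beta> B' B u x y + far_remainder p \<beta> B' B u y x)"
  have N0: "?N \<ge> 0" using \<Lambda> near0 by (intro mult_nonneg_nonneg add_nonneg_nonneg) auto
  have F0: "?F \<ge> 0" using \<Lambda> far0 by (intro mult_nonneg_nonneg add_nonneg_nonneg) auto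
  have combine: "X \<le> Y + (N + F)" if "X \<le> Y + G" "G \<le> F" "N \<ge> 0" for X Y F G N :: real
    using that by linarith
  have "2 powr (-p-1) / \<Lambda> * (\<bar>\<psi> x * a - \<psi> y * b\<bar> powr p * k) \<le> A x y * Q * k + (?N + ?F)"
  proof -
    consider "x \<in> B" "y \<in> B" | "\<psi> x = 0" "\<psi> y = 0" | "x \<in> B'" "y \<notin> B" "\<psi> y = 0" | "y \<in> B'" "x \<notin> B" "\<psi> x = 0"
      using supp BB by blast
    then show ?thesis
    proof cases
      case 1
      define m where "m = 2 powr (-p-1) * \<bar>\<psi> x * a - \<psi> y * b\<bar> powr p"
      define M where "M = ((2 * p) powr p + 1) * \<bar>\<psi> x - \<psi> y\<bar> powr p * (\<bar>a\<bar> powr p + \<bar>b\<bar> powr p)"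
      have mM: "m - M \<le> Q" unfolding m_def M_def Q_def using p \<psi> by (intro energy_lower_bound) auto
      have m0: "m \<ge> 0" by (simp add: m_def)
      have M0: "M \<ge> 0" unfolding M_def by (intro mult_nonneg_nonneg add_nonneg_nonneg) auto
      have A0: "A x y \<ge> 0" using A[of x y] \<Lambda> by (meson divide_nonneg_pos order_trans zero_le_one)
      \<comment> \<open>The lower bound of A is used for the good term and the upper bound for the
        error, as both are nonnegative.\<close>
      have "m / \<Lambda> - \<Lambda> * M \<le> A x y * m - A x y * M"
        using A[of x y] m0 M0 mult_right_mono[of "1 / \<Lambda>" "A x y" m] mult_right_mono[of "A x y" \<Lambda> M] by simp
      also have "\<dots> \<le> A x y * Q" using mult_left_mono[OF mM A0] by (simp add: right_diff_distrib)
      finally have "(m / \<Lambda> - \<Lambda> * M) * k \<le> A x y * Q * k" using k by (rule mult_right_mono)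
      moreover have "\<Lambda> * M * k \<le> ?N"
      proof -
        have "near_remainder p \<beta> B \<psi> u x y + near_remainder p \<beta> B \<psi> u y x
            = \<bar>\<psi> x - \<psi> y\<bar> powr p * (norm (u x) powr p + norm (u y) powr p) * k"
          using 1 by (simp add: near_remainder_def k_def norm_minus_commute[of y x] abs_minus_commute[of "\<psi> y"] algebra_simps)
        moreover have "\<bar>a\<bar> powr p + \<bar>b\<bar> powr p \<le> norm (u x) powr p + norm (u y) powr p"
          using ab p by (intro add_mono powr_mono2) auto
        then have "\<Lambda> * ((2 * p) powr p + 1) * (\<bar>\<psi> x - \<psi> y\<bar> powr p * (\<bar>a\<bar> powr p + \<bar>b\<bar> powr p) * k)
          \<le> \<Lambda> * ((2 * p) powr p + 1) * (\<bar>\<psi> x - \<psi> y\<bar> powr p * (norm (u x) powr p + norm (u y) powr p) * k)"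
          using \<Lambda> k by (intro mult_left_mono mult_right_mono) auto
        ultimately show ?thesis unfolding M_def by (simp only: mult_ac)
      qed
      ultimately have "m / \<Lambda> * k \<le> A x y * Q * k + ?N" by (simp add: left_diff_distrib)
      then show ?thesis using F0 by (simp add: m_def mult_ac)
    next
      case 2
      then show ?thesis using N0 F0 p by (simp add: Q_def)
    next
      case 3
      have "2 powr (-p-1) / \<Lambda> * \<bar>\<psi> x * a\<bar> powr p
        \<le> A x y * (\<bar>a - b\<bar> powr (p - 2) * (a - b) * (\<psi> x powr p * a)) + \<Lambda> * (\<bar>b\<bar> powr (p - 1) * \<bar>a\<bar> + \<bar>a\<bar> powr p)"
        using A \<psi> p \<Lambda> by (intro energy_lower_bound_far_weighted) auto
      then have "2 powr (-p-1) / \<Lambda> * \<bar>\<psi> x * a\<bar> powr p * k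
        \<le> (A x y * (\<bar>a - b\<bar> powr (p - 2) * (a - b) * (\<psi> x powr p * a)) + \<Lambda> * (\<bar>b\<bar> powr (p - 1) * \<bar>a\<bar> + \<bar>a\<bar> powr p)) * k"
        using k by (rule mult_right_mono)
      moreover have "\<bar>a - b\<bar> powr (p - 2) * (a - b) * (\<psi> x powr p * a) = Q"
        using 3 p by (simp add: Q_def)
      ultimately have main: "2 powr (-p-1) / \<Lambda> * \<bar>\<psi> x * a\<bar> powr p * k
        \<le> A x y * Q * k + \<Lambda> * (\<bar>b\<bar> powr (p - 1) * \<bar>a\<bar> + \<bar>a\<bar> powr p) * k"
        by (simp only: distrib_right)
      have far: "\<Lambda> * (\<bar>b\<bar> powr (p - 1) * \<bar>a\<bar> + \<bar>a\<bar> powr p) * k \<le> ?F"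
      proof -
        have "far_remainder p \<beta> B' B u x y = (norm (u y) powr (p - 1) * norm (u x) + norm (u x) powr p) * k"
          using 3 by (simp add: far_remainder_def k_def)
        then have "\<Lambda> * (\<bar>b\<bar> powr (p - 1) * \<bar>a\<bar> + \<bar>a\<bar> powr p) * k \<le> \<Lambda> * far_remainder p \<beta> B' B u x y"
          using far_term(1) by simp
        also have "\<dots> \<le> ?F" using \<Lambda> far0 by (intro mult_left_mono) auto
        finally show ?thesis .
      qed
      from combine[OF main far N0] show ?thesis using 3 by (simp only: mult.assoc mult_zero_left diff_zero)
    next
      case 4
      have "2 powr (-p-1) / \<Lambda> * \<bar>\<psi> y * b\<bar> powr p
        \<le> A x y * (\<bar>b - a\<bar> powr (p - 2) * (b - a) * (\<psi> y powr p * b)) + \<Lambda> * (\<bar>a\<bar> powr (p - 1) * \<bar>b\<bar> + \<bar>b\<bar> powr p)"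
        using A \<psi> p \<Lambda> by (intro energy_lower_bound_far_weighted) auto
      then have "2 powr (-p-1) / \<Lambda> * \<bar>\<psi> y * b\<bar> powr p * k
        \<le> (A x y * (\<bar>b - a\<bar> powr (p - 2) * (b - a) * (\<psi> y powr p * b)) + \<Lambda> * (\<bar>a\<bar> powr (p - 1) * \<bar>b\<bar> + \<bar>b\<bar> powr p)) * k"
        using k by (rule mult_right_mono)
      moreover have "\<bar>b - a\<bar> powr (p - 2) * (b - a) * (\<psi> y powr p * b) = Q"
        using 4 p by (simp add: Q_def abs_minus_commute algebra_simps)
      ultimately have main: "2 powr (-p-1) / \<Lambda> * \<bar>\<psi> y * b\<bar> powr p * k
        \<le> A x y * Q * k + \<Lambda> * (\<bar>a\<bar> powr (p - 1) * \<bar>b\<bar> + \<bar>b\<bar> powr p) * k"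
        by (simp only: distrib_right)
      have far: "\<Lambda> * (\<bar>a\<bar> powr (p - 1) * \<bar>b\<bar> + \<bar>b\<bar> powr p) * k \<le> ?F"
      proof -
        have "far_remainder p \<beta> B' B u y x = (norm (u x) powr (p - 1) * norm (u y) + norm (u y) powr p) * k"
          using 4 by (simp add: far_remainder_def k_def norm_minus_commute)
        then have "\<Lambda> * (\<bar>a\<bar> powr (p - 1) * \<bar>b\<bar> + \<bar>b\<bar> powr p) * k \<le> \<Lambda> * far_remainder p \<beta> B' B u y x"
          using far_term(2) by simp
        also have "\<dots> \<le> ?F" using \<Lambda> far0 by (intro mult_left_mono) auto
        finally show ?thesis .
      qed
      from combine[OF main far N0] show ?thesis using 4
        by (simp only: mult.assoc mult_zero_left diff_0 abs_minus_cancel)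
    qed
  qed
  then show ?thesis unfolding I pdw k_def by simp
qed

section \<open>Integrals of the remainders\<close>

lemma nn_integral_lborel_swap:
  fixes G :: "'a::euclidean_space \<times> 'a \<Rightarrow> ennreal"
  assumes [measurable]: "G \<in> borel_measurable borel"
  shows "(\<integral>\<^sup>+z. G (snd z, fst z) \<partial>lborel) = (\<integral>\<^sup>+z. G z \<partial>lborel)"
proof -
  have [measurable]: "(\<lambda>z. G (snd z, fst z)) \<in> borel_measurable borel"
    by (rule measurable_compose[of "\<lambda>z. (snd z, fst z)" _ borel])
      (auto intro!: borel_measurable_continuous_onI continuous_intros)
  show ?thesis
    by (subst nn_integral_lborel_pair(1)) (auto simp: nn_integral_lborel_pair(2)[OF assms])
qed

text \<open>Two points of the ball are less than 2 r apart. The Lipschitz bound contributes r powr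
  (-p) and the kernel integral over radius 2 r contributes r powr (p - s p), together r powr (- s
  p).\<close>

lemma nn_integral_near_remainder_le:
  fixes p s L :: real
  assumes p: "p \<ge> 1" and s: "0 < s" "s < 1" and L: "L \<ge> 0"
  obtains C where "C > 0" and
    "\<And>(u :: real ^ 'n \<Rightarrow> real ^ 'n) \<psi> x0 r U. u \<in> borel_measurable borel \<Longrightarrow> \<psi> \<in> borel_measurable borel \<Longrightarrow> r > 0 \<Longrightarrow>
      (\<And>x y. \<bar>\<psi> x - \<psi> y\<bar> \<le> L / r * norm (x - y)) \<Longrightarrow> U \<ge> 0 \<Longrightarrow>
      (\<integral>\<^sup>+x. ennreal (norm (u x) powr p) * indicator (ball x0 r) x \<partial>lborel) = ennreal U \<Longrightarrow>
      (\<integral>\<^sup>+z. ennreal (near_remainder p (real CARD('n) + s * p) (ball x0 r) \<psi> u (fst z) (snd z)) \<partial>lborel)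
        \<le> ennreal (C * (r powr (- (s * p)) * U))"
proof -
  define \<beta> where "\<beta> = real CARD('n) + s * p"
  obtain K where K: "K > 0" "\<And>R x. R > 0 \<Longrightarrow> (\<integral>\<^sup>+y. ennreal (norm (y - x) powr p * norm (y - x) powr (-\<beta>))
      * indicator (ball x R) y \<partial>(lborel :: (real^'n) measure)) \<le> ennreal (K * R powr (p - s * p))"
    using nn_integral_lipschitz_kernel_near[of p s, where 'a="real^'n"] p s unfolding \<beta>_def by auto
  \<comment> \<open>The summand 1 keeps C positive when L = 0.\<close>
  define C where "C = L powr p * (K * 2 powr (p - s * p)) + 1"
  show thesis
  proof (rule that[of C])
    show "C > 0" using K by (simp add: C_def add_nonneg_pos)
    fix u :: "real ^ 'n \<Rightarrow> real ^ 'n" and \<psi> :: "real ^ 'n \<Rightarrow> real" and x0 and r U :: real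
    assume [measurable]: "u \<in> borel_measurable borel" "\<psi> \<in> borel_measurable borel" and r: "r > 0"
      and \<psi>: "\<And>x y. \<bar>\<psi> x - \<psi> y\<bar> \<le> L / r * norm (x - y)" and U: "U \<ge> 0"
      "(\<integral>\<^sup>+x. ennreal (norm (u x) powr p) * indicator (ball x0 r) x \<partial>lborel) = ennreal U"
    have "(\<integral>\<^sup>+z. ennreal (near_remainder p \<beta> (ball x0 r) \<psi> u (fst z) (snd z)) \<partial>lborel)
      = (\<integral>\<^sup>+y. \<integral>\<^sup>+x. ennreal (near_remainder p \<beta> (ball x0 r) \<psi> u x y) \<partial>lborel \<partial>lborel)"
      unfolding near_remainder_def by (subst nn_integral_lborel_pair(2)) auto
    also have "\<dots> \<le> (\<integral>\<^sup>+y. ennreal ((L / r) powr p) * (ennreal (norm (u y) powr p) * indicator (ball x0 r) y)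
        * (\<integral>\<^sup>+x. ennreal (norm (x - y) powr p * norm (x - y) powr (-\<beta>)) * indicator (ball y (2 * r)) x \<partial>lborel) \<partial>lborel)"
    proof (rule nn_integral_mono)
      fix y
      have "ennreal (near_remainder p \<beta> (ball x0 r) \<psi> u x y)
        \<le> ennreal ((L / r) powr p) * (ennreal (norm (u y) powr p) * indicator (ball x0 r) y)
          * (ennreal (norm (x - y) powr p * norm (x - y) powr (-\<beta>)) * indicator (ball y (2 * r)) x)" for x
      proof (cases "x \<in> ball x0 r \<and> y \<in> ball x0 r")
        case True
        have "dist y x < 2 * r" using True dist_triangle[of y x x0] by (auto simp: dist_commute)
        moreover have "\<bar>\<psi> x - \<psi> y\<bar> powr p \<le> (L / r) powr p * norm (x - y) powr p"
        proof -
          have "\<bar>\<psi> x - \<psi> y\<bar> powr p \<le> (L / r * norm (x - y)) powr p"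
            using \<psi>[of x y] p by (intro powr_mono2) auto
          also have "\<dots> = (L / r) powr p * norm (x - y) powr p"
            by (rule powr_mult)
          finally show ?thesis .
        qed
        then have "\<bar>\<psi> x - \<psi> y\<bar> powr p * (norm (u y) powr p * norm (x - y) powr (-\<beta>))
          \<le> (L / r) powr p * norm (x - y) powr p * (norm (u y) powr p * norm (x - y) powr (-\<beta>))"
          by (rule mult_right_mono) simp
        ultimately show ?thesis using True
          by (simp add: near_remainder_def ennreal_mult'[symmetric] ennreal_leI mult_ac)
      next
        case False
        then have "near_remainder p \<beta> (ball x0 r) \<psi> u x y = 0" by (auto simp: near_remainder_def)
        then show ?thesis by simp
      qed
      then have "(\<integral>\<^sup>+x. ennreal (near_remainder p \<beta> (ball x0 r) \<psi> u x y) \<partial>lborel)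
        \<le> (\<integral>\<^sup>+x. ennreal ((L / r) powr p) * (ennreal (norm (u y) powr p) * indicator (ball x0 r) y)
          * (ennreal (norm (x - y) powr p * norm (x - y) powr (-\<beta>)) * indicator (ball y (2 * r)) x) \<partial>lborel)"
        by (rule nn_integral_mono)
      also have "\<dots> = ennreal ((L / r) powr p) * (ennreal (norm (u y) powr p) * indicator (ball x0 r) y)
          * (\<integral>\<^sup>+x. ennreal (norm (x - y) powr p * norm (x - y) powr (-\<beta>)) * indicator (ball y (2 * r)) x \<partial>lborel)"
        by (rule nn_integral_cmult) measurable
      finally show "(\<integral>\<^sup>+x. ennreal (near_remainder p \<beta> (ball x0 r) \<psi> u x y) \<partial>lborel) \<le> \<dots>" .
    qed
    also have "\<dots> \<le> (\<integral>\<^sup>+y. ennreal ((L / r) powr p) * (ennreal (norm (u y) powr p) * indicator (ball x0 r) y)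
        * ennreal (K * (2 * r) powr (p - s * p)) \<partial>lborel)"
      using r by (intro nn_integral_mono mult_left_mono K) auto
    also have "\<dots> = ennreal ((L / r) powr p) * ennreal U * ennreal (K * (2 * r) powr (p - s * p))"
      by (simp add: nn_integral_multc nn_integral_cmult U)
    also have "\<dots> = ennreal ((L / r) powr p * U * (K * (2 * r) powr (p - s * p)))"
      using U K by (simp add: ennreal_mult'[symmetric])
    also have "\<dots> \<le> ennreal (C * (r powr (- (s * p)) * U))"
    proof (rule ennreal_leI)
      have e1: "(L / r) powr p = L powr p * r powr (- p)"
        using L r by (simp add: powr_divide powr_minus_divide)
      have e2: "(2 * r) powr (p - s * p) = 2 powr (p - s * p) * (r powr p * r powr (- (s * p)))"
        using r by (simp add: powr_mult powr_add[symmetric])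
      have e3: "r powr (- p) * r powr p = 1" using r by (simp add: powr_add[symmetric])
      have "(L / r) powr p * U * (K * (2 * r) powr (p - s * p))
          = (r powr (- p) * r powr p) * ((L powr p * (K * 2 powr (p - s * p))) * (r powr (- (s * p)) * U))"
        unfolding e1 e2 by (simp only: mult_ac)
      also have "\<dots> = (L powr p * (K * 2 powr (p - s * p))) * (r powr (- (s * p)) * U)"
        unfolding e3 by simp
      also have "\<dots> \<le> C * (r powr (- (s * p)) * U)"
        using U by (intro mult_right_mono) (auto simp: C_def)
      finally show "(L / r) powr p * U * (K * (2 * r) powr (p - s * p)) \<le> C * (r powr (- (s * p)) * U)" .
    qed
    finally show "(\<integral>\<^sup>+z. ennreal (near_remainder p (real CARD('n) + s * p) (ball x0 r) \<psi> u (fst z) (snd z)) \<partial>lborel)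
        \<le> ennreal (C * (r powr (- (s * p)) * U))"
      by (simp add: \<beta>_def)
  qed
qed

text \<open>The gap between the half ball and the complement is used twice. In the mixed term the
  kernel may be centred at x0 instead of x, at the cost of 2 powr \<beta>, so the double integral
  factorises into T and V. In the pure term y stays at distance at least r / 2 from x, and the
  kernel integral is of order r powr (- s p).\<close>

lemma nn_integral_far_remainder_le:
  fixes p s :: real
  assumes p: "p \<ge> 1" and s: "0 < s"
  obtains C where "C > 0" and
    "\<And>(u :: real ^ 'n \<Rightarrow> real ^ 'n) x0 r U V T. u \<in> borel_measurable borel \<Longrightarrow> r > 0 \<Longrightarrow>
      U \<ge> 0 \<Longrightarrow> (\<integral>\<^sup>+x. ennreal (norm (u x) powr p) * indicator (ball x0 r) x \<partial>lborel) = ennreal U \<Longrightarrow>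
      V \<ge> 0 \<Longrightarrow> (\<integral>\<^sup>+x. ennreal (norm (u x)) * indicator (ball x0 r) x \<partial>lborel) = ennreal V \<Longrightarrow>
      T \<ge> 0 \<Longrightarrow> (\<integral>\<^sup>+y. ennreal (norm (u y) powr (p - 1) * norm (x0 - y) powr (- (real CARD('n) + s * p)))
        * indicator (- ball x0 r) y \<partial>lborel) = ennreal T \<Longrightarrow>
      (\<integral>\<^sup>+z. ennreal (far_remainder p (real CARD('n) + s * p) (ball x0 (r / 2)) (ball x0 r) u (fst z) (snd z)) \<partial>lborel)
        \<le> ennreal (C * (r powr (- (s * p)) * U + T * V))"
proof -
  define \<beta> where "\<beta> = real CARD('n) + s * p"
  have \<beta>: "\<beta> > 0" using p s by (simp add: \<beta>_def add_nonneg_pos)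
  obtain K where K: "K > 0" "\<And>R x. R > 0 \<Longrightarrow> (\<integral>\<^sup>+y. ennreal (norm (y - x) powr (-\<beta>))
      * indicator (- ball x R) y \<partial>(lborel :: (real^'n) measure)) \<le> ennreal (K * R powr (- (s * p)))"
    using nn_integral_kernel_far[of p s, where 'a="real^'n"] p s unfolding \<beta>_def by auto
  define C where "C = K * 2 powr (s * p) + 2 powr \<beta>"
  show thesis
  proof (rule that[of C])
    show "C > 0" using K by (simp add: C_def add_pos_pos)
    fix u :: "real ^ 'n \<Rightarrow> real ^ 'n" and x0 and r U V T :: real
    assume [measurable]: "u \<in> borel_measurable borel" and r: "r > 0"
      and U: "U \<ge> 0" "(\<integral>\<^sup>+x. ennreal (norm (u x) powr p) * indicator (ball x0 r) x \<partial>lborel) = ennreal U"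
      and V: "V \<ge> 0" "(\<integral>\<^sup>+x. ennreal (norm (u x)) * indicator (ball x0 r) x \<partial>lborel) = ennreal V"
      and T: "T \<ge> 0" "(\<integral>\<^sup>+y. ennreal (norm (u y) powr (p - 1) * norm (x0 - y) powr (- (real CARD('n) + s * p)))
        * indicator (- ball x0 r) y \<partial>lborel) = ennreal T"
    let ?t = "\<lambda>y. ennreal (norm (u y) powr (p - 1) * norm (x0 - y) powr (-\<beta>)) * indicator (- ball x0 r) y"
    have "(\<integral>\<^sup>+z. ennreal (far_remainder p \<beta> (ball x0 (r / 2)) (ball x0 r) u (fst z) (snd z)) \<partial>lborel)
      = (\<integral>\<^sup>+x. \<integral>\<^sup>+y. ennreal (far_remainder p \<beta> (ball x0 (r / 2)) (ball x0 r) u x y) \<partial>lborel \<partial>lborel)"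
      unfolding far_remainder_def by (subst nn_integral_lborel_pair(1)) auto
    also have "\<dots> \<le> (\<integral>\<^sup>+x. \<integral>\<^sup>+y.
        ennreal (2 powr \<beta>) * (ennreal (norm (u x)) * indicator (ball x0 r) x) * ?t y
        + (ennreal (norm (u x) powr p) * indicator (ball x0 r) x)
          * (ennreal (norm (y - x) powr (-\<beta>)) * indicator (- ball x (r / 2)) y) \<partial>lborel \<partial>lborel)"
    proof (intro nn_integral_mono)
      fix x y
      show "ennreal (far_remainder p \<beta> (ball x0 (r / 2)) (ball x0 r) u x y)
        \<le> ennreal (2 powr \<beta>) * (ennreal (norm (u x)) * indicator (ball x0 r) x) * ?t y
        + (ennreal (norm (u x) powr p) * indicator (ball x0 r) x)
          * (ennreal (norm (y - x) powr (-\<beta>)) * indicator (- ball x (r / 2)) y)"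
      proof (cases "x \<in> ball x0 (r / 2) \<and> y \<notin> ball x0 r")
        case True
        then have d: "dist x0 x < r / 2" "dist x0 y \<ge> r" by auto
        have tri: "dist x0 y \<le> dist x0 x + dist x y" by (rule dist_triangle)
        have xB: "x \<in> ball x0 r" and yB: "y \<notin> ball x (r / 2)"
          using d tri r by (auto simp: dist_commute)
        \<comment> \<open>As dist x0 x < r / 2 \<le> dist x0 y / 2, the triangle inequality leaves
          at least half of dist x0 y for dist x y.\<close>
        have "norm (x0 - y) \<le> 2 * norm (x - y)" "norm (x0 - y) > 0"
          using d tri r by (auto simp: dist_norm[symmetric])
        then have "norm (x - y) powr (-\<beta>) \<le> (norm (x0 - y) / 2) powr (-\<beta>)"
          using \<beta> by (intro powr_mono2') auto
        also have "\<dots> = 2 powr \<beta> * norm (x0 - y) powr (-\<beta>)"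
          by (simp add: powr_divide powr_minus divide_simps)
        finally have "norm (u y) powr (p - 1) * norm (u x) * norm (x - y) powr (-\<beta>)
          \<le> norm (u y) powr (p - 1) * norm (u x) * (2 powr \<beta> * norm (x0 - y) powr (-\<beta>))"
          by (rule mult_left_mono) simp
        then have "far_remainder p \<beta> (ball x0 (r / 2)) (ball x0 r) u x y
          \<le> 2 powr \<beta> * norm (u x) * (norm (u y) powr (p - 1) * norm (x0 - y) powr (-\<beta>)) + norm (u x) powr p * norm (y - x) powr (-\<beta>)"
          using True by (simp add: far_remainder_def norm_minus_commute[of y x] algebra_simps)
        then show ?thesis using True xB yB
          by (simp add: ennreal_mult'[symmetric] ennreal_plus[symmetric] ennreal_leI del: ennreal_plus)
      next
        case False
        then have "far_remainder p \<beta> (ball x0 (r / 2)) (ball x0 r) u x y = 0" by (auto simp: far_remainder_def)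
        then show ?thesis by simp
      qed
    qed
    also have "\<dots> = (\<integral>\<^sup>+x. ennreal (2 powr \<beta>) * (ennreal (norm (u x)) * indicator (ball x0 r) x) * ennreal T
        + (ennreal (norm (u x) powr p) * indicator (ball x0 r) x)
          * (\<integral>\<^sup>+y. ennreal (norm (y - x) powr (-\<beta>)) * indicator (- ball x (r / 2)) y \<partial>lborel) \<partial>lborel)"
      using T(2) by (intro nn_integral_cong) (simp add: nn_integral_add nn_integral_cmult \<beta>_def)
    also have "\<dots> \<le> (\<integral>\<^sup>+x. ennreal (2 powr \<beta>) * (ennreal (norm (u x)) * indicator (ball x0 r) x) * ennreal T
        + (ennreal (norm (u x) powr p) * indicator (ball x0 r) x) * ennreal (K * (r / 2) powr (- (s * p))) \<partial>lborel)"
      using r by (intro nn_integral_mono add_left_mono mult_left_mono K) auto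
    also have "\<dots> = ennreal (2 powr \<beta>) * ennreal V * ennreal T + ennreal U * ennreal (K * (r / 2) powr (- (s * p)))"
      by (simp add: nn_integral_add nn_integral_multc nn_integral_cmult U V)
    also have "\<dots> = ennreal (2 powr \<beta> * V * T + U * (K * (r / 2) powr (- (s * p))))"
      using U V T K by (simp add: ennreal_mult'[symmetric] ennreal_plus[symmetric] del: ennreal_plus)
    also have "\<dots> \<le> ennreal (C * (r powr (- (s * p)) * U + T * V))"
    proof (rule ennreal_leI)
      have "(r / 2) powr (- (s * p)) = r powr (- (s * p)) * 2 powr (s * p)"
        using r by (simp add: powr_divide powr_minus divide_simps)
      then have "2 powr \<beta> * V * T + U * (K * (r / 2) powr (- (s * p)))
          = 2 powr \<beta> * (T * V) + (K * 2 powr (s * p)) * (r powr (- (s * p)) * U)"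
        by (simp add: mult_ac)
      also have "\<dots> \<le> C * (T * V) + C * (r powr (- (s * p)) * U)"
        using U V T K by (intro add_mono mult_right_mono) (auto simp: C_def)
      finally show "2 powr \<beta> * V * T + U * (K * (r / 2) powr (- (s * p))) \<le> C * (r powr (- (s * p)) * U + T * V)"
        by (simp add: algebra_simps)
    qed
    finally show "(\<integral>\<^sup>+z. ennreal (far_remainder p (real CARD('n) + s * p) (ball x0 (r / 2)) (ball x0 r) u (fst z) (snd z)) \<partial>lborel)
        \<le> ennreal (C * (r powr (- (s * p)) * U + T * V))"
      by (simp add: \<beta>_def)
  qed
qed

text \<open>Settles the degenerate case of a cut-off that vanishes almost everywhere, from which no
  mollifier can be made.\<close>

lemma slobodeckij_AE_zero:
  fixes u :: "'a::euclidean_space \<Rightarrow> 'b::euclidean_space"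
  assumes [measurable]: "u \<in> borel_measurable borel" and z: "(\<integral>\<^sup>+x. ennreal (norm (u x)) \<partial>lborel) = 0" and p: "p > 0"
  shows "slobodeckij p s u = 0"
proof -
  have "(\<integral>\<^sup>+x. ennreal (norm (u (x + h) - u x) powr p * norm h powr (-(real DIM('a) + s * p))) \<partial>lborel) = 0" for h
  proof -
    have "(\<integral>\<^sup>+x. ennreal (norm (u (x + h))) \<partial>lborel) = 0"
      using z nn_integral_lborel_shift[of "\<lambda>x. ennreal (norm (u x))" h] by simp
    then have "AE x in lborel. u (x + h) = 0" by (subst (asm) nn_integral_0_iff_AE) auto
    moreover have "AE x in lborel. u x = 0" using z by (subst (asm) nn_integral_0_iff_AE) auto
    ultimately show ?thesis
      by (subst nn_integral_0_iff_AE) (auto elim!: AE_mp simp: p)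
  qed
  then show ?thesis by (simp add: slobodeckij_def)
qed

section \<open>The Caccioppoli estimate for Borel data\<close>

text \<open>Everything follows from 1 / q = 1 / p' + s / d and 1 / P = 1 / p - s / d. The value of
  p' / q later produces the power r powr (d + s p'), and the last identity says that the L^P norm
  scales like the seminorm.\<close>

lemma conjugate_exponents:
  fixes d p p' s q P :: real
  assumes p: "p \<ge> 2" "1 / p + 1 / p' = 1" and s: "0 < s" "s * p < d"
    and q: "q = lower_star_exponent d s p'" and P: "P = d * p / (d - s * p)"
  shows "p' > 1" "q > 1" "P > 1" "1 / q + 1 / P = 1" "p' / q = 1 + s * p' / d" "d / (d - s * p) / P = 1 / p"
proof -
  have d: "d > 0" using s p mult_pos_pos[of s p] by linarith
  have e: "1 / p' = (p - 1) / p" using p by (simp add: field_simps)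
  then have "p' = p / (p - 1)" using p by (metis inverse_divide inverse_eq_divide inverse_inverse_eq)
  then show p': "p' > 1" using p by simp
  have q': "1 / q = 1 / p' + s / d"
    using d p' s by (simp add: q lower_star_exponent_def field_simps)
  have P': "1 / P = 1 / p - s / d" using d p s by (simp add: P field_simps)
  show 1: "1 / q + 1 / P = 1" using p(2) by (simp add: q' P')
  have "1 / P > 0" using d p s by (simp add: P)
  moreover have "1 / q > 0" using d p' s by (simp add: q' add_pos_pos)
  ultimately have "1 / q < 1" "1 / P < 1" "q > 0" "P > 0" using 1 by (linarith, linarith, simp_all)
  then show "q > 1" "P > 1" by simp_all
  have "p' / q = p' * (1 / q)" by simp
  also have "\<dots> = 1 + s * p' / d" unfolding q' using p' by (simp add: distrib_left)
  finally show "p' / q = 1 + s * p' / d" .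
  show "d / (d - s * p) / P = 1 / p" using d p s by (simp add: P)
qed

text \<open>Young's inequality with the weight l = (c / 2) powr (1 / p), chosen so that the power of
  X becomes c / 2 * X, half of the left side.\<close>

lemma absorb_powr:
  fixes c G N X M p p' :: real
  assumes p: "p > 1" "p' > 1" "1 / p + 1 / p' = 1" and pos: "c > 0" "G \<ge> 0" "N \<ge> 0" "X \<ge> 0"
    and le: "c * X \<le> N * G * X powr (1 / p) + M"
  shows "c / 2 * X \<le> (G / (c / 2) powr (1 / p)) powr p' * N powr p' + M"
proof -
  define l where "l = (c / 2) powr (1 / p)"
  have l: "l > 0" using pos by (simp add: l_def)
  have lp: "l powr p = c / 2" using pos p by (simp add: l_def powr_powr)
  have "(l * X powr (1 / p)) * (G / l * N) \<le> (l * X powr (1 / p)) powr p / p + (G / l * N) powr p' / p'"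
    using p pos l by (intro Youngs_inequality) auto
  also have "(l * X powr (1 / p)) powr p = c / 2 * X"
    using l p pos by (simp add: powr_mult powr_powr lp)
  also have "c / 2 * X / p \<le> c / 2 * X"
  proof -
    have "c / 2 * X * 1 \<le> c / 2 * X * p"
      using pos p by (intro mult_left_mono mult_nonneg_nonneg) auto
    then show ?thesis using p by (simp add: divide_le_eq)
  qed
  also have "(G / l * N) powr p' / p' \<le> (G / l * N) powr p'"
    using p by (simp add: divide_le_eq mult_le_cancel_left1)
  also have "(G / l * N) powr p' = (G / l) powr p' * N powr p'" by (rule powr_mult)
  finally have "(l * X powr (1 / p)) * (G / l * N) \<le> c / 2 * X + (G / l) powr p' * N powr p'" by simp
  moreover have "(l * X powr (1 / p)) * (G / l * N) = N * G * X powr (1 / p)" using l by simp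
  ultimately show ?thesis using le by (simp add: l_def)
qed

text \<open>The unknown is the projected seminorm X of \<psi> u. The energy bounds it from below up
  to remainders, while Hoelder, Sobolev and Korn bound the force term by a multiple of F powr (1 /
  q) * X powr (1 / p). As p > 1, the latter is absorbed, and a last application of Korn turns X into
  the full seminorm.\<close>

lemma caccioppoli_borel:
  fixes p p' s q \<Lambda> L :: real
  assumes p: "p \<ge> 2" "1 / p + 1 / p' = 1" and s: "0 < s" "s < 1" "s * p < real CARD('n::finite)"
    and q: "q = lower_star_exponent (real CARD('n)) s p'" and \<Lambda>: "\<Lambda> > 0" and L: "L \<ge> 0"
  obtains C where "C > 0" and
    "\<And>(A :: real ^ 'n \<Rightarrow> real ^ 'n \<Rightarrow> real) f u x0 r \<psi> U V T F.
      (\<lambda>z. A (fst z) (snd z)) \<in> borel_measurable borel \<Longrightarrow> (\<And>x y. 1 / \<Lambda> \<le> A x y \<and> A x y \<le> \<Lambda>) \<Longrightarrow>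
      f \<in> borel_measurable borel \<Longrightarrow> (\<integral>\<^sup>+x. ennreal (norm (f x) powr q) \<partial>lborel) < \<infinity> \<Longrightarrow>
      u \<in> borel_measurable borel \<Longrightarrow> (\<integral>\<^sup>+x. ennreal (norm (u x) powr p) \<partial>lborel) < \<infinity> \<Longrightarrow>
      slobodeckij p s u < \<infinity> \<Longrightarrow> r > 0 \<Longrightarrow>
      (\<And>\<phi>. \<phi> \<in> test_functions UNIV \<Longrightarrow> (\<And>x. x \<notin> cball x0 (2 * r) \<Longrightarrow> \<phi> x = 0) \<Longrightarrow>
        (LINT z|lborel. nonlocal_integrand p s A u \<phi> z) = (LINT x|lborel. f x \<bullet> \<phi> x)) \<Longrightarrow>
      \<psi> \<in> test_functions (ball x0 r) \<Longrightarrow> (\<And>x. 0 \<le> \<psi> x \<and> \<psi> x \<le> 1) \<Longrightarrow>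
      supp \<psi> \<subseteq> ball x0 (r / 2) \<Longrightarrow> (\<And>x y. \<bar>\<psi> x - \<psi> y\<bar> \<le> L / r * norm (x - y)) \<Longrightarrow>
      U \<ge> 0 \<Longrightarrow> (\<integral>\<^sup>+x. ennreal (norm (u x) powr p) * indicator (ball x0 r) x \<partial>lborel) = ennreal U \<Longrightarrow>
      V \<ge> 0 \<Longrightarrow> (\<integral>\<^sup>+x. ennreal (norm (u x)) * indicator (ball x0 r) x \<partial>lborel) = ennreal V \<Longrightarrow>
      T \<ge> 0 \<Longrightarrow> (\<integral>\<^sup>+y. ennreal (norm (u y) powr (p - 1) * norm (x0 - y) powr (- (real CARD('n) + s * p)))
        * indicator (- ball x0 r) y \<partial>lborel) = ennreal T \<Longrightarrow>
      F \<ge> 0 \<Longrightarrow> (\<integral>\<^sup>+x. ennreal (norm (f x) powr q) * indicator (ball x0 r) x \<partial>lborel) = ennreal F \<Longrightarrow>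
      slobodeckij p s (\<lambda>x. \<psi> x *\<^sub>R u x) \<le> ennreal (C * (r powr (- (s * p)) * U + T * V + F powr (p' / q)))"
proof -
  define d where "d = real CARD('n)"
  define \<beta> where "\<beta> = d + s * p"
  define P where "P = d * p / (d - s * p)"
  have sd: "s * p < d" using s by (simp add: d_def)
  note ex = conjugate_exponents[OF p s(1) sd q[folded d_def] P_def]
  obtain CK where CK: "CK > 0" and korn: "\<And>u :: real ^ 'n \<Rightarrow> real ^ 'n. u \<in> borel_measurable borel \<Longrightarrow>
      slobodeckij p s u < \<infinity> \<Longrightarrow> slobodeckij p s u \<le> ennreal CK * projected_slobodeckij p s u"
    using fractional_korn[of p s, where 'a="real^'n"] p s by auto
  obtain CS where CS: "CS > 0" and sob: "\<And>(u :: real ^ 'n \<Rightarrow> real ^ 'n) \<omega>. u \<in> borel_measurable borel \<Longrightarrow>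
      (\<integral>\<^sup>+x. ennreal (norm (u x) powr p) \<partial>lborel) < \<infinity> \<Longrightarrow> \<omega> \<ge> 0 \<Longrightarrow> slobodeckij p s u \<le> ennreal \<omega> \<Longrightarrow>
      (\<integral>\<^sup>+x. ennreal (norm (u x) powr P) \<partial>lborel) \<le> ennreal (CS * \<omega> powr (d / (d - s * p)))"
    using fractional_sobolev_inequality[of p s, where 'a="real^'n" and 'b="real^'n"] p s
    by (auto simp: P_def d_def)
  obtain CN where CN: "CN > 0" and near:
    "\<And>(u :: real ^ 'n \<Rightarrow> real ^ 'n) \<psi> x0 r U. u \<in> borel_measurable borel \<Longrightarrow> \<psi> \<in> borel_measurable borel \<Longrightarrow> r > 0 \<Longrightarrow>
      (\<And>x y. \<bar>\<psi> x - \<psi> y\<bar> \<le> L / r * norm (x - y)) \<Longrightarrow> U \<ge> 0 \<Longrightarrow>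
      (\<integral>\<^sup>+x. ennreal (norm (u x) powr p) * indicator (ball x0 r) x \<partial>lborel) = ennreal U \<Longrightarrow>
      (\<integral>\<^sup>+z. ennreal (near_remainder p \<beta> (ball x0 r) \<psi> u (fst z) (snd z)) \<partial>lborel)
        \<le> ennreal (CN * (r powr (- (s * p)) * U))"
    using nn_integral_near_remainder_le[of p s L, where 'n='n] p s L unfolding \<beta>_def d_def by auto
  obtain CF where CF: "CF > 0" and far:
    "\<And>(u :: real ^ 'n \<Rightarrow> real ^ 'n) x0 r U V T. u \<in> borel_measurable borel \<Longrightarrow> r > 0 \<Longrightarrow>
      U \<ge> 0 \<Longrightarrow> (\<integral>\<^sup>+x. ennreal (norm (u x) powr p) * indicator (ball x0 r) x \<partial>lborel) = ennreal U \<Longrightarrow>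
      V \<ge> 0 \<Longrightarrow> (\<integral>\<^sup>+x. ennreal (norm (u x)) * indicator (ball x0 r) x \<partial>lborel) = ennreal V \<Longrightarrow>
      T \<ge> 0 \<Longrightarrow> (\<integral>\<^sup>+y. ennreal (norm (u y) powr (p - 1) * norm (x0 - y) powr (- \<beta>))
        * indicator (- ball x0 r) y \<partial>lborel) = ennreal T \<Longrightarrow>
      (\<integral>\<^sup>+z. ennreal (far_remainder p \<beta> (ball x0 (r / 2)) (ball x0 r) u (fst z) (snd z)) \<partial>lborel)
        \<le> ennreal (CF * (r powr (- (s * p)) * U + T * V))"
    using nn_integral_far_remainder_le[of p s, where 'n='n] p s unfolding \<beta>_def d_def by auto
  define c0 where "c0 = 2 powr (-p-1) / \<Lambda>"
  have c0: "c0 > 0" using \<Lambda> by (simp add: c0_def)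
  define a1 where "a1 = \<Lambda> * ((2 * p) powr p + 1)"
  have a1: "a1 \<ge> 0" using \<Lambda> by (simp add: a1_def add_nonneg_nonneg)
  \<comment> \<open>Each remainder occurs twice, once with the points exchanged.\<close>
  define CM where "CM = 2 * a1 * CN + 2 * \<Lambda> * CF"
  define G where "G = CS powr (1 / P) * CK powr (1 / p)"
  define G' where "G' = (G / (c0 / 2) powr (1 / p)) powr p'"
  have CM: "CM \<ge> 0" using a1 CN CF \<Lambda> by (simp add: CM_def add_nonneg_nonneg)
  have G0: "G \<ge> 0" "G' \<ge> 0" by (simp_all add: G_def G'_def)
  define C where "C = CK * (2 / c0) * (CM + G') + 1"
  have C: "C > 0" using CK c0 CM G0 by (simp add: C_def add_nonneg_pos)
  have main: "slobodeckij p s (\<lambda>x. \<psi> x *\<^sub>R u x) \<le> ennreal (C * (r powr (- (s * p)) * U + T * V + F powr (p' / q)))"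
    if A[measurable]: "(\<lambda>z. A (fst z) (snd z)) \<in> borel_measurable borel" and Ab: "\<And>x y. 1 / \<Lambda> \<le> A x y \<and> A x y \<le> \<Lambda>"
      and f[measurable]: "f \<in> borel_measurable borel" and fq: "(\<integral>\<^sup>+x. ennreal (norm (f x) powr q) \<partial>lborel) < \<infinity>"
      and u[measurable]: "u \<in> borel_measurable borel" and uLp: "(\<integral>\<^sup>+x. ennreal (norm (u x) powr p) \<partial>lborel) < \<infinity>"
      and ufin: "slobodeckij p s u < \<infinity>" and r: "r > 0"
      and weak: "\<And>\<phi>. \<phi> \<in> test_functions UNIV \<Longrightarrow> (\<And>x. x \<notin> cball x0 (2 * r) \<Longrightarrow> \<phi> x = 0) \<Longrightarrow>
        (LINT z|lborel. nonlocal_integrand p s A u \<phi> z) = (LINT x|lborel. f x \<bullet> \<phi> x)"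
      and \<psi>t: "\<psi> \<in> test_functions (ball x0 r)" and \<psi>b: "\<And>x. 0 \<le> \<psi> x \<and> \<psi> x \<le> 1"
      and \<psi>s: "supp \<psi> \<subseteq> ball x0 (r / 2)" and \<psi>L: "\<And>x y. \<bar>\<psi> x - \<psi> y\<bar> \<le> L / r * norm (x - y)"
      and U: "U \<ge> 0" "(\<integral>\<^sup>+x. ennreal (norm (u x) powr p) * indicator (ball x0 r) x \<partial>lborel) = ennreal U"
      and V: "V \<ge> 0" "(\<integral>\<^sup>+x. ennreal (norm (u x)) * indicator (ball x0 r) x \<partial>lborel) = ennreal V"
      and T: "T \<ge> 0" "(\<integral>\<^sup>+y. ennreal (norm (u y) powr (p - 1) * norm (x0 - y) powr (- \<beta>))
        * indicator (- ball x0 r) y \<partial>lborel) = ennreal T"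
      and F: "F \<ge> 0" "(\<integral>\<^sup>+x. ennreal (norm (f x) powr q) * indicator (ball x0 r) x \<partial>lborel) = ennreal F"
    for A :: "real ^ 'n \<Rightarrow> real ^ 'n \<Rightarrow> real" and f u x0 r \<psi> U V T F
  proof -
    have C\<psi>: "\<forall>k. Ck k \<psi>" "compact (supp \<psi>)" using \<psi>t by (auto simp: test_functions_def)
    have \<psi>m[measurable]: "\<psi> \<in> borel_measurable borel"
      using smooth_partial_derivative(4)[OF C\<psi>] by (rule borel_measurable_continuous_onI)
    have supp: "x \<in> ball x0 (r / 2)" if "\<psi> x \<noteq> 0" for x
      using \<psi>s closure_subset[of "{x. \<psi> x \<noteq> 0}"] that by (auto simp: supp_def)
    have half: "ball x0 (r / 2) \<subseteq> ball x0 r" using r by (intro subset_ball) simp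
    define w where "w x = \<psi> x *\<^sub>R u x" for x
    define \<theta> where "\<theta> x = \<psi> x powr p" for x
    define \<phi> where "\<phi> x = \<theta> x *\<^sub>R u x" for x
    have [measurable]: "w \<in> borel_measurable borel" "\<theta> \<in> borel_measurable borel"
      unfolding w_def \<theta>_def by measurable
    have \<phi>m[measurable]: "\<phi> \<in> borel_measurable borel" unfolding \<phi>_def by measurable
    have \<theta>\<psi>: "0 \<le> \<theta> x" "\<theta> x \<le> \<psi> x" for x
    proof -
      show "0 \<le> \<theta> x" by (simp add: \<theta>_def)
      show "\<theta> x \<le> \<psi> x"
      proof (cases "\<psi> x = 0")
        case False
        then show ?thesis using powr_mono'[of 1 p "\<psi> x"] \<psi>b[of x] p by (simp add: \<theta>_def)
      qed (use p in \<open>simp add: \<theta>_def\<close>)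
    qed
    \<comment> \<open>As 0 \<le> \<psi> \<le> 1, the power \<psi> powr p inherits a Lipschitz bound
      from \<psi> with the additional factor p; hence the test function has a finite seminorm
      too.\<close>
    have \<theta>L: "\<bar>\<theta> x - \<theta> y\<bar> \<le> (p * (L / r)) * norm (x - y)" for x y
    proof -
      have *: "\<bar>\<psi> x powr p - \<psi> y powr p\<bar> \<le> p * \<bar>\<psi> x - \<psi> y\<bar>" if "\<psi> y \<le> \<psi> x" for x y
      proof -
        have "\<psi> y powr p \<le> \<psi> x powr p" using that \<psi>b p by (intro powr_mono2) auto
        moreover have "\<psi> x powr p - \<psi> y powr p \<le> p * \<psi> x powr (p - 1) * (\<psi> x - \<psi> y)"
          using that \<psi>b p by (intro powr_diff_le) auto
        moreover have "p * \<psi> x powr (p - 1) * (\<psi> x - \<psi> y) \<le> p * 1 * (\<psi> x - \<psi> y)"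
          using that \<psi>b[of x] p by (intro mult_right_mono mult_left_mono powr_le1) auto
        ultimately show ?thesis using that by simp
      qed
      have "\<bar>\<theta> x - \<theta> y\<bar> \<le> p * \<bar>\<psi> x - \<psi> y\<bar>"
        using *[of x y] *[of y x] unfolding \<theta>_def by (cases "\<psi> y \<le> \<psi> x") (auto simp: abs_minus_commute)
      also have "\<dots> \<le> p * (L / r * norm (x - y))" using p by (intro mult_left_mono \<psi>L) auto
      finally show ?thesis by simp
    qed
    have p1: "p \<ge> 1" "p > 0" "p > 1" using p by auto
    \<comment> \<open>The finiteness that Korn's inequality presupposes.\<close>
    have wfin: "slobodeckij p s w < \<infinity>"
      unfolding w_def
      by (rule slobodeckij_lipschitz_multiple[OF u \<psi>m p1(1) s(1,2) uLp ufin _ \<psi>L]) (use \<psi>b in auto)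
    have \<phi>fin: "slobodeckij p s \<phi> < \<infinity>"
      unfolding \<phi>_def
      by (rule slobodeckij_lipschitz_multiple[OF u _ p1(1) s(1,2) uLp ufin _ \<theta>L])
        (use \<psi>b \<theta>\<psi> order_trans in \<open>auto simp: abs_le_iff intro: order_trans\<close>)
    have wu: "norm (w x) \<le> norm (u x)" and \<phi>w: "norm (\<phi> x) \<le> norm (w x)" for x
      using \<psi>b[of x] \<theta>\<psi>[of x] by (auto simp: w_def \<phi>_def mult_left_le_one_le mult_right_mono)
    have wLp: "(\<integral>\<^sup>+x. ennreal (norm (w x) powr p) \<partial>lborel) < \<infinity>"
    proof -
      have "(\<integral>\<^sup>+x. ennreal (norm (w x) powr p) \<partial>lborel) \<le> (\<integral>\<^sup>+x. ennreal (norm (u x) powr p) \<partial>lborel)"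
        using wu p1 by (intro nn_integral_mono ennreal_leI powr_mono2) auto
      then show ?thesis using uLp by (rule le_less_trans)
    qed
    obtain \<omega> where \<omega>: "\<omega> \<ge> 0" "slobodeckij p s w = ennreal \<omega>"
      using wfin by (cases "slobodeckij p s w") auto
    obtain X where X: "X \<ge> 0" "projected_slobodeckij p s w = ennreal X"
      using projected_slobodeckij_le[of w p s] p1 wfin
      by (cases "projected_slobodeckij p s w") (auto simp: top_unique)
    have \<omega>X: "\<omega> \<le> CK * X"
      using korn[of w] wfin CK X \<omega> by (simp add: ennreal_mult'[symmetric])
    have wP: "(\<integral>\<^sup>+x. ennreal (norm (w x) powr P) \<partial>lborel) \<le> ennreal (CS * \<omega> powr (d / (d - s * p)))"
      by (rule sob) (use wLp \<omega> in auto)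
    show ?thesis
    proof (cases "(\<integral>\<^sup>+x. ennreal (\<psi> x) \<partial>lborel) = 0")
      case True
      then have "AE x in lborel. \<psi> x = 0"
        by (subst (asm) nn_integral_0_iff_AE) (use \<psi>b in \<open>auto simp: ennreal_eq_0_iff intro: antisym\<close>)
      then have "(\<integral>\<^sup>+x. ennreal (norm (w x)) \<partial>lborel) = 0"
        by (subst nn_integral_0_iff_AE) (auto simp: w_def elim!: AE_mp)
      then have "slobodeckij p s w = 0" using p1 by (intro slobodeckij_AE_zero) auto
      then show ?thesis by (simp add: w_def[abs_def])
    next
      case nz: False
      have \<phi>z: "\<phi> x = 0" if "x \<notin> cball x0 r" for x
      proof -
        have "\<psi> x = 0" using supp[of x] half that by (cases "\<psi> x = 0") auto
        then show ?thesis using p1 by (simp add: \<phi>_def \<theta>_def)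
      qed
      have \<phi>B: "norm (\<phi> x) \<le> norm (w x) * indicator (ball x0 r) x" for x
      proof (cases "\<psi> x = 0")
        case False
        then show ?thesis using \<phi>w[of x] supp[of x] half by auto
      qed (use p1 in \<open>simp add: \<phi>_def \<theta>_def w_def\<close>)
      have \<phi>int: "integrable lborel \<phi>"
      proof (rule integrableI_bounded)
        have "(\<integral>\<^sup>+x. ennreal (norm (\<phi> x)) \<partial>lborel) \<le> (\<integral>\<^sup>+x. ennreal (norm (u x)) * indicator (ball x0 r) x \<partial>lborel)"
        proof (rule nn_integral_mono)
          fix x
          show "ennreal (norm (\<phi> x)) \<le> ennreal (norm (u x)) * indicator (ball x0 r) x"
            using \<phi>B[of x] wu[of x] by (cases "x \<in> ball x0 r") (auto intro!: ennreal_leI)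
        qed
        then show "(\<integral>\<^sup>+x. ennreal (norm (\<phi> x)) \<partial>lborel) < \<infinity>" unfolding V(2) by (auto intro: le_less_trans)
      qed measurable
      have \<phi>P: "(\<integral>\<^sup>+x. ennreal (norm (\<phi> x) powr P) \<partial>lborel) < \<infinity>"
      proof -
        have "(\<integral>\<^sup>+x. ennreal (norm (\<phi> x) powr P) \<partial>lborel) \<le> (\<integral>\<^sup>+x. ennreal (norm (w x) powr P) \<partial>lborel)"
          using \<phi>w ex(3) by (intro nn_integral_mono ennreal_leI powr_mono2) auto
        also have "\<dots> \<le> ennreal (CS * \<omega> powr (d / (d - s * p)))" by (rule wP)
        finally show ?thesis by (auto intro: le_less_trans)
      qed
      have Aabs: "\<bar>A x y\<bar> \<le> \<Lambda>" for x y
        using Ab[of x y] \<Lambda> by (smt (verit) divide_pos_pos)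
      have \<psi>0: "\<psi> x \<ge> 0" for x using \<psi>b by blast
      note wk = weak_formulation_extends[OF A Aabs u ufin f fq p ex(1) ex(2,3,4) r \<psi>t r \<psi>0 nz \<phi>m \<phi>z \<phi>int \<phi>fin \<phi>P weak]
      define E where "E = (LINT x|lborel. f x \<bullet> \<phi> x)"
      \<comment> \<open>Hoelder with the exponents q and P on the ball, then Sobolev for w, then
        Korn to replace \<omega> by X; the result has the exponent 1 / p required by the
        absorption.\<close>
      have Ele: "E \<le> F powr (1 / q) * G * X powr (1 / p)"
      proof -
        have "ennreal (norm E) \<le> (\<integral>\<^sup>+x. ennreal (norm (f x \<bullet> \<phi> x)) \<partial>lborel)"
          unfolding E_def by (rule integral_norm_bound_ennreal[OF wk(2)])
        also have "\<dots> \<le> (\<integral>\<^sup>+x. ennreal ((norm (f x) * indicator (ball x0 r) x) * norm (w x)) \<partial>lborel)"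
        proof (intro nn_integral_mono ennreal_leI)
          fix x
          have "norm (f x \<bullet> \<phi> x) \<le> norm (f x) * norm (\<phi> x)" by (simp add: Cauchy_Schwarz_ineq2)
          also have "\<dots> \<le> norm (f x) * (norm (w x) * indicator (ball x0 r) x)"
            by (intro mult_left_mono \<phi>B) auto
          finally show "norm (f x \<bullet> \<phi> x) \<le> (norm (f x) * indicator (ball x0 r) x) * norm (w x)"
            by (simp add: mult_ac)
        qed
        also have "\<dots> \<le> ennreal (F powr (1 / q) * (CS * \<omega> powr (d / (d - s * p))) powr (1 / P))"
        proof (rule nn_integral_Holder)
          have "(\<integral>\<^sup>+x. ennreal ((norm (f x) * indicator (ball x0 r) x) powr q) \<partial>lborel)
            = (\<integral>\<^sup>+x. ennreal (norm (f x) powr q) * indicator (ball x0 r) x \<partial>lborel)"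
            using ex(2) by (intro nn_integral_cong) (auto simp: indicator_def)
          then show "(\<integral>\<^sup>+x. ennreal ((norm (f x) * indicator (ball x0 r) x) powr q) \<partial>lborel) \<le> ennreal F"
            using F by simp
        qed (use ex F CS wP in auto)
        finally have E1: "E \<le> F powr (1 / q) * (CS * \<omega> powr (d / (d - s * p))) powr (1 / P)" by simp
        have "(CS * \<omega> powr (d / (d - s * p))) powr (1 / P) = CS powr (1 / P) * \<omega> powr (1 / p)"
          using CS ex(6) by (simp add: powr_mult powr_powr)
        also have "\<dots> \<le> CS powr (1 / P) * (CK * X) powr (1 / p)"
          using \<omega> \<omega>X p1 by (intro mult_left_mono powr_mono2) auto
        also have "\<dots> = G * X powr (1 / p)" by (simp only: powr_mult G_def mult.assoc)
        finally have "F powr (1 / q) * (CS * \<omega> powr (d / (d - s * p))) powr (1 / P) \<le> F powr (1 / q) * (G * X powr (1 / p))"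
          by (rule mult_left_mono) simp
        with E1 show ?thesis by (simp only: mult.assoc)
      qed
      define W where "W = r powr (- (s * p)) * U + T * V"
      have W0: "W \<ge> 0" using U V T by (simp add: W_def add_nonneg_nonneg)
      have UW: "r powr (- (s * p)) * U \<le> W" using V T by (simp add: W_def)
      let ?B = "ball x0 r" and ?B' = "ball x0 (r / 2)"
      let ?N = "\<lambda>z. near_remainder p \<beta> ?B \<psi> u (fst z) (snd z)"
      let ?N' = "\<lambda>z. near_remainder p \<beta> ?B \<psi> u (snd z) (fst z)"
      let ?R = "\<lambda>z. far_remainder p \<beta> ?B' ?B u (fst z) (snd z)"
      let ?R' = "\<lambda>z. far_remainder p \<beta> ?B' ?B u (snd z) (fst z)"
      define R where "R z = a1 * (?N z + ?N' z) + \<Lambda> * (?R z + ?R' z)" for z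
      have rem0: "near_remainder p \<beta> ?B \<psi> u x y \<ge> 0" "far_remainder p \<beta> ?B' ?B u x y \<ge> 0" for x y
        by (auto simp: near_remainder_def far_remainder_def intro!: mult_nonneg_nonneg add_nonneg_nonneg)
      have [measurable]: "?N \<in> borel_measurable borel" "?N' \<in> borel_measurable borel"
        "?R \<in> borel_measurable borel" "?R' \<in> borel_measurable borel"
        unfolding near_remainder_def far_remainder_def by measurable
      have [measurable]: "R \<in> borel_measurable borel" unfolding R_def by measurable
      have R0: "R z \<ge> 0" for z
        using rem0 a1 \<Lambda> by (auto simp: R_def intro!: mult_nonneg_nonneg add_nonneg_nonneg)
      have Nle: "(\<integral>\<^sup>+z. ennreal (?N z) \<partial>lborel) \<le> ennreal (CN * W)"
      proof -
        have "CN * (r powr (- (s * p)) * U) \<le> CN * W" using UW CN by (intro mult_left_mono) auto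
        with near[OF u \<psi>m r \<psi>L U] show ?thesis by (rule order_trans[OF _ ennreal_leI])
      qed
      have Rle: "(\<integral>\<^sup>+z. ennreal (?R z) \<partial>lborel) \<le> ennreal (CF * W)"
        unfolding W_def by (rule far[OF u r U V T])
      have N'le: "(\<integral>\<^sup>+z. ennreal (?N' z) \<partial>lborel) \<le> ennreal (CN * W)"
        using Nle nn_integral_lborel_swap[of "\<lambda>z. ennreal (?N z)"] by simp
      have R'le: "(\<integral>\<^sup>+z. ennreal (?R' z) \<partial>lborel) \<le> ennreal (CF * W)"
        using Rle nn_integral_lborel_swap[of "\<lambda>z. ennreal (?R z)"] by simp
      have "(\<integral>\<^sup>+z. ennreal (R z) \<partial>lborel) = (\<integral>\<^sup>+z. ennreal a1 * (ennreal (?N z) + ennreal (?N' z))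
          + ennreal \<Lambda> * (ennreal (?R z) + ennreal (?R' z)) \<partial>lborel)"
        using rem0 a1 \<Lambda> by (intro nn_integral_cong)
          (simp add: R_def ennreal_mult'[symmetric] ennreal_plus[symmetric] add_nonneg_nonneg del: ennreal_plus)
      also have "\<dots> = ennreal a1 * ((\<integral>\<^sup>+z. ennreal (?N z) \<partial>lborel) + (\<integral>\<^sup>+z. ennreal (?N' z) \<partial>lborel))
          + ennreal \<Lambda> * ((\<integral>\<^sup>+z. ennreal (?R z) \<partial>lborel) + (\<integral>\<^sup>+z. ennreal (?R' z) \<partial>lborel))"
        by (simp add: nn_integral_add nn_integral_cmult)
      also have "\<dots> \<le> ennreal a1 * (ennreal (CN * W) + ennreal (CN * W)) + ennreal \<Lambda> * (ennreal (CF * W) + ennreal (CF * W))"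
        by (intro add_mono mult_left_mono Nle N'le Rle R'le) auto
      also have "\<dots> = ennreal (CM * W)"
        using a1 \<Lambda> CN CF W0
        by (simp add: ennreal_mult'[symmetric] ennreal_plus[symmetric] del: ennreal_plus)
          (simp add: CM_def algebra_simps)
      finally have Rint: "(\<integral>\<^sup>+z. ennreal (R z) \<partial>lborel) \<le> ennreal (CM * W)" .
      then have Ri: "integrable lborel R"
        using R0 by (intro integrableI_bounded) (auto simp: le_less_trans[OF _ ennreal_less_top])
      have RW: "(LINT z|lborel. R z) \<le> CM * W"
        using Rint R0 CM W0 by (simp add: integral_eq_nn_integral enn2real_leI)
      have "ennreal (c0 * X) = ennreal c0 * projected_slobodeckij p s w"
        using c0 X by (simp add: ennreal_mult')
      also have "\<dots> = (\<integral>\<^sup>+z. ennreal c0 * ennreal (\<bar>projected_difference w (fst z) (snd z)\<bar> powr p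
          * norm (fst z - snd z) powr (-\<beta>)) \<partial>lborel)"
        using p1 by (simp add: projected_slobodeckij_pair nn_integral_cmult \<beta>_def d_def)
      also have "\<dots> \<le> (\<integral>\<^sup>+z. ennreal (nonlocal_integrand p s A u \<phi> z + R z) \<partial>lborel)"
      proof (rule nn_integral_mono)
        fix z :: "(real ^ 'n) \<times> (real ^ 'n)"
        have "c0 * (\<bar>projected_difference w (fst z) (snd z)\<bar> powr p * norm (fst z - snd z) powr (-\<beta>))
          \<le> nonlocal_integrand p s A u \<phi> z + R z"
          using caccioppoli_pointwise[where A=A and u=u and \<psi>=\<psi> and p=p and s=s and \<Lambda>=\<Lambda> and B'="?B'" and B="?B"
              and x="fst z" and y="snd z", OF p(1) Ab \<Lambda> \<psi>b supp half]
          by (simp add: c0_def R_def a1_def w_def[abs_def] \<phi>_def[abs_def] \<theta>_def \<beta>_def d_def)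
        then show "ennreal c0 * ennreal (\<bar>projected_difference w (fst z) (snd z)\<bar> powr p
          * norm (fst z - snd z) powr (-\<beta>)) \<le> ennreal (nonlocal_integrand p s A u \<phi> z + R z)"
          using c0 by (simp add: ennreal_mult'[symmetric] ennreal_leI)
      qed
      \<comment> \<open>The nonlocal integrand may be negative, but its sum with R dominates a
        nonnegative quantity. Both parts are integrable, so the extended integral is a Bochner
        integral and can be split.\<close>
      also have "\<dots> = ennreal (LINT z|lborel. nonlocal_integrand p s A u \<phi> z + R z)"
      proof (rule nn_integral_eq_integral)
        show "AE z in lborel. 0 \<le> nonlocal_integrand p s A u \<phi> z + R z"
        proof (rule AE_I2)
          fix z :: "(real ^ 'n) \<times> (real ^ 'n)"
          have "0 \<le> 2 powr (-p-1) / \<Lambda> * (\<bar>projected_difference w (fst z) (snd z)\<bar> powr p * norm (fst z - snd z) powr (-\<beta>))"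
            using \<Lambda> by simp
          also have "\<dots> \<le> nonlocal_integrand p s A u \<phi> z + R z"
            using caccioppoli_pointwise[where A=A and u=u and \<psi>=\<psi> and p=p and s=s and \<Lambda>=\<Lambda> and B'="?B'" and B="?B"
                and x="fst z" and y="snd z", OF p(1) Ab \<Lambda> \<psi>b supp half]
            by (simp add: R_def a1_def w_def[abs_def] \<phi>_def[abs_def] \<theta>_def \<beta>_def d_def)
          finally show "0 \<le> nonlocal_integrand p s A u \<phi> z + R z" .
        qed
      qed (intro Bochner_Integration.integrable_add wk(1) Ri)
      also have "(LINT z|lborel. nonlocal_integrand p s A u \<phi> z + R z) = E + (LINT z|lborel. R z)"
        using wk Ri by (simp add: E_def)
      finally have 1: "ennreal (c0 * X) \<le> ennreal (E + (LINT z|lborel. R z))" .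
      have "c0 * X \<le> F powr (1 / q) * G * X powr (1 / p) + CM * W"
      proof -
        have rhs: "0 \<le> F powr (1 / q) * G * X powr (1 / p) + CM * W"
          using G0 CM W0 by (intro add_nonneg_nonneg mult_nonneg_nonneg) auto
        have "E + (LINT z|lborel. R z) \<le> F powr (1 / q) * G * X powr (1 / p) + CM * W"
          using Ele RW by linarith
        then have "ennreal (c0 * X) \<le> ennreal (F powr (1 / q) * G * X powr (1 / p) + CM * W)"
          using 1 ennreal_leI order_trans by blast
        then show ?thesis using rhs by simp
      qed
      from absorb_powr[OF p1(3) ex(1) p(2) c0 G0(1) powr_ge_zero X(1) this]
      have "c0 / 2 * X \<le> G' * (F powr (1 / q)) powr p' + CM * W"
        by (simp add: G'_def)
      also have "(F powr (1 / q)) powr p' = F powr (p' / q)" by (simp add: powr_powr)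
      finally have "X \<le> 2 / c0 * (G' * F powr (p' / q) + CM * W)"
        using c0 by (simp add: field_simps)
      also have "\<dots> \<le> 2 / c0 * ((CM + G') * (W + F powr (p' / q)))"
        using c0 CM G0 W0 by (intro mult_left_mono) (auto simp: algebra_simps)
      finally have "CK * X \<le> CK * (2 / c0 * ((CM + G') * (W + F powr (p' / q))))"
        using CK by (intro mult_left_mono) auto
      also have "\<dots> = CK * (2 / c0) * (CM + G') * (W + F powr (p' / q))" by (simp only: mult.assoc)
      also have "\<dots> \<le> C * (W + F powr (p' / q))"
        using W0 by (intro mult_right_mono) (auto simp: C_def)
      finally have "\<omega> \<le> C * (W + F powr (p' / q))" using \<omega>X by linarith
      then show ?thesis using \<omega> by (simp add: w_def[abs_def] W_def ennreal_leI)
    qed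
  qed
  show thesis
  proof (rule that[OF C], goal_cases)
    case (1 A f u x0 r \<psi> U V T F)
    show ?case
      by (rule main[of A f u r x0 \<psi> U V T F]; (rule 1 | unfold \<beta>_def d_def, rule 1))
  qed
qed

section \<open>From Lebesgue to Borel measurable data\<close>

text \<open>Each coordinate has a Borel representative, and finitely many null sets are discarded at
  once.\<close>

lemma completion_ex_borel_measurable_euclidean:
  fixes g :: "'a \<Rightarrow> 'b::euclidean_space"
  assumes g: "g \<in> borel_measurable (completion M)"
  obtains g' where "g' \<in> borel_measurable M" "AE x in M. g x = g' x"
proof -
  have "\<exists>h\<in>borel_measurable M. AE x in M. g x \<bullet> b = h x" for b
    using g by (intro completion_ex_borel_measurable_real) auto
  then obtain h where h: "\<And>b. h b \<in> borel_measurable M" "\<And>b. AE x in M. g x \<bullet> b = h b x"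
    by metis
  have "AE x in M. \<forall>b\<in>Basis. g x \<bullet> b = h b x"
    using h(2) by (intro AE_finite_allI) auto
  then have "AE x in M. g x = (\<Sum>b\<in>Basis. h b x *\<^sub>R b)"
  proof eventually_elim
    case (elim x)
    have "g x = (\<Sum>b\<in>Basis. (g x \<bullet> b) *\<^sub>R b)" by (simp add: euclidean_representation)
    also have "\<dots> = (\<Sum>b\<in>Basis. h b x *\<^sub>R b)" using elim by (intro sum.cong) auto
    finally show ?case .
  qed
  moreover have "(\<lambda>x. \<Sum>b\<in>Basis. h b x *\<^sub>R b) \<in> borel_measurable M"
    using h(1) by (intro borel_measurable_sum borel_measurable_scaleR) auto
  ultimately show thesis using that by blast
qed

text \<open>Measurability of h comes for free: for a complete measure, a function equal to a Borel
  function almost everywhere is measurable.\<close>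

lemma integral_lebesgue_AE_eq:
  fixes g h :: "'a::euclidean_space \<Rightarrow> real"
  assumes g: "g \<in> borel_measurable borel" and ae: "AE x in lborel. h x = g x"
  shows "integral\<^sup>L lebesgue h = integral\<^sup>L lborel g"
proof -
  have g': "g \<in> borel_measurable lebesgue" using g by (auto intro: measurable_completion)
  have ae': "AE x in lebesgue. g x = h x" using AE_completion[OF ae] by eventually_elim simp
  have h: "h \<in> borel_measurable lebesgue" by (rule borel_measurable_AE[OF g' ae'])
  have "integral\<^sup>L lebesgue h = integral\<^sup>L lebesgue g"
    using ae' by (intro integral_cong_AE h g') auto
  also have "\<dots> = integral\<^sup>L lborel g" using g by (intro integral_completion) auto
  finally show ?thesis .
qed

text \<open>A divergent integral has the Bochner value 0, so finiteness is what lets the real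
  integrals of the statement stand for the extended ones of the estimates.\<close>

lemma set_integral_lebesgue_AE_eq:
  fixes g h :: "'a::euclidean_space \<Rightarrow> real"
  assumes g[measurable]: "g \<in> borel_measurable borel" and S[measurable]: "S \<in> sets borel"
    and ae: "AE x in lborel. h x = g x" and g0: "\<And>x. g x \<ge> 0"
    and fin: "(\<integral>\<^sup>+x. ennreal (g x) * indicator S x \<partial>lborel) < \<infinity>"
  shows "(LINT x:S|lebesgue. h x) \<ge> 0"
    and "(\<integral>\<^sup>+x. ennreal (g x) * indicator S x \<partial>lborel) = ennreal (LINT x:S|lebesgue. h x)"
proof -
  have "(LINT x:S|lebesgue. h x) = (LINT x|lborel. indicator S x *\<^sub>R g x)"
    unfolding set_lebesgue_integral_def using ae by (intro integral_lebesgue_AE_eq) auto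
  also have "\<dots> = enn2real (\<integral>\<^sup>+x. ennreal (indicator S x *\<^sub>R g x) \<partial>lborel)"
    using g0 by (intro integral_eq_nn_integral) auto
  also have "(\<integral>\<^sup>+x. ennreal (indicator S x *\<^sub>R g x) \<partial>lborel) = (\<integral>\<^sup>+x. ennreal (g x) * indicator S x \<partial>lborel)"
    by (intro nn_integral_cong) (auto simp: indicator_def)
  finally have eq: "(LINT x:S|lebesgue. h x) = enn2real (\<integral>\<^sup>+x. ennreal (g x) * indicator S x \<partial>lborel)" .
  show "(LINT x:S|lebesgue. h x) \<ge> 0" unfolding eq by simp
  show "(\<integral>\<^sup>+x. ennreal (g x) * indicator S x \<partial>lborel) = ennreal (LINT x:S|lebesgue. h x)"
    unfolding eq using fin by simp
qed

lemma gagliardo_eq_slobodeckij: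
  fixes v v' :: "real ^ 'n \<Rightarrow> real ^ 'n"
  assumes [measurable]: "v' \<in> borel_measurable borel" and ae: "AE x in lborel. v x = v' x"
  shows "gagliardo s p UNIV v = slobodeckij p s v'"
proof -
  have "gagliardo s p UNIV v = (\<integral>\<^sup>+x. (\<integral>\<^sup>+y. ennreal (norm (v x - v y) powr p * norm (x - y) powr (-(real CARD('n) + s * p))) \<partial>lborel) \<partial>lborel)"
    unfolding gagliardo_def nn_integral_completion powr_minus_divide by simp
  also have "\<dots> = (\<integral>\<^sup>+x. (\<integral>\<^sup>+y. ennreal (norm (v' x - v' y) powr p * norm (x - y) powr (-(real CARD('n) + s * p))) \<partial>lborel) \<partial>lborel)"
  proof (rule nn_integral_cong_AE)
    show "AE x in lborel. (\<integral>\<^sup>+y. ennreal (norm (v x - v y) powr p * norm (x - y) powr (-(real CARD('n) + s * p))) \<partial>lborel)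
      = (\<integral>\<^sup>+y. ennreal (norm (v' x - v' y) powr p * norm (x - y) powr (-(real CARD('n) + s * p))) \<partial>lborel)"
      using ae
    proof eventually_elim
      case (elim x)
      show ?case by (rule nn_integral_cong_AE) (use ae elim in \<open>auto elim!: AE_mp\<close>)
    qed
  qed
  also have "\<dots> = slobodeckij p s v'"
    by (subst slobodeckij_pair) (auto simp: nn_integral_lborel_pair(1))
  finally show ?thesis .
qed

text \<open>Returns from the whole space, where Korn's inequality lives, to the ball.\<close>

lemma gagliardo_mono_set: "gagliardo s p S v \<le> gagliardo s p UNIV v"
  unfolding gagliardo_def
  by (intro nn_integral_mono mult_mono) (auto simp: indicator_def intro!: nn_integral_mono)

section \<open>The energy form on test functions\<close>

lemma test_function_lipschitz:
  fixes \<phi> :: "'a::euclidean_space \<Rightarrow> 'b::euclidean_space"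
  assumes \<phi>: "\<phi> \<in> test_functions S"
  obtains L where "L \<ge> 0" "\<And>x y. norm (\<phi> x - \<phi> y) \<le> L * norm (x - y)"
proof -
  have C: "\<forall>k. Ck k \<phi>" "compact (supp \<phi>)" using \<phi> by (auto simp: test_functions_def)
  note der = smooth_partial_derivative(3)[OF C]
  have "\<exists>B>0. \<forall>x. norm (frechet_derivative \<phi> (at x) b) \<le> B" for b
  proof -
    have c: "continuous_on UNIV (\<lambda>x. frechet_derivative \<phi> (at x) b)"
      by (rule smooth_partial_derivative(4)[OF smooth_partial_derivative(1,2)[OF C]])
    have k: "compact (supp (\<lambda>x. frechet_derivative \<phi> (at x) b))"
      by (rule smooth_partial_derivative(2)[OF C])
    show ?thesis using continuous_compact_supp_bounded[OF c k] by blast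
  qed
  then obtain B where B: "\<And>b. B b > 0" "\<And>b x. norm (frechet_derivative \<phi> (at x) b) \<le> B b" by metis
  define L where "L = (\<Sum>b\<in>Basis. B b)"
  have "norm (\<phi> x - \<phi> y) \<le> L * norm (x - y)" for x y
  proof (rule differentiable_bound[of UNIV \<phi> "\<lambda>x. frechet_derivative \<phi> (at x)"])
    fix q
    have lin: "linear (frechet_derivative \<phi> (at q))" by (rule has_derivative_linear[OF der])
    have "norm (frechet_derivative \<phi> (at q) h) \<le> L * norm h" for h
    proof -
      have "frechet_derivative \<phi> (at q) h = frechet_derivative \<phi> (at q) (\<Sum>b\<in>Basis. (h \<bullet> b) *\<^sub>R b)"
        by (simp add: euclidean_representation)
      also have "\<dots> = (\<Sum>b\<in>Basis. (h \<bullet> b) *\<^sub>R frechet_derivative \<phi> (at q) b)"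
        by (simp add: linear_sum[OF lin] linear_scale[OF lin])
      also have "norm \<dots> \<le> (\<Sum>b\<in>Basis. norm h * B b)"
        by (rule order_trans[OF norm_sum sum_mono]) (auto intro!: mult_mono B Basis_le_norm)
      finally show ?thesis by (simp add: L_def sum_distrib_left mult.commute)
    qed
    then show "onorm (frechet_derivative \<phi> (at q)) \<le> L"
      by (rule onorm_le)
  qed (use der in auto)
  moreover have "L \<ge> 0" unfolding L_def using B(1) by (intro sum_nonneg) (simp add: less_imp_le)
  ultimately show thesis using that by blast
qed

text \<open>For increments shorter than 1 the Lipschitz bound holds on one slightly enlarged ball;
  for longer ones the difference is at most 2 M and lives on a ball and its translate. Either way
  the integral in x is a finite volume times a kernel that is integrable on its range of h.\<close>

lemma slobodeckij_test_function_finite: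
  fixes \<phi> :: "'a::euclidean_space \<Rightarrow> 'b::euclidean_space" and p s :: real
  assumes \<phi>: "\<phi> \<in> test_functions S" and p: "p \<ge> 1" and s: "0 < s" "s < 1"
  shows "slobodeckij p s \<phi> < \<infinity>"
proof -
  define \<beta> where "\<beta> = real DIM('a) + s * p"
  have C: "\<forall>k. Ck k \<phi>" "compact (supp \<phi>)" using \<phi> by (auto simp: test_functions_def)
  have cont: "continuous_on UNIV \<phi>" by (rule smooth_partial_derivative(4)[OF C])
  then have [measurable]: "\<phi> \<in> borel_measurable borel" by (rule borel_measurable_continuous_onI)
  obtain L where L: "L \<ge> 0" "\<And>x y. norm (\<phi> x - \<phi> y) \<le> L * norm (x - y)"
    using test_function_lipschitz[OF \<phi>] by blast
  obtain M where M: "M > 0" "\<And>x. norm (\<phi> x) \<le> M"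
    using continuous_compact_supp_bounded[OF cont C(2)] by blast
  obtain R where R: "R > 0" "\<And>x. x \<in> supp \<phi> \<Longrightarrow> norm x \<le> R"
    using compact_imp_bounded[OF C(2)] unfolding bounded_pos by blast
  have z: "\<phi> x = 0" if "norm x > R" for x
  proof (rule ccontr)
    assume "\<phi> x \<noteq> 0"
    then have "x \<in> supp \<phi>" unfolding supp_def using closure_subset[of "{x. \<phi> x \<noteq> 0}"] by auto
    from R(2)[OF this] that show False by simp
  qed
  obtain C1 where "C1 > 0" and K1: "\<And>R x. R > 0 \<Longrightarrow> (\<integral>\<^sup>+y. ennreal (norm (y - x) powr p * norm (y - x) powr (-\<beta>))
      * indicator (ball x R) y \<partial>(lborel :: 'a measure)) \<le> ennreal (C1 * R powr (p - s * p))"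
    using nn_integral_lipschitz_kernel_near[of p s, where 'a='a] p s unfolding \<beta>_def by auto
  from K1[of 1 0] have C1: "(\<integral>\<^sup>+y. ennreal (norm (y - 0) powr p * norm (y - 0) powr (-\<beta>))
      * indicator (ball 0 1) y \<partial>(lborel :: 'a measure)) \<le> ennreal C1" by simp
  obtain C2 where "C2 > 0" and K2: "\<And>R x. R > 0 \<Longrightarrow> (\<integral>\<^sup>+y. ennreal (norm (y - x) powr (-\<beta>))
      * indicator (- ball x R) y \<partial>(lborel :: 'a measure)) \<le> ennreal (C2 * R powr (- (s * p)))"
    using nn_integral_kernel_far[of p s, where 'a='a] p s unfolding \<beta>_def by auto
  from K2[of 1 0] have C2: "(\<integral>\<^sup>+y. ennreal (norm (y - 0) powr (-\<beta>))
      * indicator (- ball 0 1) y \<partial>(lborel :: 'a measure)) \<le> ennreal C2" by simp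
  let ?K = "emeasure lborel (cball (0::'a) (R + 1))"
  have K: "?K < \<infinity>" using emeasure_lborel_cball_finite[of "0::'a"] by simp
  have inner: "(\<integral>\<^sup>+x. ennreal (norm (\<phi> (x + h) - \<phi> x) powr p * norm h powr (-\<beta>)) \<partial>lborel)
    \<le> ennreal (L powr p) * ?K * (ennreal (norm (h - 0) powr p * norm (h - 0) powr (-\<beta>)) * indicator (ball 0 1) h)
      + ennreal (2 * (2 * M) powr p) * ?K * (ennreal (norm (h - 0) powr (-\<beta>)) * indicator (- ball 0 1) h)" for h
  proof (cases "norm h < 1")
    case True
    have "(\<integral>\<^sup>+x. ennreal (norm (\<phi> (x + h) - \<phi> x) powr p * norm h powr (-\<beta>)) \<partial>lborel)
      \<le> (\<integral>\<^sup>+x. ennreal (L powr p * norm h powr p * norm h powr (-\<beta>)) * indicator (cball (0::'a) (R + 1)) x \<partial>lborel)"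
    proof (rule nn_integral_mono)
      fix x
      show "ennreal (norm (\<phi> (x + h) - \<phi> x) powr p * norm h powr (-\<beta>))
        \<le> ennreal (L powr p * norm h powr p * norm h powr (-\<beta>)) * indicator (cball (0::'a) (R + 1)) x"
      proof (cases "norm x \<le> R + 1")
        case in_ball: True
        have "norm (\<phi> (x + h) - \<phi> x) powr p \<le> (L * norm h) powr p"
          using L(2)[of "x + h" x] p by (intro powr_mono2) auto
        then have "norm (\<phi> (x + h) - \<phi> x) powr p * norm h powr (-\<beta>) \<le> L powr p * norm h powr p * norm h powr (-\<beta>)"
          unfolding powr_mult by (rule mult_right_mono) simp
        then show ?thesis using in_ball by (simp add: ennreal_leI)
      next
        case False
        have "norm x \<le> norm (x + h) + norm h" using norm_triangle_ineq4[of "x + h" h] by simp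
        then have "\<phi> x = 0" "\<phi> (x + h) = 0" using False True z[of x] z[of "x + h"] by auto
        then show ?thesis using p by simp
      qed
    qed
    also have "\<dots> = ennreal (L powr p * norm h powr p * norm h powr (-\<beta>)) * ?K"
      by (rule nn_integral_cmult_indicator) simp
    also have "\<dots> = ennreal (L powr p) * ?K * (ennreal (norm h powr p * norm h powr (-\<beta>)) * indicator (ball 0 1) h)"
      using True by (simp add: ennreal_mult' mult_ac)
    finally show ?thesis using True by simp
  next
    case False
    have "(\<integral>\<^sup>+x. ennreal (norm (\<phi> (x + h) - \<phi> x) powr p * norm h powr (-\<beta>)) \<partial>lborel)
      \<le> (\<integral>\<^sup>+x. ennreal ((2 * M) powr p * norm h powr (-\<beta>)) * (indicator (cball (0::'a) (R + 1)) (x + h) + indicator (cball (0::'a) (R + 1)) x) \<partial>lborel)"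
    proof (rule nn_integral_mono)
      fix x
      show "ennreal (norm (\<phi> (x + h) - \<phi> x) powr p * norm h powr (-\<beta>))
        \<le> ennreal ((2 * M) powr p * norm h powr (-\<beta>)) * (indicator (cball (0::'a) (R + 1)) (x + h) + indicator (cball (0::'a) (R + 1)) x)"
      proof (cases "norm x \<le> R \<or> norm (x + h) \<le> R")
        case True
        have "norm (\<phi> (x + h) - \<phi> x) \<le> 2 * M"
          using norm_triangle_ineq4[of "\<phi> (x + h)" "\<phi> x"] M(2)[of x] M(2)[of "x + h"] by linarith
        then have le: "norm (\<phi> (x + h) - \<phi> x) powr p * norm h powr (-\<beta>) \<le> (2 * M) powr p * norm h powr (-\<beta>)"
          using p by (intro mult_right_mono powr_mono2) auto
        have "ennreal (norm (\<phi> (x + h) - \<phi> x) powr p * norm h powr (-\<beta>)) * 1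
          \<le> ennreal ((2 * M) powr p * norm h powr (-\<beta>)) * (indicator (cball (0::'a) (R + 1)) (x + h) + indicator (cball (0::'a) (R + 1)) x)"
          using True by (intro mult_mono[OF ennreal_leI[OF le]]) (auto simp: indicator_def)
        then show ?thesis by simp
      next
        case False
        then show ?thesis using z[of x] z[of "x + h"] p by auto
      qed
    qed
    also have "\<dots> = ennreal ((2 * M) powr p * norm h powr (-\<beta>)) * ((\<integral>\<^sup>+x. indicator (cball (0::'a) (R + 1)) (x + h) \<partial>lborel) + ?K)"
    proof -
      have [measurable]: "cball (0::'a) (R + 1) \<in> sets borel" by simp
      show ?thesis by (simp add: nn_integral_cmult nn_integral_add)
    qed
    also have "(\<integral>\<^sup>+x. indicator (cball (0::'a) (R + 1)) (x + h) \<partial>lborel) = ?K"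
      by (subst nn_integral_lborel_shift) (auto intro: borel_measurable_indicator)
    also have "ennreal ((2 * M) powr p * norm h powr (-\<beta>)) * (?K + ?K)
      = ennreal (2 * (2 * M) powr p) * ?K * (ennreal (norm h powr (-\<beta>)) * indicator (- ball 0 1) h)"
      using False by (simp add: ennreal_mult' mult_ac mult_2[symmetric])
    finally show ?thesis using False by simp
  qed
  have "slobodeckij p s \<phi> \<le> (\<integral>\<^sup>+h. ennreal (L powr p) * ?K * (ennreal (norm (h - 0) powr p * norm (h - 0) powr (-\<beta>)) * indicator (ball (0::'a) 1) h)
      + ennreal (2 * (2 * M) powr p) * ?K * (ennreal (norm (h - 0) powr (-\<beta>)) * indicator (- ball (0::'a) 1) h) \<partial>lborel)"
    unfolding slobodeckij_def \<beta>_def[symmetric] by (rule nn_integral_mono) (rule inner)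
  also have "\<dots> = ennreal (L powr p) * ?K * (\<integral>\<^sup>+h. ennreal (norm (h - 0) powr p * norm (h - 0) powr (-\<beta>)) * indicator (ball (0::'a) 1) h \<partial>lborel)
      + ennreal (2 * (2 * M) powr p) * ?K * (\<integral>\<^sup>+h. ennreal (norm (h - 0) powr (-\<beta>)) * indicator (- ball (0::'a) 1) h \<partial>lborel)"
    by (subst nn_integral_add, simp, simp, subst nn_integral_cmult, simp, subst nn_integral_cmult) auto
  also have "\<dots> \<le> ennreal (L powr p) * ?K * ennreal C1 + ennreal (2 * (2 * M) powr p) * ?K * ennreal C2"
    by (intro add_mono mult_left_mono C1 C2) auto
  also have "\<dots> < \<infinity>" using K by (simp add: ennreal_mult_less_top)
  finally show ?thesis .
qed

text \<open>The form is an iterated integral of Lebesgue data. The pairing of flux and weighted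
  difference shows that the Borel version is absolutely integrable over pairs, so Fubini turns the
  iterated integral into one over pairs.\<close>

lemma nonlocal_form_eq_integral:
  fixes A A' :: "real ^ 'n \<Rightarrow> real ^ 'n \<Rightarrow> real" and u u' \<phi> :: "real ^ 'n \<Rightarrow> real ^ 'n" and p s p' \<Lambda> :: real
  assumes A'[measurable]: "(\<lambda>z. A' (fst z) (snd z)) \<in> borel_measurable borel" and A'b: "\<And>x y. \<bar>A' x y\<bar> \<le> \<Lambda>"
    and AA: "AE z in lborel. A (fst z) (snd z) = A' (fst z) (snd z)"
    and u'[measurable]: "u' \<in> borel_measurable borel" and uu: "AE x in lborel. u x = u' x"
    and ufin: "slobodeckij p s u' < \<infinity>"
    and p: "p \<ge> 2" "1 / p + 1 / p' = 1" "p' > 1" and s: "0 < s" "s < 1"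
    and \<phi>: "\<phi> \<in> test_functions S"
  shows "nonlocal_form p s A u \<phi> = (LINT z|lborel. nonlocal_integrand p s A' u' \<phi> z)"
proof -
  have C: "\<forall>k. Ck k \<phi>" "compact (supp \<phi>)" using \<phi> by (auto simp: test_functions_def)
  have [measurable]: "\<phi> \<in> borel_measurable borel"
    using smooth_partial_derivative(4)[OF C] by (rule borel_measurable_continuous_onI)
  have p0: "p > 0" "p \<ge> 1" "p > 1" using p by auto
  let ?I = "nonlocal_integrand p s A' u' \<phi>"
  have ni: "?I = (\<lambda>z. flux p p' s A' u' z \<bullet> weighted_difference p s \<phi> z)"
    using nonlocal_integrand_eq[OF p(2)] by blast
  have int: "integrable lborel ?I"
    unfolding ni
  proof (rule integrable_pairing[OF _ _ p(3) p0(3)])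
    show "1 / p' + 1 / p = 1" using p by simp
    have "ennreal (\<Lambda> powr p') * projected_slobodeckij p s u' < \<infinity>"
      using ufin projected_slobodeckij_le[OF u', of p s] p0 by (auto simp: ennreal_mult_less_top)
    then show "(\<integral>\<^sup>+z. ennreal (norm (flux p p' s A' u' z) powr p') \<partial>lborel) < \<infinity>"
      using nn_integral_flux_le[OF A' u' A'b p, of s] by (rule le_less_trans[rotated])
    show "(\<integral>\<^sup>+z. ennreal (norm (weighted_difference p s \<phi> z) powr p) \<partial>lborel) < \<infinity>"
      unfolding nn_integral_weighted_difference[OF \<open>\<phi> \<in> borel_measurable borel\<close> p0(1)]
      using projected_slobodeckij_le[OF \<open>\<phi> \<in> borel_measurable borel\<close> p0(1)]
        slobodeckij_test_function_finite[OF \<phi> p0(2) s] by (rule le_less_trans)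
  qed measurable
  have [measurable]: "?I \<in> borel_measurable borel" using int by auto
  have m2: "?I \<in> borel_measurable (borel \<Otimes>\<^sub>M borel)" by (simp add: borel_prod)
  have sec[measurable]: "(\<lambda>y. ?I (x, y)) \<in> borel_measurable borel" for x
    by (rule measurable_compose[OF _ m2]) measurable
  have outer: "(\<lambda>x. LINT y|lborel. ?I (x, y)) \<in> borel_measurable borel"
    using lborel.borel_measurable_lebesgue_integral[of "\<lambda>x y. ?I (x, y)" borel] m2 by simp
  \<comment> \<open>A null set of pairs has null sections for almost every x, the form needed under
    an iterated integral.\<close>
  have AA2: "AE x in lborel. AE y in lborel. A x y = A' x y"
    using lborel_pair.AE_pair[OF AA[folded lborel_prod]] by simp
  have "nonlocal_form p s A u \<phi> = (LINT x|lborel. LINT y|lborel. ?I (x, y))"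
    unfolding nonlocal_form_def
  proof (rule integral_lebesgue_AE_eq[OF outer])
    show "AE x in lborel. (LINT y|lebesgue. A x y / norm (x - y) powr (real CARD('n) + s * p)
         * \<bar>projected_difference u x y\<bar> powr (p - 2)
         * projected_difference u x y * projected_difference \<phi> x y) = (LINT y|lborel. ?I (x, y))"
      using AA2 uu
    proof eventually_elim
      case (elim x)
      show ?case
      proof (rule integral_lebesgue_AE_eq[OF sec])
        show "AE y in lborel. A x y / norm (x - y) powr (real CARD('n) + s * p)
         * \<bar>projected_difference u x y\<bar> powr (p - 2)
         * projected_difference u x y * projected_difference \<phi> x y = ?I (x, y)"
          using elim(1) uu
          by eventually_elim (use elim(2) in \<open>simp add: nonlocal_integrand_def projected_difference_def\<close>)
      qed
    qed
  qed
  also have "\<dots> = (LINT z|lborel. ?I z)"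
    using lborel_pair.integral_fst'[of ?I] int by (simp add: lborel_prod)
  finally show ?thesis .
qed

section \<open>The Caccioppoli estimate for Lebesgue data\<close>

theorem theorem4p1:
  fixes p p' q s \<Lambda> Cd d :: real
  assumes d: "d = real CARD('n::finite)" "CARD('n) \<ge> 2"
    and p: "p \<ge> 2"
    and p': "1 / p + 1 / p' = 1"
    and q: "q = lower_star_exponent d s p'"
    and s: "0 < s" "s < 1" "s * p < d" "s * p \<noteq> 1"
    and \<Lambda>: "\<Lambda> > 0"
  shows "\<exists>C>0. \<forall>(A :: real ^ 'n \<Rightarrow> real ^ 'n \<Rightarrow> real) (f :: real ^ 'n \<Rightarrow> real ^ 'n)
      (u :: real ^ 'n \<Rightarrow> real ^ 'n) (x0 :: real ^ 'n) (r :: real) (\<psi> :: real ^ 'n \<Rightarrow> real).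
    (\<lambda>(x, y). A x y) \<in> borel_measurable lebesgue \<longrightarrow>
    (\<forall>x y. A x y = A y x) \<longrightarrow>
    (\<forall>x y. 1 / \<Lambda> \<le> A x y \<and> A x y \<le> \<Lambda>) \<longrightarrow>
    in_Lp_loc q f \<longrightarrow>
    u \<in> fractional_sobolev s p \<longrightarrow>
    (\<forall>\<phi> \<in> test_functions UNIV. nonlocal_form p s A u \<phi> = (LINT x|lebesgue. f x \<bullet> \<phi> x)) \<longrightarrow>
    r > 0 \<longrightarrow>
    \<psi> \<in> test_functions (ball x0 r) \<longrightarrow>
    (\<forall>x. 0 \<le> \<psi> x \<and> \<psi> x \<le> 1) \<longrightarrow>
    supp \<psi> \<subseteq> ball x0 (r / 2) \<longrightarrow>
    (\<forall>x. norm (gradient \<psi> x) \<le> Cd / r) \<longrightarrow>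
    gagliardo s p (ball x0 r) (\<lambda>x. \<psi> x *\<^sub>R u x) \<le> ennreal (
      C / r powr (s * p) * (LINT x:ball x0 r|lebesgue. norm (u x) powr p)
      + C * (LINT y:- ball x0 r|lebesgue. norm (u y) powr (p - 1) / norm (x0 - y) powr (d + s * p))
          * (LINT x:ball x0 r|lebesgue. norm (u x))
      + C * r powr (d + s * p')
          * (1 / measure lebesgue (ball x0 r)
              * (LINT x:ball x0 r|lebesgue. norm (f x) powr q)) powr (p' / q))"
proof -
  have p0: "p > 0" "p \<ge> 1" using p by auto
  have sd: "s * p < real CARD('n)" using s d by simp
  have d0: "d > 0" using d by simp
  note ex = conjugate_exponents[OF p p' s(1) s(3) q refl]
  define v where "v = unit_ball_vol d"
  have v: "v > 0" using d0 by (simp add: v_def)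
  define \<beta> where "\<beta> = real CARD('n) + s * p"
  have \<beta>: "\<beta> > 0" using p0 s by (simp add: \<beta>_def add_nonneg_pos)
  \<comment> \<open>The Lipschitz constant has to be nonnegative, while Cd is an arbitrary real
    number; hence its absolute value.\<close>
  obtain C where C: "C > 0" and cacc:
    "\<And>(A :: real ^ 'n \<Rightarrow> real ^ 'n \<Rightarrow> real) f u x0 r \<psi> U V T F.
      (\<lambda>z. A (fst z) (snd z)) \<in> borel_measurable borel \<Longrightarrow> (\<And>x y. 1 / \<Lambda> \<le> A x y \<and> A x y \<le> \<Lambda>) \<Longrightarrow>
      f \<in> borel_measurable borel \<Longrightarrow> (\<integral>\<^sup>+x. ennreal (norm (f x) powr q) \<partial>lborel) < \<infinity> \<Longrightarrow>
      u \<in> borel_measurable borel \<Longrightarrow> (\<integral>\<^sup>+x. ennreal (norm (u x) powr p) \<partial>lborel) < \<infinity> \<Longrightarrow>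
      slobodeckij p s u < \<infinity> \<Longrightarrow> r > 0 \<Longrightarrow>
      (\<And>\<phi>. \<phi> \<in> test_functions UNIV \<Longrightarrow> (\<And>x. x \<notin> cball x0 (2 * r) \<Longrightarrow> \<phi> x = 0) \<Longrightarrow>
        (LINT z|lborel. nonlocal_integrand p s A u \<phi> z) = (LINT x|lborel. f x \<bullet> \<phi> x)) \<Longrightarrow>
      \<psi> \<in> test_functions (ball x0 r) \<Longrightarrow> (\<And>x. 0 \<le> \<psi> x \<and> \<psi> x \<le> 1) \<Longrightarrow>
      supp \<psi> \<subseteq> ball x0 (r / 2) \<Longrightarrow> (\<And>x y. \<bar>\<psi> x - \<psi> y\<bar> \<le> \<bar>Cd\<bar> / r * norm (x - y)) \<Longrightarrow>
      U \<ge> 0 \<Longrightarrow> (\<integral>\<^sup>+x. ennreal (norm (u x) powr p) * indicator (ball x0 r) x \<partial>lborel) = ennreal U \<Longrightarrow>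
      V \<ge> 0 \<Longrightarrow> (\<integral>\<^sup>+x. ennreal (norm (u x)) * indicator (ball x0 r) x \<partial>lborel) = ennreal V \<Longrightarrow>
      T \<ge> 0 \<Longrightarrow> (\<integral>\<^sup>+y. ennreal (norm (u y) powr (p - 1) * norm (x0 - y) powr (- (real CARD('n) + s * p)))
        * indicator (- ball x0 r) y \<partial>lborel) = ennreal T \<Longrightarrow>
      F \<ge> 0 \<Longrightarrow> (\<integral>\<^sup>+x. ennreal (norm (f x) powr q) * indicator (ball x0 r) x \<partial>lborel) = ennreal F \<Longrightarrow>
      slobodeckij p s (\<lambda>x. \<psi> x *\<^sub>R u x) \<le> ennreal (C * (r powr (- (s * p)) * U + T * V + F powr (p' / q)))"
    by (rule caccioppoli_borel[OF p p' s(1,2) sd q[unfolded d(1)] \<Lambda> abs_ge_zero[of Cd]]) blast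
  obtain KF where KF: "KF > 0" "\<And>R x. R > 0 \<Longrightarrow> (\<integral>\<^sup>+y. ennreal (norm (y - x) powr (-\<beta>))
      * indicator (- ball x R) y \<partial>(lborel :: (real^'n) measure)) \<le> ennreal (KF * R powr (- (s * p)))"
    using nn_integral_kernel_far[of p s, where 'a="real^'n"] p0 s unfolding \<beta>_def by auto
  \<comment> \<open>Rewriting F powr (p' / q) with the average over a ball of measure v * r powr d
    costs v powr (p' / q) and yields r powr (d + s p'), because d * (p' / q) = d + s p'.\<close>
  define D where "D = C * (1 + v powr (p' / q))"
  have D: "D > 0" "C \<le> D" using C v by (simp_all add: D_def add_pos_nonneg)
  show ?thesis
  proof (rule exI[of _ D], intro conjI allI impI D(1))
    fix A :: "real ^ 'n \<Rightarrow> real ^ 'n \<Rightarrow> real" and f u :: "real ^ 'n \<Rightarrow> real ^ 'n" and x0 :: "real ^ 'n"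
      and r :: real and \<psi> :: "real ^ 'n \<Rightarrow> real"
    assume Am: "(\<lambda>(x, y). A x y) \<in> borel_measurable lebesgue"
      and Ab: "\<forall>x y. 1 / \<Lambda> \<le> A x y \<and> A x y \<le> \<Lambda>"
      and f: "in_Lp_loc q f" and u: "u \<in> fractional_sobolev s p"
      and weak: "\<forall>\<phi>\<in>test_functions UNIV. nonlocal_form p s A u \<phi> = (LINT x|lebesgue. f x \<bullet> \<phi> x)"
      and r: "r > 0" and \<psi>t: "\<psi> \<in> test_functions (ball x0 r)" and \<psi>b: "\<forall>x. 0 \<le> \<psi> x \<and> \<psi> x \<le> 1"
      and \<psi>s: "supp \<psi> \<subseteq> ball x0 (r / 2)" and \<psi>g: "\<forall>x. norm (gradient \<psi> x) \<le> Cd / r"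
    obtain a where [measurable]: "a \<in> borel_measurable borel" and a: "AE z in lborel. (case z of (x, y) \<Rightarrow> A x y) = a z"
      using completion_ex_borel_measurable_real[OF Am] by auto
    \<comment> \<open>A Borel representative satisfies the ellipticity bounds only almost
      everywhere; clamping its values restores them everywhere without changing them where it agrees
      with A.\<close>
    define A' where "A' x y = max (1 / \<Lambda>) (min \<Lambda> (a (x, y)))" for x y
    have "1 / \<Lambda> \<le> \<Lambda>" using Ab order_trans by blast
    then have A'b: "1 / \<Lambda> \<le> A' x y \<and> A' x y \<le> \<Lambda>" for x y by (auto simp: A'_def)
    have A'abs: "\<bar>A' x y\<bar> \<le> \<Lambda>" for x y
    proof -
      have "0 \<le> A' x y" using A'b[of x y] \<Lambda> by (meson divide_nonneg_pos order_trans zero_le_one)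
      then show ?thesis using A'b[of x y] by simp
    qed
    have A'm: "(\<lambda>z. A' (fst z) (snd z)) \<in> borel_measurable borel" unfolding A'_def by simp
    have AA: "AE z in lborel. A (fst z) (snd z) = A' (fst z) (snd z)"
      using a
    proof eventually_elim
      case (elim z)
      then have "a z = A (fst z) (snd z)" by (simp add: case_prod_unfold)
      then show ?case using Ab by (simp add: A'_def max_absorb2 min_absorb2)
    qed
    have um: "u \<in> borel_measurable lebesgue" and uLp: "(\<integral>\<^sup>+x. ennreal (norm (u x) powr p) \<partial>lebesgue) < \<infinity>"
      and ug: "gagliardo s p UNIV u < \<infinity>"
      using u by (auto simp: fractional_sobolev_def in_Lp_def set_borel_measurable_def)
    obtain u' where u'[measurable]: "u' \<in> borel_measurable borel" and uu: "AE x in lborel. u x = u' x"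
      using completion_ex_borel_measurable_euclidean[OF um] by auto
    have u'Lp: "(\<integral>\<^sup>+x. ennreal (norm (u' x) powr p) \<partial>lborel) < \<infinity>"
    proof -
      have "(\<integral>\<^sup>+x. ennreal (norm (u' x) powr p) \<partial>lborel) = (\<integral>\<^sup>+x. ennreal (norm (u x) powr p) \<partial>lborel)"
        using uu by (intro nn_integral_cong_AE) auto
      then show ?thesis using uLp by (simp add: nn_integral_completion)
    qed
    have u'fin: "slobodeckij p s u' < \<infinity>"
      using ug gagliardo_eq_slobodeckij[OF u' uu, of s p] by simp
    \<comment> \<open>f is only locally integrable, so it is cut off outside a ball that contains
      the supports of all test functions involved.\<close>
    let ?K = "cball x0 (2 * r)"
    have fK: "(\<lambda>x. indicator ?K x *\<^sub>R f x) \<in> borel_measurable lebesgue"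
      and fq: "(\<integral>\<^sup>+x\<in>?K. ennreal (norm (f x) powr q) \<partial>lebesgue) < \<infinity>"
      using f by (auto simp: in_Lp_loc_def in_Lp_def set_borel_measurable_def)
    obtain f' where f'[measurable]: "f' \<in> borel_measurable borel" and ff: "AE x in lborel. indicator ?K x *\<^sub>R f x = f' x"
      using completion_ex_borel_measurable_euclidean[OF fK] by auto
    have f'q: "(\<integral>\<^sup>+x. ennreal (norm (f' x) powr q) \<partial>lborel) < \<infinity>"
    proof -
      have "(\<integral>\<^sup>+x. ennreal (norm (f' x) powr q) \<partial>lborel) = (\<integral>\<^sup>+x\<in>?K. ennreal (norm (f x) powr q) \<partial>lborel)"
      proof (rule nn_integral_cong_AE)
        show "AE x in lborel. ennreal (norm (f' x) powr q) = ennreal (norm (f x) powr q) * indicator ?K x"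
          using ff
        proof eventually_elim
          case (elim x)
          then show ?case using ex(2) by (cases "x \<in> ?K") auto
        qed
      qed
      then show ?thesis using fq by (simp add: nn_integral_completion)
    qed
    have weak': "(LINT z|lborel. nonlocal_integrand p s A' u' \<phi> z) = (LINT x|lborel. f' x \<bullet> \<phi> x)"
      if \<phi>: "\<phi> \<in> test_functions UNIV" and z: "\<And>x. x \<notin> ?K \<Longrightarrow> \<phi> x = 0" for \<phi>
    proof -
      have [measurable]: "\<phi> \<in> borel_measurable borel"
        using \<phi> smooth_partial_derivative(4)[of \<phi>] by (auto simp: test_functions_def intro: borel_measurable_continuous_onI)
      have "(LINT z|lborel. nonlocal_integrand p s A' u' \<phi> z) = nonlocal_form p s A u \<phi>"
        by (rule nonlocal_form_eq_integral[OF A'm A'abs AA u' uu u'fin p p' ex(1) s(1,2) \<phi>, symmetric])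
      also have "\<dots> = (LINT x|lebesgue. f x \<bullet> \<phi> x)" using weak \<phi> by blast
      also have "\<dots> = (LINT x|lborel. f' x \<bullet> \<phi> x)"
      proof (rule integral_lebesgue_AE_eq)
        show "AE x in lborel. f x \<bullet> \<phi> x = f' x \<bullet> \<phi> x"
          using ff
        proof eventually_elim
          case (elim x)
          then show ?case using z[of x] by (cases "x \<in> ?K") auto
        qed
      qed measurable
      finally show ?thesis .
    qed
    have \<psi>L: "\<bar>\<psi> x - \<psi> y\<bar> \<le> \<bar>Cd\<bar> / r * norm (x - y)" for x y
    proof (rule gradient_bound_imp_lipschitz[OF \<psi>t])
      fix x
      have "Cd / r \<le> \<bar>Cd\<bar> / r" using r by (intro divide_right_mono) auto
      then show "norm (gradient \<psi> x) \<le> \<bar>Cd\<bar> / r" using \<psi>g order_trans by blast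
    qed
    have [measurable]: "ball x0 r \<in> sets borel" "- ball x0 r \<in> sets borel" by auto
    define U where "U = (LINT x:ball x0 r|lebesgue. norm (u x) powr p)"
    define V where "V = (LINT x:ball x0 r|lebesgue. norm (u x))"
    define T where "T = (LINT y:- ball x0 r|lebesgue. norm (u y) powr (p - 1) / norm (x0 - y) powr (d + s * p))"
    define F where "F = (LINT x:ball x0 r|lebesgue. norm (f x) powr q)"
    \<comment> \<open>Used with the exponents 1 and p - 1 to derive the finiteness of V and T from
      that of the p-th power integral.\<close>
    have le1: "t powr e \<le> 1 + t powr p" if "0 \<le> e" "e \<le> p" "t \<ge> 0" for t e :: real
    proof (cases "t \<le> 1")
      case True
      then have "t powr e \<le> 1" using that by (intro powr_le1) auto
      then show ?thesis by (simp add: add_increasing2)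
    next
      case False
      then have "t powr e \<le> t powr p" using that by (intro powr_mono) auto
      then show ?thesis by simp
    qed
    have Bfin: "emeasure lborel (ball x0 r) < \<infinity>" by (rule emeasure_lborel_ball_finite)
    have U: "U \<ge> 0" "(\<integral>\<^sup>+x. ennreal (norm (u' x) powr p) * indicator (ball x0 r) x \<partial>lborel) = ennreal U"
    proof -
      have fin: "(\<integral>\<^sup>+x. ennreal (norm (u' x) powr p) * indicator (ball x0 r) x \<partial>lborel) < \<infinity>"
        by (rule le_less_trans[OF nn_integral_mono u'Lp]) (auto simp: indicator_def)
      have ae: "AE x in lborel. norm (u x) powr p = norm (u' x) powr p" using uu by eventually_elim simp
      show "U \<ge> 0" "(\<integral>\<^sup>+x. ennreal (norm (u' x) powr p) * indicator (ball x0 r) x \<partial>lborel) = ennreal U"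
        unfolding U_def by (rule set_integral_lebesgue_AE_eq[OF _ _ ae _ fin]; simp)+
    qed
    have V: "V \<ge> 0" "(\<integral>\<^sup>+x. ennreal (norm (u' x)) * indicator (ball x0 r) x \<partial>lborel) = ennreal V"
    proof -
      have "(\<integral>\<^sup>+x. ennreal (norm (u' x)) * indicator (ball x0 r) x \<partial>lborel)
          \<le> (\<integral>\<^sup>+x. indicator (ball x0 r) x + ennreal (norm (u' x) powr p) \<partial>lborel)"
      proof (rule nn_integral_mono)
        fix x
        have "ennreal (norm (u' x)) \<le> ennreal (1 + norm (u' x) powr p)"
          using le1[of 1 "norm (u' x)"] p0 by (intro ennreal_leI) simp
        then show "ennreal (norm (u' x)) * indicator (ball x0 r) x \<le> indicator (ball x0 r) x + ennreal (norm (u' x) powr p)"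
          by (cases "x \<in> ball x0 r") auto
      qed
      also have "\<dots> = emeasure lborel (ball x0 r) + (\<integral>\<^sup>+x. ennreal (norm (u' x) powr p) \<partial>lborel)"
        by (subst nn_integral_add) auto
      also have "\<dots> < \<infinity>" using Bfin u'Lp by simp
      finally have fin: "(\<integral>\<^sup>+x. ennreal (norm (u' x)) * indicator (ball x0 r) x \<partial>lborel) < \<infinity>" .
      have ae: "AE x in lborel. norm (u x) = norm (u' x)" using uu by eventually_elim simp
      show "V \<ge> 0" "(\<integral>\<^sup>+x. ennreal (norm (u' x)) * indicator (ball x0 r) x \<partial>lborel) = ennreal V"
        unfolding V_def by (rule set_integral_lebesgue_AE_eq[OF _ _ ae _ fin]; simp)+
    qed
    have T: "T \<ge> 0" "(\<integral>\<^sup>+y. ennreal (norm (u' y) powr (p - 1) * norm (x0 - y) powr (- (real CARD('n) + s * p)))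
        * indicator (- ball x0 r) y \<partial>lborel) = ennreal T"
    proof -
      \<comment> \<open>Outside the ball the kernel is both integrable and bounded by r powr
        (-\<beta>); the first property serves the constant 1 and the second the p-th power of
        u'.\<close>
      have "(\<integral>\<^sup>+y. ennreal (norm (u' y) powr (p - 1) * norm (x0 - y) powr (- \<beta>)) * indicator (- ball x0 r) y \<partial>lborel)
        \<le> (\<integral>\<^sup>+y. ennreal (norm (y - x0) powr (-\<beta>)) * indicator (- ball x0 r) y
            + ennreal (r powr (-\<beta>)) * ennreal (norm (u' y) powr p) \<partial>lborel)"
      proof (rule nn_integral_mono)
        fix y
        show "ennreal (norm (u' y) powr (p - 1) * norm (x0 - y) powr (- \<beta>)) * indicator (- ball x0 r) y
          \<le> ennreal (norm (y - x0) powr (-\<beta>)) * indicator (- ball x0 r) y + ennreal (r powr (-\<beta>)) * ennreal (norm (u' y) powr p)"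
        proof (cases "y \<in> ball x0 r")
          case False
          then have "norm (x0 - y) powr (-\<beta>) \<le> r powr (-\<beta>)"
            using r \<beta> by (intro powr_mono2') (auto simp: dist_norm)
          then have "norm (u' y) powr p * norm (x0 - y) powr (-\<beta>) \<le> norm (u' y) powr p * r powr (-\<beta>)"
            by (rule mult_left_mono) simp
          moreover have "norm (u' y) powr (p - 1) * norm (x0 - y) powr (-\<beta>) \<le> (1 + norm (u' y) powr p) * norm (x0 - y) powr (-\<beta>)"
            using p0 by (intro mult_right_mono le1) auto
          ultimately have "norm (u' y) powr (p - 1) * norm (x0 - y) powr (-\<beta>)
              \<le> norm (y - x0) powr (-\<beta>) + r powr (-\<beta>) * norm (u' y) powr p"
            by (simp add: distrib_right norm_minus_commute mult.commute)
          then show ?thesis using False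
            by (simp add: ennreal_mult'[symmetric] ennreal_plus[symmetric] ennreal_leI del: ennreal_plus)
        qed simp
      qed
      also have "\<dots> = (\<integral>\<^sup>+y. ennreal (norm (y - x0) powr (-\<beta>)) * indicator (- ball x0 r) y \<partial>lborel)
          + ennreal (r powr (-\<beta>)) * (\<integral>\<^sup>+y. ennreal (norm (u' y) powr p) \<partial>lborel)"
        by (simp add: nn_integral_add nn_integral_cmult)
      also have "\<dots> < \<infinity>"
        using le_less_trans[OF KF(2)[OF r, of x0] ennreal_less_top] u'Lp by (simp add: ennreal_mult_less_top)
      finally have fin: "(\<integral>\<^sup>+y. ennreal (norm (u' y) powr (p - 1) * norm (x0 - y) powr (- (real CARD('n) + s * p)))
        * indicator (- ball x0 r) y \<partial>lborel) < \<infinity>" by (simp only: \<beta>_def)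
      have ae: "AE y in lborel. norm (u y) powr (p - 1) / norm (x0 - y) powr (d + s * p)
          = norm (u' y) powr (p - 1) * norm (x0 - y) powr (- (real CARD('n) + s * p))"
        using uu by eventually_elim (simp only: powr_minus_divide d(1) times_divide_eq_right mult_1_right)
      show "T \<ge> 0" "(\<integral>\<^sup>+y. ennreal (norm (u' y) powr (p - 1) * norm (x0 - y) powr (- (real CARD('n) + s * p)))
        * indicator (- ball x0 r) y \<partial>lborel) = ennreal T"
        unfolding T_def by (rule set_integral_lebesgue_AE_eq[OF _ _ ae _ fin]; simp)+
    qed
    have F: "F \<ge> 0" "(\<integral>\<^sup>+x. ennreal (norm (f' x) powr q) * indicator (ball x0 r) x \<partial>lborel) = ennreal F"
    proof -
      have fin: "(\<integral>\<^sup>+x. ennreal (norm (f' x) powr q) * indicator (ball x0 r) x \<partial>lborel) < \<infinity>"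
        by (rule le_less_trans[OF nn_integral_mono f'q]) (auto simp: indicator_def)
      have ae: "AE x in lborel. norm (indicator ?K x *\<^sub>R f x) powr q = norm (f' x) powr q"
        using ff by eventually_elim simp
      \<comment> \<open>The cut-off of f does not affect F, since the ball of radius r lies in the
        ball of radius 2 r.\<close>
      have F': "F = (LINT x:ball x0 r|lebesgue. norm (indicator ?K x *\<^sub>R f x) powr q)"
        unfolding F_def set_lebesgue_integral_def using r
        by (intro Bochner_Integration.integral_cong) (auto simp: indicator_def)
      show "F \<ge> 0" "(\<integral>\<^sup>+x. ennreal (norm (f' x) powr q) * indicator (ball x0 r) x \<partial>lborel) = ennreal F"
        unfolding F' by (rule set_integral_lebesgue_AE_eq[OF _ _ ae _ fin]; simp)+
    qed
    have \<psi>b': "0 \<le> \<psi> x \<and> \<psi> x \<le> 1" for x using \<psi>b by blast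
    have [measurable]: "\<psi> \<in> borel_measurable borel"
      using \<psi>t smooth_partial_derivative(4)[of \<psi>] by (auto simp: test_functions_def intro: borel_measurable_continuous_onI)
    have "gagliardo s p (ball x0 r) (\<lambda>x. \<psi> x *\<^sub>R u x) \<le> gagliardo s p UNIV (\<lambda>x. \<psi> x *\<^sub>R u x)"
      by (rule gagliardo_mono_set)
    also have "\<dots> = slobodeckij p s (\<lambda>x. \<psi> x *\<^sub>R u' x)"
      by (rule gagliardo_eq_slobodeckij) (use uu in \<open>auto elim!: AE_mp\<close>)
    also have "\<dots> \<le> ennreal (C * (r powr (- (s * p)) * U + T * V + F powr (p' / q)))"
      by (rule cacc[OF A'm A'b f' f'q u' u'Lp u'fin r weak' \<psi>t \<psi>b' \<psi>s \<psi>L U V T F])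
    also have "\<dots> \<le> ennreal (D / r powr (s * p) * U + D * T * V
        + D * r powr (d + s * p') * (1 / measure lebesgue (ball x0 r) * F) powr (p' / q))"
    proof (rule ennreal_leI)
      have m: "measure lebesgue (ball x0 r) = v * r powr d"
        using r by (simp add: content_ball v_def d(1) powr_realpow)
      have "d * (p' / q) = d + s * p'" unfolding ex(5) using d0 by (simp add: distrib_left)
      then have mp: "(v * r powr d) powr (p' / q) = v powr (p' / q) * r powr (d + s * p')"
        using v by (simp add: powr_mult powr_powr)
      have "F = (v * r powr d) * (1 / measure lebesgue (ball x0 r) * F)"
        unfolding m using v r by simp
      then have "F powr (p' / q) = ((v * r powr d) * (1 / measure lebesgue (ball x0 r) * F)) powr (p' / q)"
        by simp
      also have "\<dots> = v powr (p' / q) * r powr (d + s * p') * (1 / measure lebesgue (ball x0 r) * F) powr (p' / q)"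
        by (simp only: powr_mult[of "v * r powr d"] mp)
      finally have Fp: "F powr (p' / q)
          = v powr (p' / q) * (r powr (d + s * p') * (1 / measure lebesgue (ball x0 r) * F) powr (p' / q))"
        by (simp only: mult.assoc)
      define Y where "Y = r powr (d + s * p') * (1 / measure lebesgue (ball x0 r) * F) powr (p' / q)"
      have Y0: "Y \<ge> 0" by (simp add: Y_def)
      have "C * (r powr (- (s * p)) * U) \<le> D * (r powr (- (s * p)) * U)"
        using D U by (intro mult_right_mono) auto
      moreover have "C * (T * V) \<le> D * (T * V)" using D T V by (intro mult_right_mono) auto
      moreover have "C * F powr (p' / q) \<le> D * Y"
        unfolding Fp Y_def[symmetric] D_def using C Y0 by (simp add: algebra_simps)
      ultimately have "C * (r powr (- (s * p)) * U + T * V + F powr (p' / q))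
          \<le> D * (r powr (- (s * p)) * U) + D * (T * V) + D * Y"
        by (simp add: distrib_left)
      also have "\<dots> = D / r powr (s * p) * U + D * T * V
        + D * r powr (d + s * p') * (1 / measure lebesgue (ball x0 r) * F) powr (p' / q)"
        unfolding Y_def powr_minus_divide by simp
      finally show "C * (r powr (- (s * p)) * U + T * V + F powr (p' / q)) \<le> D / r powr (s * p) * U + D * T * V
        + D * r powr (d + s * p') * (1 / measure lebesgue (ball x0 r) * F) powr (p' / q)" .
    qed
    finally show "gagliardo s p (ball x0 r) (\<lambda>x. \<psi> x *\<^sub>R u x) \<le> ennreal (
      D / r powr (s * p) * (LINT x:ball x0 r|lebesgue. norm (u x) powr p)
      + D * (LINT y:- ball x0 r|lebesgue. norm (u y) powr (p - 1) / norm (x0 - y) powr (d + s * p))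
          * (LINT x:ball x0 r|lebesgue. norm (u x))
      + D * r powr (d + s * p')
          * (1 / measure lebesgue (ball x0 r)
              * (LINT x:ball x0 r|lebesgue. norm (f x) powr q)) powr (p' / q))"
      unfolding U_def V_def T_def F_def .
  qed
qed

end
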